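(* Let $n\ge 2$, let $\gamma$ be the reflection representation of $\mathfrak{S}_n$, and let $p(j)$ denote the number of partitions of the integer $j$. Then \[ K(\gamma)\cong\bigoplus_{i=2}^{p(n)-p(n-1)}\mathbb{Z}/q_i\mathbb{Z},\qquad\text{where}\qquad q_i=\prod_{\substack{1\le j\le n\\ p(j)-p(j-1)\ge i}} j. \] (An empty direct sum is the trivial group.)
   Context: Let $G$ be a finite group with irreducible complex characters $\chi_0,\chi_1,\dots,\chi_\ell$, where $\chi_0$ is the trivial character. For a faithful $d$-dimensional complex representation $\gamma$ of $G$ with character $\chi_\gamma$, let $M=(m_{ij})\in\mathbb{Z}^{(\ell+1)\times(\ell+1)}$ be defined by $\chi_\gamma\cdot\chi_i=\sum_{j=0}^{\ell}m_{ij}\chi_j$. The extended McKay–Cartan matrix is $\tilde C:=dI-M$, and the McKay–Cartan matrix $C$ is the $\ell\times\ell$ matrix obtained from $\tilde C$ by deleting the row and column indexed by $\chi_0$. The critical group of $\gamma$ is $K(\gamma):=\operatorname{coker}(C^t:\mathbb{Z}^\ell\to\mathbb{Z}^\ell)$. The reflection representation of $\mathfrak{S}_n$ is the $(n-1)$-dimensional irreducible representation indexed by the partition $(n-1,1)$, i.e. the permutation representation of $\mathfrak{S}_n$ on $\mathbb{C}^n$ with its trivial summand removed; it is faithful for $n\ge2$. By convention $p(0)=1$. *)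

theory Defs
  imports "HOL-Algebra.Sym_Groups" "HOL-Algebra.Product_Groups" "HOL-Algebra.Elementary_Groups"
    "HOL-Library.Multiset" "Jordan_Normal_Form.Matrix"
begin

definition mat_trace :: "complex mat \<Rightarrow> complex" where
  "mat_trace A = (\<Sum>i<dim_row A. A $$ (i, i))"

definition is_rep :: "('g, 'b) monoid_scheme \<Rightarrow> nat \<Rightarrow> ('g \<Rightarrow> complex mat) \<Rightarrow> bool" where
  "is_rep G d \<rho> \<longleftrightarrow>
     (\<forall>g\<in>carrier G. \<rho> g \<in> carrier_mat d d) \<and>
     (\<forall>g\<in>carrier G. \<forall>h\<in>carrier G. \<rho> (g \<otimes>\<^bsub>G\<^esub> h) = \<rho> g * \<rho> h) \<and>
     \<rho> \<one>\<^bsub>G\<^esub> = 1\<^sub>m d"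

definition invariant_subspace :: "('g, 'b) monoid_scheme \<Rightarrow> nat \<Rightarrow> ('g \<Rightarrow> complex mat) \<Rightarrow> complex vec set \<Rightarrow> bool" where
  "invariant_subspace G d \<rho> W \<longleftrightarrow>
     W \<subseteq> carrier_vec d \<and> 0\<^sub>v d \<in> W \<and>
     (\<forall>v\<in>W. \<forall>w\<in>W. v + w \<in> W) \<and>
     (\<forall>c::complex. \<forall>w\<in>W. c \<cdot>\<^sub>v w \<in> W) \<and>
     (\<forall>g\<in>carrier G. \<forall>w\<in>W. \<rho> g *\<^sub>v w \<in> W)"

definition is_irrep :: "('g, 'b) monoid_scheme \<Rightarrow> nat \<Rightarrow> ('g \<Rightarrow> complex mat) \<Rightarrow> bool" where
  "is_irrep G d \<rho> \<longleftrightarrow> is_rep G d \<rho> \<and> d > 0 \<and>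
     (\<forall>W. invariant_subspace G d \<rho> W \<longrightarrow> W = {0\<^sub>v d} \<or> W = carrier_vec d)"

definition irr_chars :: "('g, 'b) monoid_scheme \<Rightarrow> ('g \<Rightarrow> complex) set" where
  "irr_chars G = {\<chi>. \<exists>d \<rho>. is_irrep G d \<rho> \<and> \<chi> = (\<lambda>g\<in>carrier G. mat_trace (\<rho> g))}"

(* permutation matrix of g acting on C^n, basis indexed by 1..n (shifted to 0..n-1) *)
definition perm_mat :: "nat \<Rightarrow> (nat \<Rightarrow> nat) \<Rightarrow> complex mat" where
  "perm_mat n g = mat n n (\<lambda>(i, j). if g (j + 1) = i + 1 then 1 else 0)"

(* character of the reflection representation of S_n:
   permutation character minus the trivial character *)
definition refl_char :: "nat \<Rightarrow> (nat \<Rightarrow> nat) \<Rightarrow> complex" where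
  "refl_char n = (\<lambda>g\<in>carrier (sym_group n). mat_trace (perm_mat n g) - 1)"

(* critical group coker(C^t : Z^l -> Z^l), the l x l matrix C indexed by {1..l} *)
definition critical_group :: "nat \<Rightarrow> (nat \<Rightarrow> nat \<Rightarrow> int) \<Rightarrow> (nat \<Rightarrow> int) set monoid" where
  "critical_group l C =
     product_group {1..l} (\<lambda>_. integer_group) Mod
       {(\<lambda>i\<in>{1..l}. \<Sum>j=1..l. C j i * x j) | x. x \<in> carrier (product_group {1..l} (\<lambda>_. integer_group))}"

definition npart :: "nat \<Rightarrow> nat" where
  "npart j = card {ms :: nat multiset. (\<forall>x\<in>#ms. x > 0) \<and> sum_mset ms = j}"

definition qfac :: "nat \<Rightarrow> nat \<Rightarrow> nat" where
  "qfac n i = (\<Prod>j\<in>{j. 1 \<le> j \<and> j \<le> n \<and> int (npart j) - int (npart (j - 1)) \<ge> int i}. j)"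

end

theory Submission
  imports Defs "Jordan_Normal_Form.Char_Poly" "HOL-Computational_Algebra.Fundamental_Theorem_Algebra"
    "HOL-Library.Poly_Mapping" "HOL-Combinatorics.Cycles"
begin

text \<open>Write \<open>R\<close> for the representation ring of the symmetric group. Since the regular character is killed by
  \<open>n - \<pi>\<close>, where \<open>\<pi>\<close> is the permutation character, and contains the trivial character once, the critical group
  is the quotient of \<open>R\<close> by the trivial character and the multiples of \<open>n - \<pi>\<close>; this does not depend on a basis.
  The Young permutation characters span \<open>R\<close>, which identifies \<open>R\<close> with the degree \<open>n\<close> part of the polynomial ring
  in \<open>h\<^sub>1, h\<^sub>2, \<dots>\<close>. There multiplication by \<open>\<pi>\<close> is \<open>f \<mapsto> h\<^sub>1 \<partial>f\<close> for the derivation \<open>\<partial> h\<^sub>k = h\<^sub>k\<^sub>-\<^sub>1\<close>. Modulo \<open>h\<^sub>1\<close> one finds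
  a basis of the degree \<open>n\<close> part in which every element is a lift along \<open>\<partial>\<close> of a basis element in degree \<open>n - 1\<close> or is
  killed by \<open>\<partial>\<close>. As \<open>n x = h\<^sub>1 \<partial>x\<close> in the quotient, passing from \<open>n - 1\<close> to \<open>n\<close> multiplies the orders of the old
  generators by \<open>n\<close> and adds new generators of order \<open>n\<close>.\<close>

subsection \<open>Representations and characters\<close>

text \<open>The irreducible characters come in an arbitrary enumeration without explicit models, so
  spanning over the integers is the obstacle. Pairing a permutation character with a sign-twisted
  one counts 0-1 matrices with prescribed row and column sums; for conjugate shapes these numbers
  form a unitriangular matrix, which can be inverted without denominators. A lift along \<partial>
  is determined only up to the kernel, and the lifts must again form a basis modulo h_1. They are
  therefore chosen with a prescribed leading monomial, all errors being pushed into monomials with a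
  larger part. The basis modulo h_1 is indexed by the partitions without parts 1, of which there are
  p(n) - p(n-1). This number does not decrease for n \<ge> 1, so every generator survives to all
  later degrees and collects one factor in each; that is the shape of q_i. The generator with i = 1
  is h_n, the trivial character. It has infinite order and is the one divided out, so the sum starts
  at i = 2.\<close>

lemma mult_mat_entry:
  "A \<in> carrier_mat a b \<Longrightarrow> B \<in> carrier_mat b c \<Longrightarrow> i < a \<Longrightarrow> j < c \<Longrightarrow>
    (A * B) $$ (i, j) = (\<Sum>k<b. A $$ (i, k) * B $$ (k, j))"
  by (auto simp: scalar_prod_def atLeast0LessThan)

lemma mult_mat_vec_entry:
  "A \<in> carrier_mat a b \<Longrightarrow> v \<in> carrier_vec b \<Longrightarrow> i < a \<Longrightarrow>
    (A *\<^sub>v v) $ i = (\<Sum>k<b. A $$ (i, k) * v $ k)"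
  by (auto simp: scalar_prod_def atLeast0LessThan)

lemma mult_mat_unit_vec:
  "A \<in> carrier_mat a b \<Longrightarrow> s < b \<Longrightarrow> A *\<^sub>v unit_vec b s = col (A :: complex mat) s"
proof (rule eq_vecI)
  fix i assume A: "A \<in> carrier_mat a b" "s < b" and "i < dim_vec (col A s)"
  then have i: "i < a" by simp
  have "(A *\<^sub>v unit_vec b s) $ i = (\<Sum>k<b. A $$ (i, k) * unit_vec b s $ k)"
    using A i by (intro mult_mat_vec_entry) auto
  also have "\<dots> = (\<Sum>k<b. if k = s then A $$ (i, s) else 0)"
    using A(2) by (intro sum.cong) auto
  finally show "(A *\<^sub>v unit_vec b s) $ i = col A s $ i" using A i by simp
qed simp

lemma mat_trace_mult_commute:
  assumes "A \<in> carrier_mat a b" "B \<in> carrier_mat b a"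
  shows "mat_trace (A * B) = mat_trace (B * A)"
proof -
  have "mat_trace (A * B) = (\<Sum>i<a. \<Sum>k<b. A $$ (i, k) * B $$ (k, i))"
    using assms by (simp add: mat_trace_def mult_mat_entry del: index_mult_mat(1))
  also have "\<dots> = (\<Sum>k<b. \<Sum>i<a. B $$ (k, i) * A $$ (i, k))"
    by (subst sum.swap) (simp add: mult.commute)
  also have "\<dots> = mat_trace (B * A)"
    using assms by (simp add: mat_trace_def mult_mat_entry del: index_mult_mat(1))
  finally show ?thesis .
qed

lemma rep_carrier: "is_rep G d \<rho> \<Longrightarrow> g \<in> carrier G \<Longrightarrow> \<rho> g \<in> carrier_mat d d"
  and rep_mult: "is_rep G d \<rho> \<Longrightarrow> g \<in> carrier G \<Longrightarrow> h \<in> carrier G \<Longrightarrow> \<rho> (g \<otimes>\<^bsub>G\<^esub> h) = \<rho> g * \<rho> h"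
  and rep_one: "is_rep G d \<rho> \<Longrightarrow> \<rho> \<one>\<^bsub>G\<^esub> = 1\<^sub>m d"
  by (simp_all add: is_rep_def)

lemma rep_mult_entry:
  assumes "is_rep G d \<rho>" "g \<in> carrier G" "h \<in> carrier G" "i < d" "j < d"
  shows "\<rho> (g \<otimes>\<^bsub>G\<^esub> h) $$ (i, j) = (\<Sum>k<d. \<rho> g $$ (i, k) * \<rho> h $$ (k, j))"
  using mult_mat_entry[OF rep_carrier[OF assms(1,2)] rep_carrier[OF assms(1,3)] assms(4,5)] rep_mult[OF assms(1-3)]
  by simp

text \<open>The condition lets the blocks indexed by \<open>X\<close> multiply among themselves. A
  vanishing product covers two cases at once: the right factor is 0 for a subrepresentation, the
  left one for a quotient.\<close>

lemma subrep:
  assumes "group G" "is_rep G d \<rho>" "X \<subseteq> {..<d}"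
    and "\<And>g h a b k. g \<in> carrier G \<Longrightarrow> h \<in> carrier G \<Longrightarrow> a \<in> X \<Longrightarrow> b \<in> X \<Longrightarrow> k \<in> {..<d} - X \<Longrightarrow>
      \<rho> g $$ (a, k) * \<rho> h $$ (k, b) = 0"
  obtains \<sigma> where "is_rep G (card X) \<sigma>"
    "\<And>g. g \<in> carrier G \<Longrightarrow> mat_trace (\<sigma> g) = (\<Sum>x\<in>X. \<rho> g $$ (x, x))"
proof -
  interpret group G by fact
  have "finite X" using assms(3) by (rule finite_subset) simp
  then obtain e where e: "bij_betw e {..<card X} X"
    using ex_bij_betw_nat_finite[of X] by (auto simp: atLeast0LessThan)
  have eX: "e a \<in> X" "e a < d" if "a < card X" for a
    using bij_betwE[OF e] that assms(3) by auto
  have inj: "e a = e b \<longleftrightarrow> a = b" if "a < card X" "b < card X" for a b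
    using e that by (auto simp: bij_betw_def dest: inj_onD)
  define \<sigma> where "\<sigma> g = mat (card X) (card X) (\<lambda>(a, b). \<rho> g $$ (e a, e b))" for g
  have "is_rep G (card X) \<sigma>" unfolding is_rep_def
  proof (intro conjI ballI)
    show "\<sigma> g \<in> carrier_mat (card X) (card X)" for g by (simp add: \<sigma>_def)
    show "\<sigma> \<one>\<^bsub>G\<^esub> = 1\<^sub>m (card X)"
      by (rule eq_matI) (simp_all add: \<sigma>_def rep_one[OF assms(2)] eX inj)
    fix g h assume gh: "g \<in> carrier G" "h \<in> carrier G"
    show "\<sigma> (g \<otimes>\<^bsub>G\<^esub> h) = \<sigma> g * \<sigma> h"
    proof (rule eq_matI)
      fix a b assume "a < dim_row (\<sigma> g * \<sigma> h)" "b < dim_col (\<sigma> g * \<sigma> h)"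
      then have ab: "a < card X" "b < card X" by (simp_all add: \<sigma>_def)
      have "\<sigma> (g \<otimes>\<^bsub>G\<^esub> h) $$ (a, b) = (\<Sum>k<d. \<rho> g $$ (e a, k) * \<rho> h $$ (k, e b))"
        using ab rep_mult_entry[OF assms(2) gh eX(2) eX(2)] by (simp add: \<sigma>_def)
      also have "\<dots> = (\<Sum>k\<in>X. \<rho> g $$ (e a, k) * \<rho> h $$ (k, e b))"
        using assms(3,4) gh eX ab by (intro sum.mono_neutral_right) auto
      also have "\<dots> = (\<Sum>c<card X. \<rho> g $$ (e a, e c) * \<rho> h $$ (e c, e b))"
        using e by (rule sum.reindex_bij_betw[symmetric])
      also have "\<dots> = (\<sigma> g * \<sigma> h) $$ (a, b)"
        using ab by (subst mult_mat_entry[of _ "card X" "card X" _ "card X"]) (simp_all add: \<sigma>_def)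
      finally show "\<sigma> (g \<otimes>\<^bsub>G\<^esub> h) $$ (a, b) = (\<sigma> g * \<sigma> h) $$ (a, b)" .
    qed (simp_all add: \<sigma>_def)
  qed
  moreover have "mat_trace (\<sigma> g) = (\<Sum>x\<in>X. \<rho> g $$ (x, x))" for g
    unfolding mat_trace_def using sum.reindex_bij_betw[OF e, of "\<lambda>x. \<rho> g $$ (x, x)"] by (simp add: \<sigma>_def)
  ultimately show ?thesis using that by blast
qed

lemma rep_conjugate:
  assumes "is_rep G d \<rho>" "P \<in> carrier_mat d d" "Q \<in> carrier_mat d d" "P * Q = 1\<^sub>m d" "Q * P = 1\<^sub>m d"
  shows "is_rep G d (\<lambda>g. Q * (\<rho> g * P))"
    and "g \<in> carrier G \<Longrightarrow> mat_trace (Q * (\<rho> g * P)) = mat_trace (\<rho> g)"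
proof -
  show "is_rep G d (\<lambda>g. Q * (\<rho> g * P))"
    unfolding is_rep_def
  proof (intro conjI ballI)
    fix g assume g: "g \<in> carrier G"
    note cm = mult_carrier_mat[of _ d d _ d] and PQ = assms(2,3)
    have rg: "\<rho> g \<in> carrier_mat d d" using rep_carrier[OF assms(1) g] .
    show "Q * (\<rho> g * P) \<in> carrier_mat d d" by (intro cm rg PQ)
    fix h assume h: "h \<in> carrier G"
    have rh: "\<rho> h \<in> carrier_mat d d" using rep_carrier[OF assms(1) h] .
    have "Q * (\<rho> g * P) * (Q * (\<rho> h * P)) = Q * ((\<rho> g * P) * (Q * (\<rho> h * P)))"
      by (intro assoc_mult_mat[of _ d d _ d _ d] cm rg rh PQ)
    also have "(\<rho> g * P) * (Q * (\<rho> h * P)) = \<rho> g * (P * (Q * (\<rho> h * P)))"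
      by (intro assoc_mult_mat[of _ d d _ d _ d] cm rg rh PQ)
    also have "P * (Q * (\<rho> h * P)) = (P * Q) * (\<rho> h * P)"
      by (intro assoc_mult_mat[symmetric, of _ d d _ d _ d] cm rg rh PQ)
    also have "(P * Q) * (\<rho> h * P) = \<rho> h * P"
      unfolding assms(4) by (intro left_mult_one_mat[of _ d d] cm rh PQ)
    also have "\<rho> g * (\<rho> h * P) = (\<rho> g * \<rho> h) * P"
      by (intro assoc_mult_mat[symmetric, of _ d d _ d _ d] cm rg rh PQ)
    finally show "Q * (\<rho> (g \<otimes>\<^bsub>G\<^esub> h) * P) = Q * (\<rho> g * P) * (Q * (\<rho> h * P))"
      by (simp add: rep_mult[OF assms(1) g h])
  next
    show "Q * (\<rho> \<one>\<^bsub>G\<^esub> * P) = 1\<^sub>m d" using assms by (simp add: rep_one[OF assms(1)])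
  qed
  assume g: "g \<in> carrier G"
  have "mat_trace (Q * (\<rho> g * P)) = mat_trace ((\<rho> g * P) * Q)"
    using assms(2,3) rep_carrier[OF assms(1) g] by (intro mat_trace_mult_commute[of _ d d]) auto
  also have "(\<rho> g * P) * Q = \<rho> g"
    using assms(2-4) rep_carrier[OF assms(1) g] by (simp add: assoc_mult_mat[of _ d d _ d _ d])
  finally show "mat_trace (Q * (\<rho> g * P)) = mat_trace (\<rho> g)" .
qed

text \<open>A basis adapted to the subspace is found by exchanging columns of an invertible matrix for vectors
  of the subspace as long as possible.\<close>

lemma adapted_basis:
  fixes W :: "complex vec set"
  assumes W: "W \<subseteq> carrier_vec d"
  obtains P Q S where "P \<in> carrier_mat d d" "Q \<in> carrier_mat d d" "P * Q = 1\<^sub>m d" "Q * P = 1\<^sub>m d"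
    "S \<subseteq> {..<d}" "\<And>s. s \<in> S \<Longrightarrow> col P s \<in> W"
    "\<And>v i. v \<in> W \<Longrightarrow> i < d \<Longrightarrow> i \<notin> S \<Longrightarrow> (Q *\<^sub>v v) $ i = 0"
proof -
  define good where "good = (\<lambda>(P :: complex mat, Q :: complex mat, S).
    P \<in> carrier_mat d d \<and> Q \<in> carrier_mat d d \<and> P * Q = 1\<^sub>m d \<and> Q * P = 1\<^sub>m d \<and> S \<subseteq> {..<d} \<and> (\<forall>s\<in>S. col P s \<in> W))"
  have "good (1\<^sub>m d, 1\<^sub>m d, {})" by (simp add: good_def)
  moreover have "\<forall>y. good y \<longrightarrow> card (snd (snd y)) < Suc d"
  proof (intro allI impI)
    fix y assume "good y"
    then have "snd (snd y) \<subseteq> {..<d}" by (auto simp: good_def split: prod.splits)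
    then show "card (snd (snd y)) < Suc d" using card_mono[of "{..<d}" "snd (snd y)"] by simp
  qed
  ultimately obtain z where z: "good z" "\<And>y. good y \<Longrightarrow> card (snd (snd y)) \<le> card (snd (snd z))"
    using ex_has_greatest_nat[of good _ "\<lambda>y. card (snd (snd y))" "Suc d"] by blast
  obtain P Q S where zP: "z = (P, Q, S)" by (cases z)
  have g: "P \<in> carrier_mat d d" "Q \<in> carrier_mat d d" "P * Q = 1\<^sub>m d" "Q * P = 1\<^sub>m d" "S \<subseteq> {..<d}"
    "\<And>s. s \<in> S \<Longrightarrow> col P s \<in> W" using z(1) unfolding zP good_def by auto
  have "(Q *\<^sub>v v) $ i = 0" if v: "v \<in> W" "i < d" "i \<notin> S" for v i
  proof (rule ccontr)
    define u where "u = Q *\<^sub>v v"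
    assume "(Q *\<^sub>v v) $ i \<noteq> 0"
    then have c: "u $ i \<noteq> 0" by (simp add: u_def)
    have vd: "v \<in> carrier_vec d" using v W by auto
    have ud: "u \<in> carrier_vec d" using g(2) vd by (simp add: u_def)
    \<comment> \<open>Column \<open>i\<close> of \<open>E\<close> is the coordinate vector of
      \<open>v\<close>, so \<open>P * E\<close> has \<open>v\<close> as column \<open>i\<close> and
      keeps the columns in \<open>S\<close>. \<open>F\<close> is the inverse of \<open>E\<close>; it
      exists because coordinate \<open>i\<close> is nonzero.\<close>
    define E where "E = mat d d (\<lambda>(a, b). if b = i then u $ a else if a = b then 1 else 0)"
    define F where "F = mat d d (\<lambda>(a, b). if b = i then (if a = i then 1 / u $ i else - (u $ a / u $ i)) else if a = b then 1 else 0)"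
    have EF: "E \<in> carrier_mat d d" "F \<in> carrier_mat d d" by (simp_all add: E_def F_def)
    have "E * F = 1\<^sub>m d"
    proof (rule eq_matI)
      fix a b assume "a < dim_row (1\<^sub>m d :: complex mat)" "b < dim_col (1\<^sub>m d :: complex mat)"
      then have ab: "a < d" "b < d" by auto
      have "(E * F) $$ (a, b) = (\<Sum>k<d. E $$ (a, k) * F $$ (k, b))"
        using mult_mat_entry[OF EF ab] .
      also have "\<dots> = (\<Sum>k<d. (if k = i then u $ a * F $$ (i, b) else 0) + (if k = a then (if a = i then 0 else F $$ (a, b)) else 0))"
        using ab v(2) by (intro sum.cong) (auto simp: E_def)
      also have "\<dots> = u $ a * F $$ (i, b) + (if a = i then 0 else F $$ (a, b))"
        using ab v(2) by (simp add: sum.distrib)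
      also have "\<dots> = 1\<^sub>m d $$ (a, b)" using ab v(2) c by (auto simp: F_def)
      finally show "(E * F) $$ (a, b) = 1\<^sub>m d $$ (a, b)" .
    qed (use EF in auto)
    then have FE: "F * E = 1\<^sub>m d" using mat_mult_left_right_inverse[OF EF] by simp
    have "P * E * (F * Q) = P * ((E * F) * Q)" "(F * Q) * (P * E) = F * ((Q * P) * E)"
      using g(1,2) EF by (simp_all add: assoc_mult_mat[of _ d d _ d _ d])
    then have 1: "P * E * (F * Q) = 1\<^sub>m d" "(F * Q) * (P * E) = 1\<^sub>m d"
      using g(1-4) EF FE \<open>E * F = 1\<^sub>m d\<close> by auto
    have "col (P * E) i = v"
    proof -
      have "col E i = u" using v(2) ud by (intro eq_vecI) (auto simp: E_def)
      then have "col (P * E) i = P *\<^sub>v u" using g(1) EF(1) v(2) by simp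
      also have "\<dots> = (P * Q) *\<^sub>v v" using g(1,2) vd by (simp add: u_def)
      finally show ?thesis using g(3) vd by simp
    qed
    moreover have "col (P * E) s = col P s" if "s \<in> S" for s
    proof -
      have s: "s < d" "s \<noteq> i" using that g(5) v(3) by auto
      have "col E s = unit_vec d s" using s by (intro eq_vecI) (auto simp: E_def)
      then have "col (P * E) s = P *\<^sub>v unit_vec d s" using g(1) EF(1) s by simp
      then show ?thesis using g(1) s by (simp add: mult_mat_unit_vec)
    qed
    ultimately have "good (P * E, F * Q, insert i S)"
      using 1 g EF v by (auto simp: good_def)
    from z(2)[OF this] show False using v(3) finite_subset[OF g(5)] by (simp add: zP)
  qed
  then show ?thesis using that g by blast
qed


text \<open>In a basis adapted to an invariant subspace the matrices are block triangular, so the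
  trace is the sum of those of a subrepresentation and a quotient, both of smaller degree. The claim
  is about traces, for which this form suffices.\<close>

lemma rep_decomposition:
  assumes "group G" "is_rep G d \<rho>"
  shows "\<exists>cs. set cs \<subseteq> irr_chars G \<and> (\<forall>g\<in>carrier G. mat_trace (\<rho> g) = (\<Sum>\<chi>\<leftarrow>cs. \<chi> g))"
  using assms(2)
proof (induction d arbitrary: \<rho> rule: less_induct)
  case (less d)
  show ?case
  proof (cases "is_irrep G d \<rho> \<or> d = 0")
    case True
    then show ?thesis
    proof
      assume irr: "is_irrep G d \<rho>"
      then have "(\<lambda>g\<in>carrier G. mat_trace (\<rho> g)) \<in> irr_chars G" by (auto simp: irr_chars_def)
      then show ?thesis by (intro exI[of _ "[\<lambda>g\<in>carrier G. mat_trace (\<rho> g)]"]) simp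
    next
      assume "d = 0"
      then have "mat_trace (\<rho> g) = 0" if "g \<in> carrier G" for g
        using rep_carrier[OF less.prems that] by (simp add: mat_trace_def)
      then show ?thesis by (intro exI[of _ "[]"]) simp
    qed
  next
    case False
    then obtain W where W: "invariant_subspace G d \<rho> W" "W \<noteq> {0\<^sub>v d}" "W \<noteq> carrier_vec d"
      using less.prems by (auto simp: is_irrep_def)
    then have Wc: "W \<subseteq> carrier_vec d" and W0: "0\<^sub>v d \<in> W"
      and Wadd: "\<And>v w. v \<in> W \<Longrightarrow> w \<in> W \<Longrightarrow> v + w \<in> W"
      and Wsm: "\<And>c w. w \<in> W \<Longrightarrow> c \<cdot>\<^sub>v w \<in> W"
      and Winv: "\<And>g w. g \<in> carrier G \<Longrightarrow> w \<in> W \<Longrightarrow> \<rho> g *\<^sub>v w \<in> W"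
      by (auto simp: invariant_subspace_def)
    obtain P Q S where P: "P \<in> carrier_mat d d" "Q \<in> carrier_mat d d" "P * Q = 1\<^sub>m d" "Q * P = 1\<^sub>m d"
      and S: "S \<subseteq> {..<d}" "\<And>s. s \<in> S \<Longrightarrow> col P s \<in> W"
      "\<And>v i. v \<in> W \<Longrightarrow> i < d \<Longrightarrow> i \<notin> S \<Longrightarrow> (Q *\<^sub>v v) $ i = 0"
      using adapted_basis[OF Wc] by metis
    have PQv: "P *\<^sub>v (Q *\<^sub>v v) = v" if "v \<in> carrier_vec d" for v
      using assoc_mult_mat_vec[OF P(1,2) that] P(3) that by simp
    define \<sigma> where "\<sigma> g = Q * (\<rho> g * P)" for g
    have \<sigma>: "is_rep G d \<sigma>" "\<And>g. g \<in> carrier G \<Longrightarrow> mat_trace (\<sigma> g) = mat_trace (\<rho> g)"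
      using rep_conjugate[OF less.prems P] unfolding \<sigma>_def by auto
    have zero: "\<sigma> g $$ (i, s) = 0" if "g \<in> carrier G" "i < d" "i \<notin> S" "s \<in> S" for g i s
    proof -
      have r: "\<rho> g \<in> carrier_mat d d" using rep_carrier[OF less.prems that(1)] .
      have s: "s < d" using S(1) that(4) by auto
      have "\<sigma> g $$ (i, s) = col (\<sigma> g) s $ i" using rep_carrier[OF \<sigma>(1) that(1)] that(2) s by simp
      also have "col (\<sigma> g) s = Q *\<^sub>v col (\<rho> g * P) s"
        unfolding \<sigma>_def by (rule col_mult2[OF P(2) mult_carrier_mat[OF r P(1)] s])
      also have "col (\<rho> g * P) s = \<rho> g *\<^sub>v col P s" by (rule col_mult2[OF r P(1) s])
      finally show ?thesis using S(3)[OF Winv[OF that(1) S(2)[OF that(4)]] that(2,3)] by simp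
    qed
    have "S \<noteq> {}"
    proof
      assume "S = {}"
      have "v = 0\<^sub>v d" if "v \<in> W" for v
      proof -
        have vc: "v \<in> carrier_vec d" using that Wc by auto
        have "Q *\<^sub>v v = 0\<^sub>v d"
        proof (rule eq_vecI)
          fix i assume "i < dim_vec (0\<^sub>v d :: complex vec)"
          then show "(Q *\<^sub>v v) $ i = 0\<^sub>v d $ i" using S(3)[OF that, of i] \<open>S = {}\<close> by simp
        qed (use P(2) in simp)
        then have "v = P *\<^sub>v 0\<^sub>v d" using PQv[OF vc] by simp
        then show ?thesis using P(1) by (intro eq_vecI) auto
      qed
      then have "W = {0\<^sub>v d}" using W0 by blast
      then show False using W(2) by blast
    qed
    moreover have "S \<noteq> {..<d}"
    proof
      assume Sd: "S = {..<d}"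
      have "w \<in> W" if "w \<in> carrier_vec d" for w
      proof -
        define u where "u = Q *\<^sub>v w"
        have u: "u \<in> carrier_vec d" using P(2) that by (simp add: u_def)
        \<comment> \<open>Truncated coordinates: each step adds a multiple of one more column of
          \<open>P\<close>, and all columns lie in \<open>W\<close>.\<close>
        define t where "t k = vec d (\<lambda>i. if i < k then u $ i else 0)" for k
        have t: "t k \<in> carrier_vec d" for k by (simp add: t_def)
        have "P *\<^sub>v t k \<in> W" if "k \<le> d" for k
          using that
        proof (induction k)
          case 0
          have "P *\<^sub>v t 0 = 0\<^sub>v d"
            using P(1) by (intro eq_vecI) (auto simp: t_def mult_mat_vec_entry[OF P(1)] simp del: index_mult_mat_vec)
          then show ?case using W0 by simp
        next
          case (Suc k)
          then have k: "k < d" by simp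
          have "t (Suc k) = t k + u $ k \<cdot>\<^sub>v unit_vec d k"
            by (rule eq_vecI) (auto simp: t_def less_Suc_eq unit_vec_def)
          then have "P *\<^sub>v t (Suc k) = P *\<^sub>v t k + P *\<^sub>v (u $ k \<cdot>\<^sub>v unit_vec d k)"
            using mult_add_distrib_mat_vec[OF P(1) t[of k], of "u $ k \<cdot>\<^sub>v unit_vec d k"] by simp
          also have "P *\<^sub>v (u $ k \<cdot>\<^sub>v unit_vec d k) = u $ k \<cdot>\<^sub>v col P k"
            using mult_mat_vec[OF P(1), of "unit_vec d k" "u $ k"] mult_mat_unit_vec[OF P(1) k] by simp
          finally show ?case using Suc k Sd by (auto intro!: Wadd Wsm S(2))
        qed
        moreover have "t d = u" using u by (intro eq_vecI) (auto simp: t_def)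
        ultimately have "P *\<^sub>v u \<in> W" by auto
        then show ?thesis using PQv[OF that] by (simp add: u_def)
      qed
      then show False using W(3) Wc by auto
    qed
    ultimately have cS: "card S < d" "card ({..<d} - S) < d"
      using S(1) psubset_card_mono[of "{..<d}" S] psubset_card_mono[of "{..<d}" "{..<d} - S"] by auto
    obtain \<sigma>1 where \<sigma>1: "is_rep G (card S) \<sigma>1"
      "\<And>g. g \<in> carrier G \<Longrightarrow> mat_trace (\<sigma>1 g) = (\<Sum>x\<in>S. \<sigma> g $$ (x, x))"
      by (rule subrep[OF assms(1) \<sigma>(1) S(1)]) (use zero in auto)
    obtain \<sigma>2 where \<sigma>2: "is_rep G (card ({..<d} - S)) \<sigma>2"
      "\<And>g. g \<in> carrier G \<Longrightarrow> mat_trace (\<sigma>2 g) = (\<Sum>x\<in>{..<d} - S. \<sigma> g $$ (x, x))"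
      by (rule subrep[OF assms(1) \<sigma>(1), of "{..<d} - S"]) (use zero in auto)
    obtain cs1 where 1: "set cs1 \<subseteq> irr_chars G" "\<And>g. g \<in> carrier G \<Longrightarrow> mat_trace (\<sigma>1 g) = (\<Sum>\<chi>\<leftarrow>cs1. \<chi> g)"
      using less.IH[OF cS(1) \<sigma>1(1)] by blast
    obtain cs2 where 2: "set cs2 \<subseteq> irr_chars G" "\<And>g. g \<in> carrier G \<Longrightarrow> mat_trace (\<sigma>2 g) = (\<Sum>\<chi>\<leftarrow>cs2. \<chi> g)"
      using less.IH[OF cS(2) \<sigma>2(1)] by blast
    have "mat_trace (\<rho> g) = (\<Sum>\<chi>\<leftarrow>cs1 @ cs2. \<chi> g)" if g: "g \<in> carrier G" for g
    proof -
      have "mat_trace (\<rho> g) = (\<Sum>x<d. \<sigma> g $$ (x, x))"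
        using \<sigma>(2)[OF g] rep_carrier[OF \<sigma>(1) g] by (simp add: mat_trace_def)
      also have "\<dots> = (\<Sum>x\<in>S. \<sigma> g $$ (x, x)) + (\<Sum>x\<in>{..<d} - S. \<sigma> g $$ (x, x))"
        using S(1) by (subst sum.subset_diff[of S]) auto
      finally show ?thesis using 1(2)[OF g] 2(2)[OF g] \<sigma>1(2)[OF g] \<sigma>2(2)[OF g] by simp
    qed
    then show ?thesis using 1(1) 2(1) by (intro exI[of _ "cs1 @ cs2"]) auto
  qed
qed

section \<open>Schur's lemma and the orthogonality relations\<close>

lemma invariant_kernel:
  assumes "is_rep G e \<sigma>" "T \<in> carrier_mat d e" "\<And>g. g \<in> carrier G \<Longrightarrow> \<rho> g * T = T * \<sigma> g"
    "\<And>g. g \<in> carrier G \<Longrightarrow> \<rho> g \<in> carrier_mat d d"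
  shows "invariant_subspace G e \<sigma> {v \<in> carrier_vec e. T *\<^sub>v v = 0\<^sub>v d}"
  unfolding invariant_subspace_def
proof (intro conjI ballI allI)
  show "0\<^sub>v e \<in> {v \<in> carrier_vec e. T *\<^sub>v v = 0\<^sub>v d}" using assms(2) by (auto intro!: eq_vecI)
  fix v assume v: "v \<in> {v \<in> carrier_vec e. T *\<^sub>v v = 0\<^sub>v d}"
  show "v + w \<in> {v \<in> carrier_vec e. T *\<^sub>v v = 0\<^sub>v d}" if "w \<in> {v \<in> carrier_vec e. T *\<^sub>v v = 0\<^sub>v d}" for w
    using v that mult_add_distrib_mat_vec[OF assms(2), of v w] by auto
  show "c \<cdot>\<^sub>v v \<in> {v \<in> carrier_vec e. T *\<^sub>v v = 0\<^sub>v d}" for c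
    using v mult_mat_vec[OF assms(2), of v c] by auto
next
  fix g v assume g: "g \<in> carrier G" and v: "v \<in> {v \<in> carrier_vec e. T *\<^sub>v v = 0\<^sub>v d}"
  have "T *\<^sub>v (\<sigma> g *\<^sub>v v) = \<rho> g *\<^sub>v (T *\<^sub>v v)"
    using assoc_mult_mat_vec[OF assms(2) rep_carrier[OF assms(1) g], of v]
      assoc_mult_mat_vec[OF assms(4)[OF g] assms(2), of v] assms(3)[OF g] v by auto
  also have "\<dots> = 0\<^sub>v d" using v assms(4)[OF g] by (auto intro!: eq_vecI)
  finally show "\<sigma> g *\<^sub>v v \<in> {v \<in> carrier_vec e. T *\<^sub>v v = 0\<^sub>v d}"
    using v rep_carrier[OF assms(1) g] by auto
qed auto

lemma invariant_image:
  assumes "is_rep G d \<rho>" "is_rep G e \<sigma>" "T \<in> carrier_mat d e" "\<And>g. g \<in> carrier G \<Longrightarrow> \<rho> g * T = T * \<sigma> g"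
  shows "invariant_subspace G d \<rho> ((\<lambda>v. T *\<^sub>v v) ` carrier_vec e)"
  unfolding invariant_subspace_def
proof (intro conjI ballI allI)
  show "(\<lambda>v. T *\<^sub>v v) ` carrier_vec e \<subseteq> carrier_vec d" using assms(3) by auto
  have "T *\<^sub>v 0\<^sub>v e = 0\<^sub>v d" using assms(3) by (auto intro!: eq_vecI)
  then show "0\<^sub>v d \<in> (\<lambda>v. T *\<^sub>v v) ` carrier_vec e" by (intro image_eqI[of _ _ "0\<^sub>v e"]) auto
  fix v assume "v \<in> (\<lambda>v. T *\<^sub>v v) ` carrier_vec e"
  then obtain x where x: "v = T *\<^sub>v x" "x \<in> carrier_vec e" by auto
  show "v + w \<in> (\<lambda>v. T *\<^sub>v v) ` carrier_vec e" if w: "w \<in> (\<lambda>v. T *\<^sub>v v) ` carrier_vec e" for w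
  proof -
    obtain y where y: "w = T *\<^sub>v y" "y \<in> carrier_vec e" using w by auto
    show ?thesis using mult_add_distrib_mat_vec[OF assms(3) x(2) y(2)] x y by (intro image_eqI[of _ _ "x + y"]) auto
  qed
  show "c \<cdot>\<^sub>v v \<in> (\<lambda>v. T *\<^sub>v v) ` carrier_vec e" for c
    using mult_mat_vec[OF assms(3) x(2), of c] x by (intro image_eqI[of _ _ "c \<cdot>\<^sub>v x"]) auto
next
  fix g v assume g: "g \<in> carrier G" and "v \<in> (\<lambda>v. T *\<^sub>v v) ` carrier_vec e"
  then obtain x where x: "v = T *\<^sub>v x" "x \<in> carrier_vec e" by auto
  have "\<rho> g *\<^sub>v v = T *\<^sub>v (\<sigma> g *\<^sub>v x)"
    using assoc_mult_mat_vec[OF assms(3) rep_carrier[OF assms(2) g] x(2)]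
      assoc_mult_mat_vec[OF rep_carrier[OF assms(1) g] assms(3) x(2)] assms(4)[OF g] x by simp
  then show "\<rho> g *\<^sub>v v \<in> (\<lambda>v. T *\<^sub>v v) ` carrier_vec e"
    using x rep_carrier[OF assms(2) g] by (intro image_eqI[of _ _ "\<sigma> g *\<^sub>v x"]) auto
qed

lemma mat_eq_zeroI:
  assumes "T \<in> carrier_mat d e" "\<And>v. v \<in> carrier_vec e \<Longrightarrow> T *\<^sub>v v = 0\<^sub>v d"
  shows "(T :: complex mat) = 0\<^sub>m d e"
proof (rule eq_matI)
  fix i j assume "i < dim_row (0\<^sub>m d e :: complex mat)" "j < dim_col (0\<^sub>m d e :: complex mat)"
  then have ij: "i < d" "j < e" by auto
  have "col T j = 0\<^sub>v d" using mult_mat_unit_vec[OF assms(1) ij(2)] assms(2)[of "unit_vec e j"] by simp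
  then have "col T j $ i = 0" using ij by simp
  then show "T $$ (i, j) = 0\<^sub>m d e $$ (i, j)" using ij assms(1) by simp
qed (use assms in auto)

text \<open>Kernel and image of \<open>T\<close> are invariant, so a nonzero \<open>T\<close> is
  bijective, and conjugation by it leaves the trace unchanged.\<close>

lemma schur_trace:
  assumes \<rho>: "is_irrep G d \<rho>" and \<sigma>: "is_irrep G e \<sigma>" and T: "T \<in> carrier_mat d e"
    and comm: "\<And>g. g \<in> carrier G \<Longrightarrow> \<rho> g * T = T * \<sigma> g" and "T \<noteq> 0\<^sub>m d e" and g: "g \<in> carrier G"
  shows "mat_trace (\<rho> g) = mat_trace (\<sigma> g)"
proof -
  have r: "is_rep G d \<rho>" "is_rep G e \<sigma>" using \<rho> \<sigma> by (auto simp: is_irrep_def)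
  let ?K = "{v \<in> carrier_vec e. T *\<^sub>v v = 0\<^sub>v d}"
  have "invariant_subspace G e \<sigma> ?K" by (rule invariant_kernel[OF r(2) T comm]) (use rep_carrier[OF r(1)] in auto)
  then have "?K = {0\<^sub>v e} \<or> ?K = carrier_vec e" using \<sigma> unfolding is_irrep_def by blast
  moreover have "?K \<noteq> carrier_vec e" using mat_eq_zeroI[OF T] assms(5) by auto
  ultimately have ker: "?K = {0\<^sub>v e}" by blast
  have "invariant_subspace G d \<rho> ((\<lambda>v. T *\<^sub>v v) ` carrier_vec e)" by (rule invariant_image[OF r T comm])
  then have "(\<lambda>v. T *\<^sub>v v) ` carrier_vec e = {0\<^sub>v d} \<or> (\<lambda>v. T *\<^sub>v v) ` carrier_vec e = carrier_vec d"
    using \<rho> unfolding is_irrep_def by blast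
  moreover have "(\<lambda>v. T *\<^sub>v v) ` carrier_vec e \<noteq> {0\<^sub>v d}" using mat_eq_zeroI[OF T] assms(5) by blast
  ultimately have im: "(\<lambda>v. T *\<^sub>v v) ` carrier_vec e = carrier_vec d" by blast
  have "\<exists>v. v \<in> carrier_vec e \<and> T *\<^sub>v v = unit_vec d j" for j
  proof -
    have "unit_vec d j \<in> (\<lambda>v. T *\<^sub>v v) ` carrier_vec e" unfolding im by simp
    then show ?thesis by auto
  qed
  then obtain b where b: "\<And>j. b j \<in> carrier_vec e" "\<And>j. T *\<^sub>v b j = unit_vec d j" by metis
  \<comment> \<open>Preimages of the unit vectors form a right inverse of \<open>T\<close>. Equality
    of \<open>d\<close> and \<open>e\<close> is not known at this point, so that \<open>B\<close> is
    also a left inverse is deduced from the trivial kernel.\<close>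
  define B where "B = mat e d (\<lambda>(i, j). b j $ i)"
  have B: "B \<in> carrier_mat e d" by (simp add: B_def)
  have colB: "col B j = b j" if "j < d" for j using that b(1)[of j] by (intro eq_vecI) (auto simp: B_def)
  have TB: "T * B = 1\<^sub>m d"
  proof (rule mat_col_eqI)
    fix j assume "j < dim_col (1\<^sub>m d :: complex mat)"
    then have j: "j < d" by simp
    have "col (T * B) j = T *\<^sub>v col B j" using col_mult2[OF T B j] .
    then show "col (T * B) j = col (1\<^sub>m d) j" using colB[OF j] b(2)[of j] j by simp
  qed (use T B in auto)
  have BT: "B * T = 1\<^sub>m e"
  proof (rule mat_col_eqI)
    fix j assume "j < dim_col (1\<^sub>m e :: complex mat)"
    then have j: "j < e" by simp
    have cT: "col T j \<in> carrier_vec d" using T by auto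
    define w where "w = col (B * T) j - unit_vec e j"
    have BTj: "col (B * T) j = B *\<^sub>v col T j" using col_mult2[OF B T j] .
    have c: "col (B * T) j \<in> carrier_vec e" unfolding BTj using B cT by auto
    have w: "w \<in> carrier_vec e" using c by (simp add: w_def)
    have "T *\<^sub>v (w + unit_vec e j) = T *\<^sub>v w + col T j"
      using mult_add_distrib_mat_vec[OF T w, of "unit_vec e j"] mult_mat_unit_vec[OF T j] by simp
    moreover have "w + unit_vec e j = col (B * T) j" using c B by (intro eq_vecI) (auto simp: w_def)
    moreover have "T *\<^sub>v col (B * T) j = col T j"
      using assoc_mult_mat_vec[OF T B cT] cT by (simp add: BTj TB)
    ultimately have "col T j = T *\<^sub>v w + col T j" by simp
    then have "T *\<^sub>v w = 0\<^sub>v d"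
    proof -
      have "(T *\<^sub>v w) $ i = 0" if "i < d" for i
        using arg_cong[OF \<open>col T j = T *\<^sub>v w + col T j\<close>, of "\<lambda>v. v $ i"] that T w
        by (simp del: index_mult_mat_vec)
      then show ?thesis using T by (intro eq_vecI) auto
    qed
    then have "w = 0\<^sub>v e" using ker w by blast
    then have "col (B * T) j = 0\<^sub>v e + unit_vec e j" using \<open>w + unit_vec e j = col (B * T) j\<close> by (simp only:)
    also have "0\<^sub>v e + unit_vec e j = (unit_vec e j :: complex vec)" by simp
    finally show "col (B * T) j = col (1\<^sub>m e) j" using j by simp
  qed (use T B in auto)
  note cc = rep_carrier[OF r(1) g] rep_carrier[OF r(2) g] T B
  have "\<rho> g = \<rho> g * (T * B)" using cc TB by simp
  also have "\<dots> = (\<rho> g * T) * B" using cc by (intro assoc_mult_mat[symmetric, of _ d d _ e _ d]) auto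
  also have "\<dots> = (T * \<sigma> g) * B" using comm[OF g] by simp
  also have "\<dots> = T * (\<sigma> g * B)" using cc by (intro assoc_mult_mat[of _ d e _ e _ d]) auto
  finally have "mat_trace (\<rho> g) = mat_trace (T * (\<sigma> g * B))" by simp
  also have "\<dots> = mat_trace ((\<sigma> g * B) * T)" using cc by (intro mat_trace_mult_commute[of _ d e]) auto
  also have "(\<sigma> g * B) * T = \<sigma> g * (B * T)" using cc by (intro assoc_mult_mat[of _ e e _ d _ e]) auto
  finally show ?thesis using BT cc by simp
qed

text \<open>Over the complex numbers \<open>T\<close> has an eigenvalue \<open>c\<close>; the kernel
  of \<open>T - c\<close> is invariant and nonzero, hence everything.\<close>

lemma schur_scalar:
  assumes \<rho>: "is_irrep G d \<rho>" and T: "T \<in> carrier_mat d d"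
    and comm: "\<And>g. g \<in> carrier G \<Longrightarrow> \<rho> g * T = T * \<rho> g"
  obtains c where "T = c \<cdot>\<^sub>m 1\<^sub>m d"
proof -
  have r: "is_rep G d \<rho>" "d > 0" using \<rho> by (auto simp: is_irrep_def)
  have "\<not> constant (poly (char_poly T))"
    using degree_monic_char_poly[OF T] r(2) by (simp add: constant_degree)
  then obtain c where "poly (char_poly T) c = 0" using fundamental_theorem_of_algebra by blast
  then obtain v where v: "v \<in> carrier_vec d" "v \<noteq> 0\<^sub>v d" "T *\<^sub>v v = c \<cdot>\<^sub>v v"
    using eigenvalue_root_char_poly[OF T] T by (auto simp: eigenvalue_def eigenvector_def)
  define N where "N = T - c \<cdot>\<^sub>m 1\<^sub>m d"
  have N: "N \<in> carrier_mat d d" by (auto simp: N_def intro: minus_carrier_mat)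
  have Nv: "N *\<^sub>v w = T *\<^sub>v w - c \<cdot>\<^sub>v w" if w: "w \<in> carrier_vec d" for w
  proof -
    have "(c \<cdot>\<^sub>m 1\<^sub>m d) *\<^sub>v w = c \<cdot>\<^sub>v w" using w by (intro eq_vecI) auto
    then show ?thesis using minus_mult_distrib_mat_vec[OF T, of "c \<cdot>\<^sub>m 1\<^sub>m d" w] w by (simp add: N_def)
  qed
  have commN: "\<rho> g * N = N * \<rho> g" if g: "g \<in> carrier G" for g
  proof -
    note R = rep_carrier[OF r(1) g]
    have "\<rho> g * N = \<rho> g * T - \<rho> g * (c \<cdot>\<^sub>m 1\<^sub>m d)" unfolding N_def
      by (rule mult_minus_distrib_mat[OF R T]) simp
    moreover have "N * \<rho> g = T * \<rho> g - (c \<cdot>\<^sub>m 1\<^sub>m d) * \<rho> g" unfolding N_def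
      by (rule minus_mult_distrib_mat[OF T _ R]) simp
    moreover have "\<rho> g * (c \<cdot>\<^sub>m 1\<^sub>m d) = c \<cdot>\<^sub>m \<rho> g"
      using mult_smult_distrib[OF R, of "1\<^sub>m d" d c] R by simp
    moreover have "(c \<cdot>\<^sub>m 1\<^sub>m d) * \<rho> g = c \<cdot>\<^sub>m \<rho> g"
      using mult_smult_assoc_mat[of "1\<^sub>m d" d d "\<rho> g" d c] R by simp
    ultimately show ?thesis using comm[OF g] by simp
  qed
  let ?K = "{w \<in> carrier_vec d. N *\<^sub>v w = 0\<^sub>v d}"
  have "invariant_subspace G d \<rho> ?K" by (rule invariant_kernel[OF r(1) N commN]) (use rep_carrier[OF r(1)] in auto)
  then have "?K = {0\<^sub>v d} \<or> ?K = carrier_vec d" using \<rho> unfolding is_irrep_def by blast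
  moreover have "v \<in> ?K" using v Nv[OF v(1)] by auto
  ultimately have "?K = carrier_vec d" using v(2) by blast
  then have "N = 0\<^sub>m d d" using mat_eq_zeroI[OF N] by blast
  have "T = c \<cdot>\<^sub>m 1\<^sub>m d"
  proof (rule eq_matI)
    fix i j assume "i < dim_row (c \<cdot>\<^sub>m 1\<^sub>m d)" "j < dim_col (c \<cdot>\<^sub>m 1\<^sub>m d)"
    then have ij: "i < d" "j < d" by auto
    have "N $$ (i, j) = 0" using \<open>N = 0\<^sub>m d d\<close> ij by simp
    then show "T $$ (i, j) = (c \<cdot>\<^sub>m 1\<^sub>m d) $$ (i, j)" using ij T by (simp add: N_def)
  qed (use T in auto)
  then show ?thesis by (rule that)
qed

text \<open>The sum over the group of \<rho>(g) E \<sigma>(g)^-1, where E is the matrix unit at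
  position (k, l), written out entrywise.\<close>

definition avg where
  "avg G d e \<rho> \<sigma> k l = mat d e (\<lambda>(i, j). \<Sum>g\<in>carrier G. \<rho> g $$ (i, k) * \<sigma> (inv\<^bsub>G\<^esub> g) $$ (l, j) :: complex)"

context
  fixes G :: "('g, 'b) monoid_scheme" (structure)
  assumes G: "group G" and fin: "finite (carrier G)"
begin

interpretation group G by (rule G)

lemma avg_intertwines:
  assumes "is_rep G d \<rho>" "is_rep G e \<sigma>" "k < d" "l < e" and x: "x \<in> carrier G"
  shows "\<rho> x * avg G d e \<rho> \<sigma> k l = avg G d e \<rho> \<sigma> k l * \<sigma> x"
proof (rule eq_matI)
  let ?A = "avg G d e \<rho> \<sigma> k l"
  have A: "?A \<in> carrier_mat d e" by (simp add: avg_def)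
  have R: "\<rho> x \<in> carrier_mat d d" "\<sigma> x \<in> carrier_mat e e" using assms by (auto intro: rep_carrier)
  fix i j assume "i < dim_row (?A * \<sigma> x)" "j < dim_col (?A * \<sigma> x)"
  then have ij: "i < d" "j < e" using A R by auto
  have "(\<rho> x * ?A) $$ (i, j) = (\<Sum>m<d. \<rho> x $$ (i, m) * (\<Sum>g\<in>carrier G. \<rho> g $$ (m, k) * \<sigma> (inv g) $$ (l, j)))"
    using mult_mat_entry[OF R(1) A ij] ij by (simp add: avg_def)
  also have "\<dots> = (\<Sum>g\<in>carrier G. (\<Sum>m<d. \<rho> x $$ (i, m) * \<rho> g $$ (m, k)) * \<sigma> (inv g) $$ (l, j))"
    unfolding sum_distrib_left sum_distrib_right by (subst sum.swap) (simp add: mult.assoc)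
  also have "\<dots> = (\<Sum>g\<in>carrier G. \<rho> (x \<otimes> g) $$ (i, k) * \<sigma> (inv g) $$ (l, j))"
    using rep_mult_entry[OF assms(1) x _ ij(1) assms(3)] by simp
  also have "\<dots> = (\<Sum>g\<in>carrier G. \<rho> g $$ (i, k) * \<sigma> (inv g \<otimes> x) $$ (l, j))"
  proof (rule sum.reindex_bij_witness[of _ "\<lambda>g. inv x \<otimes> g" "\<lambda>g. x \<otimes> g"])
    fix g assume g: "g \<in> carrier G"
    show "inv x \<otimes> (x \<otimes> g) = g" "x \<otimes> g \<in> carrier G" "x \<otimes> (inv x \<otimes> g) = g" "inv x \<otimes> g \<in> carrier G"
      using x g by (simp_all add: m_assoc[symmetric])
    have "inv (x \<otimes> g) \<otimes> x = inv g" using x g by (simp add: inv_mult_group m_assoc)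
    then show "\<rho> (x \<otimes> g) $$ (i, k) * \<sigma> (inv (x \<otimes> g) \<otimes> x) $$ (l, j) = \<rho> (x \<otimes> g) $$ (i, k) * \<sigma> (inv g) $$ (l, j)"
      by simp
  qed
  also have "\<dots> = (\<Sum>g\<in>carrier G. \<rho> g $$ (i, k) * (\<Sum>m<e. \<sigma> (inv g) $$ (l, m) * \<sigma> x $$ (m, j)))"
    using rep_mult_entry[OF assms(2) _ x assms(4) ij(2)] by simp
  also have "\<dots> = (\<Sum>m<e. (\<Sum>g\<in>carrier G. \<rho> g $$ (i, k) * \<sigma> (inv g) $$ (l, m)) * \<sigma> x $$ (m, j))"
    unfolding sum_distrib_left sum_distrib_right by (subst sum.swap) (simp add: mult.assoc)
  also have "\<dots> = (?A * \<sigma> x) $$ (i, j)"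
    using mult_mat_entry[OF A R(2) ij] ij by (simp add: avg_def)
  finally show "(\<rho> x * ?A) $$ (i, j) = (?A * \<sigma> x) $$ (i, j)" .
qed (use assms in \<open>auto simp: avg_def dest: rep_carrier\<close>)

text \<open>Reduces the inner product of two characters to single entries of intertwiners, each of
  which Schur's lemma determines.\<close>

lemma trace_product_avg:
  assumes "is_rep G d \<rho>" "is_rep G e \<sigma>"
  shows "(\<Sum>g\<in>carrier G. mat_trace (\<rho> g) * mat_trace (\<sigma> (inv g)))
    = (\<Sum>i<d. \<Sum>j<e. avg G d e \<rho> \<sigma> i j $$ (i, j))"
proof -
  have "(\<Sum>g\<in>carrier G. mat_trace (\<rho> g) * mat_trace (\<sigma> (inv g)))
      = (\<Sum>g\<in>carrier G. \<Sum>i<d. \<Sum>j<e. \<rho> g $$ (i, i) * \<sigma> (inv g) $$ (j, j))"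
  proof (intro sum.cong refl)
    fix g assume "g \<in> carrier G"
    then have "dim_row (\<rho> g) = d" "dim_row (\<sigma> (inv g)) = e"
      using rep_carrier[OF assms(1), of g] rep_carrier[OF assms(2), of "inv g"] by auto
    then show "mat_trace (\<rho> g) * mat_trace (\<sigma> (inv g)) = (\<Sum>i<d. \<Sum>j<e. \<rho> g $$ (i, i) * \<sigma> (inv g) $$ (j, j))"
      by (simp add: mat_trace_def sum_product)
  qed
  also have "\<dots> = (\<Sum>i<d. \<Sum>j<e. \<Sum>g\<in>carrier G. \<rho> g $$ (i, i) * \<sigma> (inv g) $$ (j, j))"
    by (subst sum.swap) (intro sum.cong refl sum.swap)
  finally show ?thesis by (simp add: avg_def)
qed

lemma irr_orthogonal:
  assumes "is_irrep G d \<rho>" "is_irrep G e \<sigma>" "g \<in> carrier G" "mat_trace (\<rho> g) \<noteq> mat_trace (\<sigma> g)"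
  shows "(\<Sum>g\<in>carrier G. mat_trace (\<rho> g) * mat_trace (\<sigma> (inv g))) = 0"
proof -
  have r: "is_rep G d \<rho>" "is_rep G e \<sigma>" using assms by (auto simp: is_irrep_def)
  have "avg G d e \<rho> \<sigma> i j = 0\<^sub>m d e" if "i < d" "j < e" for i j
  proof (rule ccontr)
    assume "avg G d e \<rho> \<sigma> i j \<noteq> 0\<^sub>m d e"
    then have "mat_trace (\<rho> g) = mat_trace (\<sigma> g)"
      by (intro schur_trace[OF assms(1,2) _ _ _ assms(3), of "avg G d e \<rho> \<sigma> i j"] avg_intertwines[OF r that])
        (simp_all add: avg_def)
    then show False using assms(4) by blast
  qed
  then show ?thesis unfolding trace_product_avg[OF r] by simp
qed

lemma irr_norm:
  assumes "is_irrep G d \<rho>"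
  shows "(\<Sum>g\<in>carrier G. mat_trace (\<rho> g) * mat_trace (\<rho> (inv g))) = of_nat (card (carrier G))"
proof -
  have r: "is_rep G d \<rho>" and d: "d > 0" using assms by (auto simp: is_irrep_def)
  let ?n = "of_nat (card (carrier G)) :: complex"
  have key: "avg G d d \<rho> \<rho> k l $$ (k, l) = (if k = l then ?n / of_nat d else 0)" if kl: "k < d" "l < d" for k l
  proof -
    obtain c where c: "avg G d d \<rho> \<rho> k l = c \<cdot>\<^sub>m 1\<^sub>m d"
      using schur_scalar[OF assms, of "avg G d d \<rho> \<rho> k l"] avg_intertwines[OF r r kl] by (auto simp: avg_def)
    \<comment> \<open>The scalar is found by taking the trace, which collapses each summand to an
      entry of the identity matrix.\<close>
    have "of_nat d * c = (\<Sum>i<d. avg G d d \<rho> \<rho> k l $$ (i, i))" by (simp add: c)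
    also have "\<dots> = (\<Sum>g\<in>carrier G. \<Sum>i<d. \<rho> (inv g) $$ (l, i) * \<rho> g $$ (i, k))"
      by (subst sum.swap) (simp add: avg_def mult.commute)
    also have "\<dots> = (\<Sum>g\<in>carrier G. if k = l then 1 else 0)"
    proof (rule sum.cong[OF refl])
      fix g assume g: "g \<in> carrier G"
      have "(\<Sum>i<d. \<rho> (inv g) $$ (l, i) * \<rho> g $$ (i, k)) = \<rho> (inv g \<otimes> g) $$ (l, k)"
        using rep_mult_entry[OF r _ g kl(2,1), of "inv g"] g by simp
      then show "(\<Sum>i<d. \<rho> (inv g) $$ (l, i) * \<rho> g $$ (i, k)) = (if k = l then 1 else 0)"
        using g kl by (simp add: rep_one[OF r] eq_commute)
    qed
    finally have "of_nat d * c = (if k = l then ?n else 0)" by simp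
    then show ?thesis using d kl unfolding c by (auto simp: field_simps split: if_splits)
  qed
  have "(\<Sum>i<d. \<Sum>j<d. avg G d d \<rho> \<rho> i j $$ (i, j)) = (\<Sum>i<d. \<Sum>j<d. if j = i then ?n / of_nat d else 0)"
    by (intro sum.cong refl) (auto simp: key)
  also have "\<dots> = ?n" using d by simp
  finally show ?thesis unfolding trace_product_avg[OF r r] .
qed

lemma irr_chars_orthonormal:
  assumes "\<chi> \<in> irr_chars G" "\<psi> \<in> irr_chars G"
  shows "(\<Sum>g\<in>carrier G. \<chi> g * \<psi> (inv g)) = (if \<chi> = \<psi> then of_nat (card (carrier G)) else 0)"
proof -
  obtain d \<rho> where \<rho>: "is_irrep G d \<rho>" "\<chi> = (\<lambda>g\<in>carrier G. mat_trace (\<rho> g))"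
    using assms(1) by (auto simp: irr_chars_def)
  obtain e \<sigma> where \<sigma>: "is_irrep G e \<sigma>" "\<psi> = (\<lambda>g\<in>carrier G. mat_trace (\<sigma> g))"
    using assms(2) by (auto simp: irr_chars_def)
  show ?thesis
  proof (cases "\<chi> = \<psi>")
    case True
    then show ?thesis using irr_norm[OF \<rho>(1)] unfolding \<open>\<chi> = \<psi>\<close>[symmetric] \<rho>(2) by simp
  next
    case False
    then obtain g where "g \<in> carrier G" "mat_trace (\<rho> g) \<noteq> mat_trace (\<sigma> g)"
      using \<rho>(2) \<sigma>(2) by (auto simp: fun_eq_iff restrict_def split: if_splits)
    then show ?thesis using irr_orthogonal[OF \<rho>(1) \<sigma>(1)] False \<rho>(2) \<sigma>(2) by simp
  qed
qed

end

text \<open>The positive degree later shows that no irreducible character is orthogonal to the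
  regular one.\<close>

lemma irr_char_one:
  assumes "group G" "\<chi> \<in> irr_chars G" shows "\<exists>d>0. \<chi> \<one>\<^bsub>G\<^esub> = of_nat d"
proof -
  interpret group G by fact
  obtain d \<rho> where \<rho>: "is_irrep G d \<rho>" "\<chi> = (\<lambda>g\<in>carrier G. mat_trace (\<rho> g))"
    using assms(2) by (auto simp: irr_chars_def)
  then have "\<rho> \<one>\<^bsub>G\<^esub> = 1\<^sub>m d" "d > 0" by (auto simp: is_irrep_def is_rep_def)
  then show ?thesis using \<rho>(2) by (intro exI[of _ d]) (simp add: mat_trace_def)
qed

lemma permutation_rep:
  assumes "group G" "finite X"
    and act: "\<And>g x. g \<in> carrier G \<Longrightarrow> x \<in> X \<Longrightarrow> a g x \<in> X"
    and mult: "\<And>g h x. g \<in> carrier G \<Longrightarrow> h \<in> carrier G \<Longrightarrow> x \<in> X \<Longrightarrow> a (g \<otimes>\<^bsub>G\<^esub> h) x = a g (a h x)"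
    and one: "\<And>x. x \<in> X \<Longrightarrow> a \<one>\<^bsub>G\<^esub> x = x"
  shows "\<exists>d \<rho>. is_rep G d \<rho> \<and> (\<forall>g\<in>carrier G. mat_trace (\<rho> g) = of_nat (card {x \<in> X. a g x = x}))"
proof -
  interpret group G by fact
  obtain e where e: "bij_betw e {..<card X} X"
    using ex_bij_betw_nat_finite[OF assms(2)] by (auto simp: atLeast0LessThan)
  have eX: "e i \<in> X" if "i < card X" for i using bij_betwE[OF e] that by auto
  have inj: "e i = e j \<longleftrightarrow> i = j" if "i < card X" "j < card X" for i j
    using e that by (auto simp: bij_betw_def dest: inj_onD)
  let ?d = "card X"
  define \<rho> where "\<rho> g = mat ?d ?d (\<lambda>(i, j). if a g (e j) = e i then 1 else 0 :: complex)" for g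
  have "is_rep G ?d \<rho>" unfolding is_rep_def
  proof (intro conjI ballI)
    show "\<rho> g \<in> carrier_mat ?d ?d" for g by (simp add: \<rho>_def)
    show "\<rho> \<one>\<^bsub>G\<^esub> = 1\<^sub>m ?d" by (rule eq_matI) (auto simp: \<rho>_def one eX inj)
    fix g h assume gh: "g \<in> carrier G" "h \<in> carrier G"
    show "\<rho> (g \<otimes>\<^bsub>G\<^esub> h) = \<rho> g * \<rho> h"
    proof (rule eq_matI)
      fix i j assume "i < dim_row (\<rho> g * \<rho> h)" "j < dim_col (\<rho> g * \<rho> h)"
      then have ij: "i < ?d" "j < ?d" by (simp_all add: \<rho>_def)
      have "a h (e j) \<in> X" using act[OF gh(2) eX[OF ij(2)]] .
      then obtain m where m: "m < ?d" "a h (e j) = e m" using e by (auto simp: bij_betw_def)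
      have "(\<rho> g * \<rho> h) $$ (i, j) = (\<Sum>k<?d. \<rho> g $$ (i, k) * \<rho> h $$ (k, j))"
        using ij by (intro mult_mat_entry) (auto simp: \<rho>_def)
      also have "\<dots> = (\<Sum>k<?d. if k = m then \<rho> g $$ (i, m) else 0)"
        using ij m inj by (intro sum.cong) (auto simp: \<rho>_def)
      also have "\<dots> = \<rho> g $$ (i, m)" using m(1) by simp
      also have "\<dots> = \<rho> (g \<otimes>\<^bsub>G\<^esub> h) $$ (i, j)"
        using ij m mult[OF gh eX[OF ij(2)]] by (simp add: \<rho>_def)
      finally show "\<rho> (g \<otimes>\<^bsub>G\<^esub> h) $$ (i, j) = (\<rho> g * \<rho> h) $$ (i, j)" by simp
    qed (simp_all add: \<rho>_def)
  qed
  moreover have "mat_trace (\<rho> g) = of_nat (card {x \<in> X. a g x = x})" for g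
  proof -
    have "mat_trace (\<rho> g) = (\<Sum>i<?d. if a g (e i) = e i then 1 else 0)" by (simp add: mat_trace_def \<rho>_def)
    also have "\<dots> = (\<Sum>x\<in>X. if a g x = x then 1 else 0)"
      using sum.reindex_bij_betw[OF e, of "\<lambda>x. if a g x = x then 1 else (0 :: complex)"] by simp
    also have "\<dots> = of_nat (card {x \<in> X. a g x = x})" using assms(2) by (simp add: sum.If_cases Int_def)
    finally show ?thesis .
  qed
  ultimately show ?thesis by blast
qed

subsection \<open>Unitriangular integer matrices\<close>

text \<open>Triangularity is expressed by a weight that drops off the diagonal, so no linear order
  is needed on \<open>I\<close>. The equation of column \<open>k\<close> involves, besides
  \<open>c k\<close>, only coefficients of larger weight; the induction descends from the largest
  weight. The case \<open>N = 0\<close> is linear independence.\<close>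

lemma unitriangular_dvd:
  fixes A :: "'a \<Rightarrow> 'a \<Rightarrow> int" and w :: "'a \<Rightarrow> int"
  assumes "finite I" and "\<And>i. i \<in> I \<Longrightarrow> A i i = 1"
    and "\<And>i j. i \<in> I \<Longrightarrow> j \<in> I \<Longrightarrow> i \<noteq> j \<Longrightarrow> A i j \<noteq> 0 \<Longrightarrow> w j < w i"
    and "\<And>j. j \<in> I \<Longrightarrow> N dvd (\<Sum>i\<in>I. c i * A i j)"
    and "k \<in> I"
  shows "N dvd c k"
  using assms(5)
proof (induction "nat (Max (w ` I) - w k)" arbitrary: k rule: less_induct)
  case less
  have "N dvd c i * A i k" if "i \<in> I - {k}" for i
  proof (cases "A i k = 0")
    case False
    have "w k < w i" using that less.prems assms(3)[OF _ _ _ False] by blast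
    moreover have "w i \<le> Max (w ` I)" using that assms(1) by simp
    ultimately have "N dvd c i" by (intro less.hyps) (use that in simp_all)
    then show ?thesis by (rule dvd_mult2)
  qed simp
  then have "N dvd (\<Sum>i\<in>I - {k}. c i * A i k)" by (rule dvd_sum)
  moreover have "(\<Sum>i\<in>I. c i * A i k) = c k + (\<Sum>i\<in>I - {k}. c i * A i k)"
    by (subst sum.remove[OF assms(1) less.prems]) (simp add: assms(2)[OF less.prems])
  ultimately show ?case using assms(4)[OF less.prems] by (simp add: dvd_add_left_iff)
qed

text \<open>The row of an index of least weight vanishes off the diagonal, so its unknown can be
  chosen last without disturbing the other equations.\<close>

lemma unitriangular_solve:
  fixes A :: "'a \<Rightarrow> 'a \<Rightarrow> int" and w :: "'a \<Rightarrow> int"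
  assumes "finite I" and "\<And>i. i \<in> I \<Longrightarrow> A i i = 1"
    and "\<And>i j. i \<in> I \<Longrightarrow> j \<in> I \<Longrightarrow> i \<noteq> j \<Longrightarrow> A i j \<noteq> 0 \<Longrightarrow> w j < w i"
  shows "\<exists>x. \<forall>j\<in>I. (\<Sum>i\<in>I. x i * A i j) = a j"
  using assms
proof (induction "card I" arbitrary: I)
  case (Suc m)
  then have fin: "finite I" and ne: "I \<noteq> {}" by auto
  define k where "k = arg_min_on w I"
  have k: "k \<in> I" "\<And>i. i \<in> I \<Longrightarrow> w k \<le> w i"
    using arg_min_if_finite[OF fin ne, of w] unfolding k_def by (auto simp: not_less)
  have "\<exists>x. \<forall>j\<in>I - {k}. (\<Sum>i\<in>I - {k}. x i * A i j) = a j"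
    using Suc k by (intro Suc.hyps(1)) auto
  then obtain x where x: "\<And>j. j \<in> I - {k} \<Longrightarrow> (\<Sum>i\<in>I - {k}. x i * A i j) = a j" by blast
  define y where "y = x(k := a k - (\<Sum>i\<in>I - {k}. x i * A i k))"
  have *: "(\<Sum>i\<in>I. y i * A i j) = y k * A k j + (\<Sum>i\<in>I - {k}. x i * A i j)" for j
    using fin k(1) by (subst sum.remove[of _ k]) (auto simp: y_def intro!: sum.cong)
  have "(\<Sum>i\<in>I. y i * A i j) = a j" if "j \<in> I" for j
  proof (cases "j = k")
    case True
    then show ?thesis using *[of k] Suc.prems(2)[OF k(1)] by (simp add: y_def)
  next
    case False
    then show ?thesis using *[of j] x[of j] Suc.prems(3)[OF k(1), of j] k(2)[of j] that by force
  qed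
  then have "\<forall>j\<in>I. (\<Sum>i\<in>I. y i * A i j) = a j" by blast
  then show ?case by blast
qed simp

text \<open>The divisibility lemma with \<open>N = 0\<close> for the transposed matrix, which
  reverses the weight.\<close>

lemma unitriangular_ker:
  fixes A :: "'a \<Rightarrow> 'a \<Rightarrow> int" and w :: "'a \<Rightarrow> int"
  assumes "finite I" and "\<And>i. i \<in> I \<Longrightarrow> A i i = 1"
    and "\<And>i j. i \<in> I \<Longrightarrow> j \<in> I \<Longrightarrow> i \<noteq> j \<Longrightarrow> A i j \<noteq> 0 \<Longrightarrow> w j < w i"
    and "\<And>i. i \<in> I \<Longrightarrow> (\<Sum>j\<in>I. A i j * c j) = 0"
    and "k \<in> I"
  shows "c k = 0"
proof -
  have "0 dvd c k"
  proof (rule unitriangular_dvd[of I "\<lambda>i j. A j i" "\<lambda>i. - w i"])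
    show "- w j < - w i" if "i \<in> I" "j \<in> I" "i \<noteq> j" "A j i \<noteq> 0" for i j
      using assms(3)[of j i] that by auto
  qed (use assms in \<open>auto simp: mult.commute\<close>)
  then show ?thesis by simp
qed

subsection \<open>Symmetric functions as polynomials in the complete ones\<close>

text \<open>A multiset of parts stands for a monomial in \<open>h\<^sub>1, h\<^sub>2, \<dots>\<close>. Multiplication by \<open>h\<^sub>1\<close> is induction
  to the next symmetric group and \<open>der\<close> below is restriction to the previous one.\<close>

type_synonym symf = "nat multiset \<Rightarrow>\<^sub>0 int"

abbreviation mcoeff :: "symf \<Rightarrow> nat multiset \<Rightarrow> int" where "mcoeff \<equiv> Poly_Mapping.lookup"

definition hm :: "nat multiset \<Rightarrow> symf" where "hm \<mu> = Poly_Mapping.single \<mu> 1"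

text \<open>The monomial of \<open>{#0#}\<close> would be a further variable, so h_0 = 1 is imposed
  here; the partitions in \<open>part\<close> have positive parts only.\<close>

definition hs :: "nat \<Rightarrow> symf" where "hs k = (if k = 0 then 1 else hm {#k#})"

definition part :: "nat \<Rightarrow> nat multiset set" where
  "part n = {\<mu>. (\<forall>x\<in>#\<mu>. x > 0) \<and> sum_mset \<mu> = n}"

definition Sp :: "nat multiset set \<Rightarrow> symf set" where "Sp S = {f. Poly_Mapping.keys f \<subseteq> S}"

abbreviation Lam :: "nat \<Rightarrow> symf set" where "Lam n \<equiv> Sp (part n)"

definition lin :: "(nat multiset \<Rightarrow> 'b) \<Rightarrow> symf \<Rightarrow> 'b::comm_ring_1" where
  "lin \<phi> f = (\<Sum>\<mu>\<in>Poly_Mapping.keys f. of_int (mcoeff f \<mu>) * \<phi> \<mu>)"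

lemma lin_superset:
  assumes "finite S" "Poly_Mapping.keys f \<subseteq> S"
  shows "lin \<phi> f = (\<Sum>\<mu>\<in>S. of_int (mcoeff f \<mu>) * \<phi> \<mu>)"
  unfolding lin_def using assms by (intro sum.mono_neutral_left) (auto simp: in_keys_iff)

lemma lin_add [simp]: "lin \<phi> (f + g) = lin \<phi> f + lin \<phi> g"
proof -
  let ?S = "Poly_Mapping.keys f \<union> Poly_Mapping.keys g"
  have "lin \<phi> (f + g) = (\<Sum>\<mu>\<in>?S. of_int (mcoeff (f + g) \<mu>) * \<phi> \<mu>)"
    by (intro lin_superset) (auto dest: subsetD[OF keys_add])
  also have "\<dots> = lin \<phi> f + lin \<phi> g"
    by (subst (1 2) lin_superset[where S = ?S]) (auto simp: lookup_add sum.distrib distrib_right)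
  finally show ?thesis .
qed

lemma lin_0 [simp]: "lin \<phi> 0 = 0"
  by (simp add: lin_def)

lemma lin_uminus [simp]: "lin \<phi> (- f) = - lin \<phi> f"
proof -
  have "lin \<phi> (- f) + lin \<phi> f = 0" by (simp flip: lin_add)
  then show ?thesis by (simp add: eq_neg_iff_add_eq_0)
qed

lemma lin_diff [simp]: "lin \<phi> (f - g) = lin \<phi> f - lin \<phi> g"
  using lin_add[of \<phi> f "- g"] by simp

lemma lin_sum [simp]: "lin \<phi> (\<Sum>i\<in>S. f i) = (\<Sum>i\<in>S. lin \<phi> (f i))"
  by (induction S rule: infinite_finite_induct) auto

lemma lin_hm [simp]: "lin \<phi> (hm \<mu>) = \<phi> \<mu>"
  by (simp add: lin_def hm_def)

lemma lookup_of_int_mult [simp]: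
  "mcoeff (of_int c * (f :: symf)) \<mu> = c * mcoeff f \<mu>"
proof -
  have *: "mcoeff (of_nat m * f) \<mu> = of_nat m * mcoeff f \<mu>" for m
    by (induction m) (auto simp: lookup_add algebra_simps)
  show ?thesis
    by (cases c) (simp_all add: * del: of_nat_Suc)
qed

lemma lin_of_int_mult [simp]: "lin \<phi> (of_int c * f) = of_int c * lin \<phi> f"
proof -
  have "lin \<phi> (of_int c * f) = (\<Sum>\<mu>\<in>Poly_Mapping.keys f. of_int (mcoeff (of_int c * f) \<mu>) * \<phi> \<mu>)"
    by (intro lin_superset) (auto simp: in_keys_iff)
  then show ?thesis by (simp add: lin_def sum_distrib_left mult.assoc)
qed

lemma lookup_hm: "mcoeff (hm \<mu>) \<nu> = (if \<mu> = \<nu> then 1 else 0)"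
  by (simp add: hm_def lookup_single)

lemma sym_expand: "(\<Sum>\<mu>\<in>Poly_Mapping.keys f. of_int (mcoeff f \<mu>) * hm \<mu>) = f"
proof (rule poly_mapping_eqI)
  fix \<nu>
  have "mcoeff (\<Sum>\<mu>\<in>Poly_Mapping.keys f. of_int (mcoeff f \<mu>) * hm \<mu>) \<nu>
      = (\<Sum>\<mu>\<in>Poly_Mapping.keys f. if \<mu> = \<nu> then mcoeff f \<nu> else 0)"
    unfolding lookup_sum by (rule sum.cong) (simp_all add: lookup_hm)
  also have "\<dots> = mcoeff f \<nu>"
    by (simp add: in_keys_iff)
  finally show "mcoeff (\<Sum>\<mu>\<in>Poly_Mapping.keys f. of_int (mcoeff f \<mu>) * hm \<mu>) \<nu>
      = mcoeff f \<nu>" .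
qed

lemma Sp_induct [consumes 1, case_names zero add uminus hm]:
  assumes "f \<in> Sp S" and "P 0" and "\<And>f g. P f \<Longrightarrow> P g \<Longrightarrow> P (f + g)"
    and "\<And>f. P f \<Longrightarrow> P (- f)" and "\<And>\<mu>. \<mu> \<in> S \<Longrightarrow> P (hm \<mu>)"
  shows "P f"
proof -
  have nat: "P (of_nat m * hm \<mu>)" if "\<mu> \<in> S" for m \<mu>
  proof (induction m)
    case (Suc m)
    then show ?case using assms(3)[OF assms(5)[OF that] Suc] by (simp add: distrib_right)
  qed (simp add: assms(2))
  have int: "P (of_int c * hm \<mu>)" if "\<mu> \<in> S" for c \<mu>
    using nat[OF that] assms(4)[OF nat[OF that]] by (cases c) (simp_all del: of_nat_Suc)
  have "P (\<Sum>\<mu>\<in>X. of_int (mcoeff f \<mu>) * hm \<mu>)" if "finite X" "X \<subseteq> S" for X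
    using that
  proof (induction X rule: finite_induct)
    case (insert x X)
    then show ?case using assms(3)[OF int] by simp
  qed (simp add: assms(2))
  from this[of "Poly_Mapping.keys f"] show ?thesis using assms(1) by (simp add: sym_expand Sp_def)
qed

lemma hm_empty [simp]: "hm {#} = 1"
  by (simp add: hm_def)

lemma hm_add_mset: "hm (add_mset k \<mu>) = hm {#k#} * hm \<mu>"
  by (simp add: hm_def mult_single)

lemma hm_add_mset_h: "k > 0 \<Longrightarrow> hm (add_mset k \<mu>) = hs k * hm \<mu>"
  by (subst hm_add_mset) (simp add: hs_def)

lemma Sp_0 [simp]: "0 \<in> Sp S"
  by (simp add: Sp_def)

lemma Sp_add [intro]: "f \<in> Sp S \<Longrightarrow> g \<in> Sp S \<Longrightarrow> f + g \<in> Sp S"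
  using keys_add[of f g] by (auto simp: Sp_def)

lemma Sp_uminus [intro]: "f \<in> Sp S \<Longrightarrow> - f \<in> Sp S"
  by (auto simp: Sp_def in_keys_iff)

lemma Sp_diff [intro]: "f \<in> Sp S \<Longrightarrow> g \<in> Sp S \<Longrightarrow> f - g \<in> Sp S"
  using Sp_add[of f S "- g"] Sp_uminus by auto

lemma Sp_of_int [intro]: "f \<in> Sp S \<Longrightarrow> of_int c * f \<in> Sp S"
  by (auto simp: Sp_def in_keys_iff)

lemma Sp_of_nat [intro]: "f \<in> Sp S \<Longrightarrow> of_nat c * f \<in> Sp S"
  using Sp_of_int[of f S "int c"] by simp

lemma Sp_sum [intro]: "(\<And>i. i \<in> X \<Longrightarrow> f i \<in> Sp S) \<Longrightarrow> (\<Sum>i\<in>X. f i) \<in> Sp S"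
  by (induction X rule: infinite_finite_induct) auto

lemma Sp_hm [simp]: "hm \<mu> \<in> Sp S \<longleftrightarrow> \<mu> \<in> S"
  by (simp add: Sp_def hm_def)

lemma part_add_mset: "k > 0 \<Longrightarrow> \<mu> \<in> part n \<Longrightarrow> add_mset k \<mu> \<in> part (n + k)"
  by (auto simp: part_def)

lemma Lam_h_mult [intro]: assumes "f \<in> Lam n" shows "hs k * f \<in> Lam (n + k)"
proof (cases "k = 0")
  case False
  show ?thesis using assms
    by (induction rule: Sp_induct)
      (use False in \<open>auto simp: distrib_left hm_add_mset_h[symmetric] part_add_mset Sp_uminus\<close>)
qed (use assms in \<open>simp add: hs_def\<close>)

definition der :: "symf \<Rightarrow> symf" where
  "der = lin (\<lambda>\<mu>. \<Sum>k\<in>#\<mu>. hs (k - 1) * hm (\<mu> - {#k#}))"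

lemma D_linear [simp]:
  "der 0 = 0" "der (f + g) = der f + der g" "der (- f) = - der f" "der (f - g) = der f - der g"
  "der (\<Sum>i\<in>S. F i) = (\<Sum>i\<in>S. der (F i))" "der (of_int c * f) = of_int c * der f"
  by (simp_all add: der_def)

lemma D_1 [simp]: "der 1 = 0"
  using lin_hm[of "\<lambda>\<mu>. \<Sum>k\<in>#\<mu>. hs (k - 1) * hm (\<mu> - {#k#})" "{#}"] by (simp add: der_def del: lin_hm)

lemma D_h_mult:
  assumes "k > 0" shows "der (hs k * f) = hs (k - 1) * f + hs k * der f"
proof -
  have "f \<in> Sp UNIV" by (simp add: Sp_def)
  then show ?thesis
  proof (induction rule: Sp_induct)
    case (hm \<mu>)
    have "(\<Sum>j\<in>#\<mu>. hs (j - 1) * hm (add_mset k \<mu> - {#j#})) = hs k * (\<Sum>j\<in>#\<mu>. hs (j - 1) * hm (\<mu> - {#j#}))"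
      unfolding sum_mset_distrib_left using assms
      by (intro arg_cong[of _ _ sum_mset] image_mset_cong)
         (auto simp: hm_add_mset_h mult.left_commute)
    then have "der (hm (add_mset k \<mu>)) = hs (k - 1) * hm \<mu> + hs k * der (hm \<mu>)"
      by (simp add: der_def)
    then show ?case using assms by (simp add: hm_add_mset_h)
  qed (auto simp: algebra_simps)
qed

lemma D_h: "k > 0 \<Longrightarrow> der (hs k) = hs (k - 1)"
  using D_h_mult[of k 1] by simp

lemma part_0 [simp]: "part 0 = {{#}}"
  by (auto simp: part_def) (metis less_irrefl multiset_nonemptyE)

lemma D_Lam_0 [simp]: assumes "f \<in> Lam 0" shows "der f = 0"
  using assms by (induction rule: Sp_induct) auto

lemma D_Lam: assumes "f \<in> Lam (Suc n)" shows "der f \<in> Lam n"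
  using assms
proof (induction rule: Sp_induct)
  case (hm \<mu>)
  have "hs (k - 1) * hm (\<mu> - {#k#}) \<in> Lam n" if "k \<in># \<mu>" for k
  proof -
    from multi_member_split[OF that] obtain \<nu> where \<nu>: "\<mu> = add_mset k \<nu>" by blast
    have "hm \<nu> \<in> Lam (Suc n - k)" "0 < k" "k \<le> Suc n" using hm by (auto simp: \<nu> part_def)
    then show ?thesis using Lam_h_mult[of "hm \<nu>" "Suc n - k" "k - 1"] by (simp add: \<nu>)
  qed
  then have "(\<Sum>k\<in>#M. hs (k - 1) * hm (\<mu> - {#k#})) \<in> Lam n" if "set_mset M \<subseteq> set_mset \<mu>" for M
    using that by (induction M) auto
  then show ?case by (simp add: der_def)
qed (auto simp: Sp_uminus)

subsection \<open>Lifting along the derivation\<close>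

text \<open>The room for error terms: a basis element is controlled only up to monomials having a
  part at least as large as a given bound.\<close>

definition Top :: "nat \<Rightarrow> nat \<Rightarrow> symf set" where
  "Top k n = Sp {\<mu> \<in> part n. \<exists>j\<in>#\<mu>. k \<le> j}"

lemma Sp_mono: "S \<subseteq> S' \<Longrightarrow> Sp S \<subseteq> Sp S'"
  by (auto simp: Sp_def)

lemma Top_Lam: "f \<in> Top k n \<Longrightarrow> f \<in> Lam n"
  unfolding Top_def using Sp_mono[of "{\<mu> \<in> part n. \<exists>j\<in>#\<mu>. k \<le> j}" "part n"] by auto

lemma Top_anti: "k \<le> k' \<Longrightarrow> f \<in> Top k' n \<Longrightarrow> f \<in> Top k n"
  unfolding Top_def by (erule subsetD[OF Sp_mono, rotated]) (blast intro: le_trans)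

lemma Top_closed [intro]:
  "f \<in> Top k n \<Longrightarrow> g \<in> Top k n \<Longrightarrow> f + g \<in> Top k n"
  "f \<in> Top k n \<Longrightarrow> g \<in> Top k n \<Longrightarrow> f - g \<in> Top k n"
  "f \<in> Top k n \<Longrightarrow> - f \<in> Top k n" "0 \<in> Top k n"
  by (auto simp: Top_def)

lemma Top_h_mult:
  assumes "f \<in> Lam n" "k \<le> j" "j > 0" shows "hs j * f \<in> Top k (n + j)"
  using assms(1)
proof (induction rule: Sp_induct)
  case (hm \<mu>)
  then show ?case using assms(2,3) part_add_mset[of j \<mu> n]
    by (auto simp: Top_def hm_add_mset_h[symmetric])
qed (auto simp: distrib_left)

text \<open>Integration by parts: \<partial>(h_(j+1) g) = h_j g + h_(j+1) \<partial>g, and the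
  second term is corrected recursively. The preimage is h_(j+1) g - h_(j+2) \<partial>g + ..., which
  ends because \<partial> lowers the degree of g.\<close>

lemma D_onto_h:
  assumes "g \<in> Lam a" shows "\<exists>r \<in> Top (Suc j) (Suc (a + j)). der r = hs j * g"
  using assms
proof (induction a arbitrary: g j)
  case 0
  then have "der (hs (Suc j) * g) = hs j * g" by (simp add: D_h_mult)
  then show ?case using Top_h_mult[OF 0, of "Suc j" "Suc j"] by auto
next
  case (Suc a)
  obtain r where r: "r \<in> Top (Suc (Suc j)) (Suc (a + Suc j))" "der r = hs (Suc j) * der g"
    using Suc.IH[OF D_Lam[OF Suc.prems], of "Suc j"] by auto
  have "der (hs (Suc j) * g - r) = hs j * g" by (simp add: D_h_mult r)
  moreover have "hs (Suc j) * g - r \<in> Top (Suc j) (Suc (Suc a + j))"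
    using Top_h_mult[OF Suc.prems, of "Suc j" "Suc j"] Top_anti[OF _ r(1), of "Suc j"] by auto
  ultimately show ?case by blast
qed

lemma part_remove:
  assumes "\<mu> \<in> part n" "j \<in># \<mu>"
  obtains \<nu> where "\<mu> = add_mset j \<nu>" "\<nu> \<in> part (n - j)" "0 < j" "j \<le> n"
proof -
  from multi_member_split[OF assms(2)] obtain \<nu> where "\<mu> = add_mset j \<nu>" by blast
  then show ?thesis using assms(1) by (intro that[of \<nu>]) (auto simp: part_def)
qed

lemma D_onto_Top:
  assumes "f \<in> Top k n" shows "\<exists>r \<in> Top (Suc k) (Suc n). der r = f"
  using assms unfolding Top_def[of k]
proof (induction rule: Sp_induct)
  case zero
  then show ?case by (rule bexI[of _ 0]) auto
next
  case (add f g)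
  then obtain r s where "r \<in> Top (Suc k) (Suc n)" "der r = f" "s \<in> Top (Suc k) (Suc n)" "der s = g" by blast
  then show ?case by (intro bexI[of _ "r + s"]) auto
next
  case (uminus f)
  then obtain r where "r \<in> Top (Suc k) (Suc n)" "der r = f" by blast
  then show ?case by (intro bexI[of _ "- r"]) auto
next
  case (hm \<mu>)
  then obtain j where j: "\<mu> \<in> part n" "j \<in># \<mu>" "k \<le> j" by blast
  obtain \<nu> where \<nu>: "\<mu> = add_mset j \<nu>" "\<nu> \<in> part (n - j)" "0 < j" "j \<le> n"
    using part_remove[OF j(1,2)] by blast
  obtain r where "r \<in> Top (Suc j) (Suc (n - j + j))" "der r = hs j * hm \<nu>"
    using D_onto_h[of "hm \<nu>" "n - j" j] \<nu> by auto
  then show ?case using \<nu> j(3) Top_anti[of "Suc k" "Suc j" r] by (auto simp: hm_add_mset_h)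
qed

text \<open>The derivative of h_k q is h_(k-1) q + h_k \<partial>q, so it differs from
  \<open>X\<close> only by terms with a part at least k. These have a preimage with a part at least
  k+1, which does not touch the leading monomial h_k q.\<close>

lemma D_lift:
  assumes "k > 0" "q \<in> Lam b" "b + k = Suc n" "X \<in> Lam n" "X - hs (k - 1) * q \<in> Top k n"
  shows "\<exists>X' \<in> Lam (Suc n). der X' = X \<and> X' - hs k * q \<in> Top (Suc k) (Suc n)"
proof -
  have "hs k * der q \<in> Top k n"
  proof (cases b)
    case 0
    then show ?thesis using assms(2) by auto
  next
    case (Suc b')
    then show ?thesis using Top_h_mult[OF D_Lam, of q b' k k] assms by auto
  qed
  then have "X - hs (k - 1) * q - hs k * der q \<in> Top k n" using assms(5) by auto
  then obtain r where r: "r \<in> Top (Suc k) (Suc n)" "der r = X - hs (k - 1) * q - hs k * der q"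
    using D_onto_Top by blast
  have "hs k * q + r \<in> Lam (Suc n)" using Lam_h_mult[OF assms(2), of k] assms(3) Top_Lam[OF r(1)] by auto
  moreover have "der (hs k * q + r) = X" using assms(1) by (simp add: D_h_mult r(2))
  ultimately show ?thesis using r(1) by (intro bexI[of _ "hs k * q + r"]) auto
qed

section \<open>Divisibility by h_1 and partitions without parts 1\<close>

lemma lookup_h1_mult:
  "mcoeff (hs 1 * g) \<mu> = (if 1 \<in># \<mu> then mcoeff g (\<mu> - {#1#}) else 0)"
proof -
  have "g \<in> Sp UNIV" by (simp add: Sp_def)
  then show ?thesis
  proof (induction rule: Sp_induct)
    case (hm \<nu>)
    have "hs 1 * hm \<nu> = hm (add_mset 1 \<nu>)" by (simp add: hm_add_mset_h)
    then show ?case by (cases "1 \<in># \<mu>") (auto simp: lookup_hm)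
  qed (auto simp: distrib_left lookup_add)
qed

lemma h1_mult_eq_0: assumes "hs 1 * g = 0" shows "g = 0"
proof (rule poly_mapping_eqI)
  fix \<mu>
  show "mcoeff g \<mu> = mcoeff 0 \<mu>"
    using lookup_h1_mult[of g "add_mset 1 \<mu>"] assms by simp
qed

lemma h1_dvd:
  assumes "f \<in> Lam (Suc n)" "\<And>\<mu>. \<mu> \<in> part (Suc n) \<Longrightarrow> 1 \<notin># \<mu> \<Longrightarrow> mcoeff f \<mu> = 0"
  shows "\<exists>g \<in> Lam n. f = hs 1 * g"
proof -
  have "f \<in> Sp {\<mu> \<in> part (Suc n). 1 \<in># \<mu>}"
    using assms by (auto simp: Sp_def in_keys_iff)
  then show ?thesis
  proof (induction rule: Sp_induct)
    case zero
    then show ?case by (rule bexI[of _ 0]) auto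
  next
    case (add f g)
    then obtain r s where "r \<in> Lam n" "f = hs 1 * r" "s \<in> Lam n" "g = hs 1 * s" by blast
    then show ?case by (intro bexI[of _ "r + s"]) (auto simp: distrib_left)
  next
    case (uminus f)
    then obtain r where "r \<in> Lam n" "f = hs 1 * r" by blast
    then show ?case by (intro bexI[of _ "- r"]) auto
  next
    case (hm \<mu>)
    then obtain \<nu> where "\<mu> = add_mset 1 \<nu>" "\<nu> \<in> part (Suc n - 1)"
      using part_remove[of \<mu> "Suc n" 1] by blast
    then show ?case by (intro bexI[of _ "hm \<nu>"]) (auto simp: hm_add_mset_h)
  qed
qed

text \<open>Multiplication by h_1 adds a part 1, so these monomials form a basis of degree
  \<open>n\<close> modulo the multiples of h_1.\<close>

definition nopart :: "nat \<Rightarrow> nat multiset set" where "nopart n = {\<mu> \<in> part n. 1 \<notin># \<mu>}"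

lemma finite_part [simp]: "finite (part n)"
proof -
  have "\<mu> \<in> mset ` {xs. set xs \<subseteq> {..n} \<and> length xs \<le> n}" if \<mu>: "\<mu> \<in> part n" for \<mu>
  proof -
    obtain xs where xs: "\<mu> = mset xs" using ex_mset by metis
    have pos: "\<forall>x\<in>set xs. 0 < x" and sum: "sum_list xs = n"
      using \<mu> by (auto simp: part_def xs sum_mset_sum_list)
    have "length xs \<le> sum_list xs" using pos by (induction xs) auto
    then show ?thesis using sum member_le_sum_list[of _ xs] by (auto simp: xs)
  qed
  then show ?thesis
    by (intro finite_surj[OF finite_lists_length_le[of "{..n}" n], of "part n" mset]) auto
qed

lemma finite_nopart [simp]: "finite (nopart n)"
  by (simp add: nopart_def)

lemma npart_eq: "npart n = card (part n)"
  by (simp add: npart_def part_def)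

lemma npart_Suc: "npart (Suc n) = npart n + card (nopart (Suc n))"
proof -
  have "part (Suc n) = nopart (Suc n) \<union> add_mset 1 ` part n"
  proof -
    have "\<mu> \<in> add_mset 1 ` part n" if "\<mu> \<in> part (Suc n)" "1 \<in># \<mu>" for \<mu>
      using part_remove[OF that] by auto
    then show ?thesis using part_add_mset[of 1 _ n] by (auto simp: nopart_def)
  qed
  then have "card (part (Suc n)) = card (nopart (Suc n)) + card (add_mset 1 ` part n)"
    by (simp only:) (intro card_Un_disjoint, auto simp: nopart_def)
  moreover have "card (add_mset (1 :: nat) ` part n) = card (part n)"
    by (rule card_image) (auto simp: inj_on_def)
  ultimately show ?thesis by (simp add: npart_eq)
qed

text \<open>The condition in the product for \<open>j = Suc n\<close> says that \<open>i\<close> is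
  at most the number of partitions of \<open>Suc n\<close> without parts 1. Thus the formula for the
  orders obeys the recursion of the cokernels.\<close>

lemma qfac_Suc:
  "qfac (Suc n) i = (if i \<le> card (nopart (Suc n)) then Suc n else 1) * qfac n i"
proof -
  let ?P = "\<lambda>j. int i \<le> int (npart j) - int (npart (j - 1))"
  have fin: "finite {j. 1 \<le> j \<and> j \<le> m \<and> ?P j}" for m
    by (rule finite_subset[of _ "{..m}"]) auto
  have *: "?P (Suc n) \<longleftrightarrow> i \<le> card (nopart (Suc n))" by (simp add: npart_Suc)
  show ?thesis
  proof (cases "?P (Suc n)")
    case True
    then have "{j. 1 \<le> j \<and> j \<le> Suc n \<and> ?P j} = insert (Suc n) {j. 1 \<le> j \<and> j \<le> n \<and> ?P j}"
      by (auto simp: le_Suc_eq)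
    then show ?thesis using fin[of n] True * by (simp add: qfac_def)
  next
    case False
    then have "{j. 1 \<le> j \<and> j \<le> Suc n \<and> ?P j} = {j. 1 \<le> j \<and> j \<le> n \<and> ?P j}"
      by (auto simp: le_Suc_eq)
    then show ?thesis using False * by (simp add: qfac_def)
  qed
qed

subsection \<open>The cokernel and its recursion\<close>

text \<open>The degree \<open>n - 1\<close> minus the reflection character equals \<open>n\<close>
  minus the permutation character, because the two trivial summands cancel.\<close>

definition lap :: "nat \<Rightarrow> symf \<Rightarrow> symf" where "lap n f = of_nat n * f - hs 1 * der f"

lemma T_linear [simp]:
  "lap n 0 = 0" "lap n (f + g) = lap n f + lap n g" "lap n (- f) = - lap n f" "lap n (f - g) = lap n f - lap n g"
  "lap n (of_int c * f) = of_int c * lap n f" "lap n (\<Sum>i\<in>S. F i) = (\<Sum>i\<in>S. lap n (F i))"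
  by (simp_all add: lap_def distrib_left right_diff_distrib sum_distrib_left sum_subtractf mult.left_commute)

lemma T_Lam: "f \<in> Lam n \<Longrightarrow> lap n f \<in> Lam n"
proof (cases n)
  case (Suc m)
  assume "f \<in> Lam n"
  then show ?thesis using Lam_h_mult[OF D_Lam, of f m 1] Suc unfolding lap_def by (intro Sp_diff Sp_of_nat) auto
qed (simp add: lap_def)

text \<open>Since \<partial>h_1 = 1, the derivative of h_1 g contributes one copy of h_1 g, which
  accounts for the difference between \<open>n\<close> and \<open>Suc n\<close>.\<close>

lemma T_h1: "lap (Suc n) (hs 1 * g) = hs 1 * lap n g"
  by (simp add: lap_def D_h_mult hs_def[of 0] distrib_left distrib_right right_diff_distrib mult.left_commute
      del: One_nat_def)

abbreviation comb :: "nat \<Rightarrow> (nat \<Rightarrow> int) \<Rightarrow> (nat \<Rightarrow> symf) \<Rightarrow> symf" where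
  "comb r c x \<equiv> \<Sum>i=1..r. of_int (c i) * x i"

text \<open>The cokernel of \<open>lap n\<close> is the direct sum of the cyclic groups generated by the \<open>x i\<close>, of which \<open>x 1\<close> has
  infinite order.\<close>

definition presents :: "nat \<Rightarrow> nat \<Rightarrow> (nat \<Rightarrow> symf) \<Rightarrow> bool" where
  "presents n r x \<longleftrightarrow>
    (\<forall>i\<in>{1..r}. x i \<in> Lam n) \<and>
    (\<forall>f\<in>Lam n. \<exists>c. \<exists>g\<in>Lam n. f = (comb r c x) + lap n g) \<and>
    (\<forall>c. \<forall>g\<in>Lam n. (comb r c x) = lap n g \<longrightarrow>
       c 1 = 0 \<and> (\<forall>i\<in>{2..r}. int (qfac n i) dvd c i)) \<and>
    (\<forall>i\<in>{2..r}. \<exists>g\<in>Lam n. lap n g = of_int (int (qfac n i)) * x i)"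

lemma presents_annihilated:
  "presents n r x \<Longrightarrow> i \<in> {2..r} \<Longrightarrow> \<exists>g\<in>Lam n. lap n g = of_int (int (qfac n i)) * x i"
  by (simp add: presents_def)

text \<open>Everything rests on \<open>hx\<close>: modulo the image of \<open>lap (Suc n)\<close>,
  h_1 times an old generator is \<open>Suc n\<close> times its lift. Hence the part divisible by h_1
  is generated by the old generators and remembers their relations, while modulo h_1 the relations
  are multiples of \<open>Suc n\<close>.\<close>

lemma presents_Suc:
  assumes p: "presents n r x" and r: "1 \<le> r" "r \<le> r'"
    and x': "\<And>i. i \<in> {1..r'} \<Longrightarrow> x' i \<in> Lam (Suc n)"
    and der: "\<And>i. i \<in> {1..r'} \<Longrightarrow> der (x' i) = (if i \<le> r then x i else 0)"
    and span: "\<And>f. f \<in> Lam (Suc n) \<Longrightarrow> \<exists>c. \<exists>g\<in>Lam n. f = (comb r' c x') + hs 1 * g"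
    and indep: "\<And>N c f g i. f \<in> Lam (Suc n) \<Longrightarrow> g \<in> Lam n \<Longrightarrow> i \<in> {1..r'} \<Longrightarrow>
        (comb r' c x') = of_int N * f + hs 1 * g \<Longrightarrow> N dvd c i"
    and q: "\<And>i. i \<in> {2..r'} \<Longrightarrow> qfac (Suc n) i = Suc n * qfac n i"
      "\<And>i. i \<in> {2..r'} \<Longrightarrow> r < i \<Longrightarrow> qfac n i = 1"
  shows "presents (Suc n) r' x'"
proof -
  have hx: "hs 1 * x i = of_nat (Suc n) * x' i - lap (Suc n) (x' i)" if "i \<in> {1..r}" for i
    using der[of i] that r by (simp add: lap_def)
  have xL: "x i \<in> Lam n" if "i \<in> {1..r}" for i using p that by (simp add: presents_def)
  have sumD: "der (comb r' c x') = (comb r c x)" for c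
  proof -
    have "der (comb r' c x') = (\<Sum>i=1..r'. if i \<le> r then of_int (c i) * x i else 0)"
      by (auto simp: der intro!: sum.cong)
    also have "\<dots> = (comb r c x)"
      using r by (intro sum.mono_neutral_cong_right) auto
    finally show ?thesis .
  qed
  have gen: "\<exists>c. \<exists>g\<in>Lam (Suc n). f = (comb r' c x') + lap (Suc n) g"
    if f: "f \<in> Lam (Suc n)" for f
  proof -
    obtain c g where c: "g \<in> Lam n" "f = (comb r' c x') + hs 1 * g"
      using span[OF f] by blast
    obtain c' g' where c': "g' \<in> Lam n" "g = (comb r c' x) + lap n g'"
      using p c(1) unfolding presents_def by blast
    define z where "z = (comb r c' x')"
    have zL: "z \<in> Lam (Suc n)" unfolding z_def using x' r by (intro Sp_sum Sp_of_int) auto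
    have "hs 1 * g = (\<Sum>i=1..r. of_int (c' i) * (hs 1 * x i)) + lap (Suc n) (hs 1 * g')"
      by (simp only: c' distrib_left sum_distrib_left T_h1 mult.left_commute)
    also have "(\<Sum>i=1..r. of_int (c' i) * (hs 1 * x i)) = of_nat (Suc n) * z - lap (Suc n) z"
      unfolding z_def T_linear sum_distrib_left sum_subtractf[symmetric]
      by (intro sum.cong refl) (simp only: hx right_diff_distrib mult.left_commute)
    also have "of_nat (Suc n) * z =
        (\<Sum>i=1..r'. of_int (if i \<le> r then int (Suc n) * c' i else 0) * x' i)"
      unfolding z_def sum_distrib_left using r
      by (intro sum.mono_neutral_cong_left) (auto simp: mult.assoc)
    finally have "f = (\<Sum>i=1..r'. of_int (c i + (if i \<le> r then int (Suc n) * c' i else 0)) * x' i)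
        + lap (Suc n) (hs 1 * g' - z)"
      by (simp add: c(2) sum.distrib distrib_right del: of_nat_Suc)
    moreover have "hs 1 * g' - z \<in> Lam (Suc n)" using Lam_h_mult[OF c'(1), of 1] zL by auto
    ultimately show ?thesis by (intro exI bexI)
  qed
  have ind: "c 1 = 0 \<and> (\<forall>i\<in>{2..r'}. int (qfac (Suc n) i) dvd c i)"
    if g: "g \<in> Lam (Suc n)" and eq: "(comb r' c x') = lap (Suc n) g" for c g
  proof -
    \<comment> \<open>By definition \<open>lap (Suc n) g\<close> is \<open>Suc n\<close> times
      \<open>g\<close> up to a multiple of h_1, so independence modulo h_1 applies with
      \<open>N = Suc n\<close>.\<close>
    have "int (Suc n) dvd c i" if "i \<in> {1..r'}" for i
      using eq g D_Lam[OF g] that by (intro indep[of g "- der g" i c]) (auto simp: lap_def)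
    then have "\<exists>e. \<forall>i\<in>{1..r'}. c i = int (Suc n) * e i"
      by (intro bchoice) (auto simp: dvd_def)
    then obtain e where e: "\<And>i. i \<in> {1..r'} \<Longrightarrow> c i = int (Suc n) * e i" by blast
    define y where "y = (comb r' e x')"
    define z where "z = (comb r e x)"
    \<comment> \<open>Subtracting \<open>y\<close> removes the multiple of \<open>Suc n\<close> and
      turns the relation into one divisible by h_1.\<close>
    define f where "f = g - y"
    have yL: "y \<in> Lam (Suc n)" unfolding y_def using x' by (intro Sp_sum Sp_of_int) auto
    have zL: "z \<in> Lam n" unfolding z_def using xL by (intro Sp_sum Sp_of_int) auto
    have fL: "f \<in> Lam (Suc n)" using g yL by (auto simp: f_def)
    have "(comb r' c x') = of_nat (Suc n) * y"
      unfolding y_def sum_distrib_left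
      by (intro sum.cong refl) (simp add: e mult.assoc del: of_nat_Suc)
    then have "lap (Suc n) f = hs 1 * z"
      using eq sumD[of e] unfolding f_def y_def[symmetric] z_def[symmetric] T_linear
      by (simp add: lap_def)
    then have f1: "of_nat (Suc n) * f = hs 1 * (der f + z)"
      by (simp add: lap_def algebra_simps)
    \<comment> \<open>A nonzero integer multiple of \<open>f\<close> is divisible by h_1, and this
      is visible in the vanishing of coefficients, so \<open>f\<close> is divisible as well.\<close>
    have "\<exists>k\<in>Lam n. f = hs 1 * k"
    proof (rule h1_dvd[OF fL])
      fix \<mu> :: "nat multiset" assume "1 \<notin># \<mu>"
      then have "mcoeff (of_int (int (Suc n)) * f) \<mu> = 0"
        using lookup_h1_mult[of "der f + z" \<mu>] f1 by simp
      then show "mcoeff f \<mu> = 0" unfolding lookup_of_int_mult by simp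
    qed
    then obtain k where k: "k \<in> Lam n" "f = hs 1 * k" by blast
    \<comment> \<open>Cancelling h_1 leaves a relation among the old generators in degree
      \<open>n\<close>.\<close>
    have "hs 1 * (lap n k - z) = 0" using \<open>lap (Suc n) f = hs 1 * z\<close> T_h1[of n k]
      by (simp add: k(2) right_diff_distrib)
    then have "lap n k - z = 0" by (rule h1_mult_eq_0)
    then have "z = lap n k" by simp
    then have old: "e 1 = 0" "\<And>i. i \<in> {2..r} \<Longrightarrow> int (qfac n i) dvd e i"
      using p k(1) unfolding presents_def z_def by blast+
    have "int (qfac (Suc n) i) dvd c i" if i: "i \<in> {2..r'}" for i
    proof -
      have "int (qfac n i) dvd e i" using old(2)[of i] q(2)[OF i] i by (cases "i \<le> r") auto
      then show ?thesis using q(1)[OF i] e[of i] i by (simp only: of_nat_mult) (auto intro: mult_dvd_mono)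
    qed
    moreover have "c 1 = 0" using e[of 1] old(1) r by simp
    ultimately show ?thesis by blast
  qed
  have ord: "\<exists>g\<in>Lam (Suc n). lap (Suc n) g = of_int (int (qfac (Suc n) i)) * x' i"
    if i: "i \<in> {2..r'}" for i
  proof (cases "i \<le> r")
    case True
    obtain y where y: "y \<in> Lam n" "lap n y = of_int (int (qfac n i)) * x i"
      using presents_annihilated[OF p, of i] True i by auto
    \<comment> \<open>The correction by h_1 \<open>y\<close> supplies the multiple of h_1
      \<open>x i\<close> that \<open>lap\<close> of the first summand lacks.\<close>
    have "of_int (int (qfac n i)) * x' i + hs 1 * y \<in> Lam (Suc n)"
      using Lam_h_mult[OF y(1), of 1] x'[of i] i by auto
    moreover have "lap (Suc n) (of_int (int (qfac n i)) * x' i + hs 1 * y)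
        = of_int (int (qfac n i)) * (lap (Suc n) (x' i) + hs 1 * x i)"
      unfolding T_linear T_h1 y(2) by (simp add: algebra_simps)
    moreover have "lap (Suc n) (x' i) + hs 1 * x i = of_nat (Suc n) * x' i"
      using hx[of i] True i by simp
    moreover have "of_int (int (qfac n i)) * (of_nat (Suc n) * x' i) = of_int (int (qfac (Suc n) i)) * x' i"
      by (simp add: q(1)[OF i] mult.assoc mult.left_commute del: of_nat_Suc mult_Suc)
    ultimately show ?thesis by (intro bexI[of _ "of_int (int (qfac n i)) * x' i + hs 1 * y"]) simp_all
  next
    case False
    then show ?thesis using q[OF i] der[of i] x'[of i] i by (intro bexI[of _ "x' i"]) (auto simp: lap_def)
  qed
  show ?thesis unfolding presents_def
    using x' gen ind ord by (intro conjI ballI allI impI) simp_all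
qed

section \<open>Raising the largest part of a partition\<close>

definition mx :: "nat multiset \<Rightarrow> nat" where "mx \<mu> = Max (set_mset \<mu>)"

definition raise :: "nat multiset \<Rightarrow> nat multiset" where
  "raise \<mu> = add_mset (Suc (mx \<mu>)) (\<mu> - {#mx \<mu>#})"

lemma mx_in: "\<mu> \<noteq> {#} \<Longrightarrow> mx \<mu> \<in># \<mu>"
  by (simp add: mx_def)

lemma mx_ge: "j \<in># \<mu> \<Longrightarrow> j \<le> mx \<mu>"
  by (simp add: mx_def)

lemma mx_eqI: "m \<in># \<mu> \<Longrightarrow> (\<And>j. j \<in># \<mu> \<Longrightarrow> j \<le> m) \<Longrightarrow> mx \<mu> = m"
  unfolding mx_def by (rule Max_eqI) auto

lemma nopart_nonempty: "\<mu> \<in> nopart n \<Longrightarrow> n > 0 \<Longrightarrow> \<mu> \<noteq> {#}"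
  by (auto simp: nopart_def part_def)

lemma mx_raise: "mx (raise \<mu>) = Suc (mx \<mu>)"
proof (rule mx_eqI)
  fix j assume "j \<in># raise \<mu>"
  then have "j = Suc (mx \<mu>) \<or> j \<in># \<mu>" by (auto simp: raise_def dest: in_diffD)
  then show "j \<le> Suc (mx \<mu>)" using mx_ge[of j \<mu>] by auto
qed (simp add: raise_def)

lemma raise_in:
  assumes "\<mu> \<in> nopart n" "n > 0"
  shows "raise \<mu> \<in> nopart (Suc n)"
proof -
  have "mx \<mu> \<in># \<mu>" using mx_in nopart_nonempty[OF assms] by blast
  then obtain \<nu> where \<nu>: "\<mu> = add_mset (mx \<mu>) \<nu>" "\<nu> \<in> part (n - mx \<mu>)" "0 < mx \<mu>" "mx \<mu> \<le> n"
    using part_remove[of \<mu> n "mx \<mu>"] assms by (auto simp: nopart_def)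
  have "raise \<mu> = add_mset (Suc (mx \<mu>)) \<nu>"
    unfolding raise_def by (subst (2) \<nu>(1)) simp
  moreover have "1 \<notin># \<mu>" using assms(1) by (simp add: nopart_def)
  then have "1 \<notin># \<nu>" by (subst (asm) \<nu>(1)) simp
  ultimately show ?thesis using part_add_mset[of "Suc (mx \<mu>)" \<nu> "n - mx \<mu>"] \<nu>
    by (auto simp: nopart_def)
qed

text \<open>The raised part is the largest part of the image, so it can be recognized and lowered
  again.\<close>

lemma raise_inj: "inj_on raise (nopart n)" if "n > 0"
proof (rule inj_onI)
  fix \<mu> \<nu> assume *: "\<mu> \<in> nopart n" "\<nu> \<in> nopart n" "raise \<mu> = raise \<nu>"
  then have m: "mx \<mu> = mx \<nu>" using mx_raise by (metis Suc_inject)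
  then have "\<mu> - {#mx \<mu>#} = \<nu> - {#mx \<mu>#}" using *(3) by (simp add: raise_def)
  moreover have "mx \<mu> \<in># \<mu>" "mx \<mu> \<in># \<nu>"
    using mx_in[of \<mu>] mx_in[of \<nu>] nopart_nonempty[OF *(1) that] nopart_nonempty[OF *(2) that] m by auto
  ultimately show "\<mu> = \<nu>" by (metis insert_DiffM)
qed

text \<open>If the largest part m occurs once, lowering it gives a preimage under
  \<open>raise\<close>. This could only fail by creating a part 1, that is for m = 2; but then the
  partition is \<open>{#2#}\<close>, too small for \<open>n \<ge> 2\<close>.\<close>

lemma raise_or_double:
  assumes "\<mu> \<in> nopart (Suc n)" "n \<ge> 2" "\<mu> \<notin> raise ` nopart n"
  obtains \<nu> where "\<mu> = add_mset (mx \<mu>) (add_mset (mx \<mu>) \<nu>)"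
proof -
  define m where "m = mx \<mu>"
  have "m \<in># \<mu>" using mx_in nopart_nonempty[OF assms(1)] by (auto simp: m_def)
  then obtain \<nu> where \<nu>: "\<mu> = add_mset m \<nu>" "\<nu> \<in> part (Suc n - m)" "0 < m" "m \<le> Suc n"
    using part_remove[of \<mu> "Suc n" m] assms(1) by (auto simp: nopart_def)
  have 1: "m \<noteq> 1" "1 \<notin># \<nu>" using assms(1) \<nu>(1) by (auto simp: nopart_def)
  show ?thesis
  proof (cases "m \<in># \<nu>")
    case True
    from multi_member_split[OF this] obtain \<kappa> where \<kappa>: "\<nu> = add_mset m \<kappa>" by blast
    show ?thesis using \<nu>(1) unfolding \<kappa> m_def by (rule that)
  next
    case False
    have lt: "j < m" if "j \<in># \<nu>" for j
    proof -
      have "j \<in># \<mu>" using that by (simp add: \<nu>(1))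
      then have "j \<le> m" using mx_ge m_def by simp
      then show ?thesis using that False by (cases "j = m") auto
    qed
    have "m \<noteq> 2"
    proof
      assume "m = 2"
      have "j \<notin># \<nu>" for j
      proof
        assume j: "j \<in># \<nu>"
        then have "j < 2" "0 < j" using lt[OF j] \<open>m = 2\<close> \<nu>(2) by (auto simp: part_def)
        then have "j = 1" by simp
        then show False using 1(2) j by simp
      qed
      then have "\<nu> = {#}" by (auto elim: multiset_nonemptyE)
      then show False using \<nu>(2) \<open>m = 2\<close> assms(2) by (auto simp: part_def)
    qed
    let ?\<kappa> = "add_mset (m - 1) \<nu>"
    have "?\<kappa> \<in> nopart n" using part_add_mset[of "m - 1" \<nu> "Suc n - m"] \<nu> 1 \<open>m \<noteq> 2\<close>
      by (auto simp: nopart_def)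
    moreover have "mx ?\<kappa> = m - 1" by (rule mx_eqI) (auto dest!: lt)
    then have "raise ?\<kappa> = \<mu>" using \<nu> by (simp add: raise_def)
    ultimately show ?thesis using assms(3) by force
  qed
qed

section \<open>Leading monomials and triangularity modulo h_1\<close>

context
  fixes n r :: nat and e :: "nat \<Rightarrow> nat multiset" and x :: "nat \<Rightarrow> symf"
  assumes bij: "bij_betw e {1..r} (nopart (Suc n))"
    and x: "\<And>i. i \<in> {1..r} \<Longrightarrow> x i - hm (e i) \<in> Top (Suc (mx (e i))) (Suc n)"
begin

text \<open>Every error monomial of \<open>x i\<close> has a part exceeding the largest part of
  \<open>e i\<close>. So the largest part orders the coefficient matrix; it is negated because
  weights have to drop off the diagonal.\<close>

lemma lead_diag: "i \<in> {1..r} \<Longrightarrow> mcoeff (x i) (e i) = 1"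
  and lead_offdiag: "i \<in> {1..r} \<Longrightarrow> j \<in> {1..r} \<Longrightarrow> i \<noteq> j \<Longrightarrow> mcoeff (x i) (e j) \<noteq> 0 \<Longrightarrow>
    - int (mx (e j)) < - int (mx (e i))"
proof -
  have *: "\<exists>k\<in>#\<mu>. Suc (mx (e i)) \<le> k"
    if "i \<in> {1..r}" "mcoeff (x i - hm (e i)) \<mu> \<noteq> 0" for i \<mu>
    using x[OF that(1)] that(2) by (auto simp: Top_def Sp_def in_keys_iff)
  show "mcoeff (x i) (e i) = 1" if "i \<in> {1..r}" for i
    using *[OF that, of "e i"] mx_ge[of _ "e i"] by (force simp: lookup_minus lookup_hm)
  show "- int (mx (e j)) < - int (mx (e i))"
    if ij: "i \<in> {1..r}" "j \<in> {1..r}" "i \<noteq> j" and nz: "mcoeff (x i) (e j) \<noteq> 0" for i j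
  proof -
    have "e i \<noteq> e j" using ij bij by (auto simp: bij_betw_def dest: inj_onD)
    then obtain k where "k \<in># e j" "Suc (mx (e i)) \<le> k"
      using *[OF ij(1), of "e j"] nz by (auto simp: lookup_minus lookup_hm)
    then show ?thesis using mx_ge[of k "e j"] by simp
  qed
qed

lemma x_Lam: "i \<in> {1..r} \<Longrightarrow> x i \<in> Lam (Suc n)"
proof -
  assume i: "i \<in> {1..r}"
  have "hm (e i) \<in> Lam (Suc n)" using bij i by (auto simp: bij_betw_def nopart_def)
  then have "(x i - hm (e i)) + hm (e i) \<in> Lam (Suc n)" using Top_Lam[OF x[OF i]] by blast
  then show "x i \<in> Lam (Suc n)" by simp
qed

text \<open>The triangular system matches the coefficients at all partitions without parts 1; what
  remains is divisible by h_1.\<close>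

lemma lead_span:
  assumes "f \<in> Lam (Suc n)"
  shows "\<exists>c. \<exists>g\<in>Lam n. f = (comb r c x) + hs 1 * g"
proof -
  have "\<exists>c. \<forall>j\<in>{1..r}.
      (\<Sum>i\<in>{1..r}. c i * mcoeff (x i) (e j)) = mcoeff f (e j)"
    by (rule unitriangular_solve[where w = "\<lambda>i. - int (mx (e i))"]) (use lead_diag lead_offdiag in auto)
  then obtain c where c: "\<And>j. j \<in> {1..r} \<Longrightarrow>
      (\<Sum>i\<in>{1..r}. c i * mcoeff (x i) (e j)) = mcoeff f (e j)"
    by blast
  have "\<exists>g\<in>Lam n. f - (comb r c x) = hs 1 * g"
  proof (rule h1_dvd)
    show "f - (comb r c x) \<in> Lam (Suc n)"
      using assms x_Lam by (intro Sp_diff Sp_sum Sp_of_int) auto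
    fix \<mu> assume "\<mu> \<in> part (Suc n)" "1 \<notin># \<mu>"
    then have "\<mu> \<in> e ` {1..r}" using bij by (simp add: bij_betw_def nopart_def)
    then obtain j where "j \<in> {1..r}" "\<mu> = e j" by blast
    then show "mcoeff (f - (comb r c x)) \<mu> = 0"
      using c[of j] by (simp add: lookup_minus lookup_sum)
  qed
  then obtain g where "g \<in> Lam n" "f = (comb r c x) + hs 1 * g"
    unfolding diff_eq_eq add.commute[of "hs 1 * _"] by blast
  then show ?thesis by (intro exI[of _ c] bexI)
qed

text \<open>Multiples of h_1 have coefficient 0 at every \<open>e j\<close>, so the relation becomes
  a triangular system modulo \<open>N\<close>.\<close>

lemma lead_indep:
  assumes "(comb r c x) = of_int N * f + hs 1 * g" "k \<in> {1..r}"
  shows "N dvd c k"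
proof (rule unitriangular_dvd[of "{1..r}" "\<lambda>i j. mcoeff (x i) (e j)" "\<lambda>i. - int (mx (e i))"])
  fix j assume j: "j \<in> {1..r}"
  then have "e j \<in> nopart (Suc n)" using bij by (auto simp: bij_betw_def)
  then have "1 \<notin># e j" by (simp add: nopart_def)
  have "(\<Sum>i\<in>{1..r}. c i * mcoeff (x i) (e j))
      = mcoeff (comb r c x) (e j)"
    by (simp add: lookup_sum)
  also have "\<dots> = N * mcoeff f (e j)"
    unfolding assms(1) lookup_add lookup_h1_mult using \<open>1 \<notin># e j\<close> by simp
  finally show "N dvd (\<Sum>i\<in>{1..r}. c i * mcoeff (x i) (e j))" by simp
qed (use assms(2) lead_diag lead_offdiag in auto)

end

text \<open>In degree 1 the map \<open>lap\<close> vanishes and the cokernel is infinite cyclic,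
  although \<open>nopart 1\<close> is empty. The generator is therefore not of the form used in
  higher degrees, and the basis construction starts in degree 2.\<close>

lemma presents_1: "presents 1 1 (\<lambda>_. hs 1)"
proof -
  have p1: "\<mu> \<in> part 1 \<Longrightarrow> \<mu> = {#1#}" for \<mu>
  proof -
    assume \<mu>: "\<mu> \<in> part 1"
    then have "\<mu> \<noteq> {#}" by (auto simp: part_def)
    then obtain k where k: "k \<in># \<mu>" by (rule multiset_nonemptyE)
    obtain \<nu> where "\<mu> = add_mset k \<nu>" "\<nu> \<in> part (1 - k)" "0 < k" "k \<le> 1"
      using part_remove[OF \<mu> k] by blast
    then show "\<mu> = {#1#}" by simp
  qed
  have h1: "hs 1 = hm {#1#}" by (simp add: hs_def)
  have L: "\<exists>c. f = of_int c * hs 1" if "f \<in> Lam 1" for f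
    using that
  proof (induction rule: Sp_induct)
    case zero
    show ?case by (rule exI[of _ 0]) simp
  next
    case (add f g)
    then obtain c d where "f = of_int c * hs 1" "g = of_int d * hs 1" by blast
    then show ?case by (intro exI[of _ "c + d"]) (simp add: distrib_right)
  next
    case (uminus f)
    then obtain c where "f = of_int c * hs 1" by blast
    then show ?case by (intro exI[of _ "- c"]) simp
  next
    case (hm \<mu>)
    then show ?case using p1 h1 by (intro exI[of _ 1]) simp
  qed
  have T0: "lap 1 f = 0" if "f \<in> Lam 1" for f
  proof -
    obtain c where "f = of_int c * hs 1" using L[OF \<open>f \<in> Lam 1\<close>] by blast
    then show ?thesis by (simp add: lap_def D_h del: One_nat_def) (simp add: hs_def)
  qed
  have c0: "c = 0" if "of_int c * hs 1 = 0" for c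
    using arg_cong[OF that, of "\<lambda>f. mcoeff f {#1#}"] unfolding lookup_of_int_mult h1 lookup_hm by simp
  have "hs 1 \<in> Lam 1" unfolding h1 by (simp add: part_def)
  then show ?thesis unfolding presents_def
  proof (intro conjI ballI allI impI)
    fix f assume "f \<in> Lam 1"
    then obtain c where "f = of_int c * hs 1" using L by blast
    then show "\<exists>c. \<exists>g\<in>Lam 1. f = (\<Sum>i = 1..(1 :: nat). of_int (c i) * hs 1) + lap 1 g"
      by (intro exI[of _ "\<lambda>_. c"] bexI[of _ 0]) simp_all
  next
    fix c :: "nat \<Rightarrow> int" and g assume "g \<in> Lam 1" "(\<Sum>i = 1..(1 :: nat). of_int (c i) * hs 1) = lap 1 g"
    then show "c 1 = 0" using c0[of "c 1"] T0 by simp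
  qed simp_all
qed

lemma h_hm: "n > 0 \<Longrightarrow> hs n = hm {#n#}"
  by (simp add: hs_def)

lemma nopart_2: "nopart 2 = {{#2#}}"
proof -
  have "\<mu> = {#2#}" if \<mu>: "\<mu> \<in> nopart 2" for \<mu>
  proof -
    obtain k where k: "k \<in># \<mu>" using nopart_nonempty[OF \<mu>] by (auto elim: multiset_nonemptyE)
    obtain \<nu> where "\<mu> = add_mset k \<nu>" "\<nu> \<in> part (2 - k)" "0 < k" "k \<le> 2"
      using part_remove[OF _ k, of 2] \<mu> by (auto simp: nopart_def)
    moreover from this have "k = 2" using k \<mu> by (cases "k = 1") (auto simp: nopart_def)
    ultimately show ?thesis by simp
  qed
  then show ?thesis by (auto simp: nopart_def part_def)
qed

lemma card_nopart_1: "card (nopart (Suc 0)) = 0"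
proof -
  have "nopart (Suc 0) = {}"
  proof -
    have False if \<mu>: "\<mu> \<in> nopart (Suc 0)" for \<mu>
    proof -
      obtain k where k: "k \<in># \<mu>" using nopart_nonempty[OF \<mu>] by (auto elim: multiset_nonemptyE)
      obtain \<nu> where "\<mu> = add_mset k \<nu>" "0 < k" "k \<le> Suc 0"
        using part_remove[OF _ k, of "Suc 0"] \<mu> by (auto simp: nopart_def)
      then show ?thesis using k \<mu> by (auto simp: nopart_def le_Suc_eq)
    qed
    then show ?thesis by blast
  qed
  then show ?thesis by simp
qed

text \<open>\<open>raise\<close> embeds one set into the next. Degree 0 is an exception:
  \<open>nopart 0\<close> contains the empty partition, \<open>nopart 1\<close> nothing.\<close>

lemma card_nopart_mono: "card (nopart n) \<le> card (nopart (Suc n))" if "n > 0"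
  using raise_inj[OF that] raise_in that by (intro card_inj_on_le[of raise]) auto

lemma qfac_eq_1: "n \<ge> 1 \<Longrightarrow> i \<ge> 1 \<Longrightarrow> card (nopart n) < i \<Longrightarrow> qfac n i = 1"
proof (induction n rule: nat_induct_at_least)
  case base
  have "{j. 1 \<le> j \<and> j \<le> 0 \<and> int i \<le> int (npart j) - int (npart (j - 1))} = {}" by auto
  then have "qfac 0 i = 1" unfolding qfac_def by (simp only: prod.empty)
  then show ?case using qfac_Suc[of 0 i] base card_nopart_1 by simp
next
  case (Suc n)
  then show ?case using qfac_Suc[of n i] card_nopart_mono[of n] by simp
qed


text \<open>A partition of \<open>Suc n\<close> without parts 1 and with a unique largest part comes from a partition of \<open>n\<close> by
  raising the largest part, and its basis element is chosen as a lift of the old one. If the largest part is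
  repeated, it is chosen in the kernel of \<open>der\<close>, as a lift of 0.\<close>

lemma step_data:
  assumes "n \<ge> 2" "bij_betw e {1..card (nopart n)} (nopart n)" "e 1 = {#n#}" "x 1 = hs n"
    and x: "\<And>i. i \<in> {1..card (nopart n)} \<Longrightarrow> x i - hm (e i) \<in> Top (Suc (mx (e i))) n"
  shows "\<exists>e' x'. bij_betw e' {1..card (nopart (Suc n))} (nopart (Suc n)) \<and> e' 1 = {#Suc n#} \<and> x' 1 = hs (Suc n) \<and>
    (\<forall>i\<in>{1..card (nopart (Suc n))}. x' i - hm (e' i) \<in> Top (Suc (mx (e' i))) (Suc n) \<and>
      der (x' i) = (if i \<le> card (nopart n) then x i else 0))"
proof -
  define r r' where "r = card (nopart n)" and "r' = card (nopart (Suc n))"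
  have rr: "r \<le> r'" unfolding r_def r'_def using card_nopart_mono assms(1) by simp
  let ?R = "raise ` nopart n"
  have sub: "?R \<subseteq> nopart (Suc n)" using raise_in assms(1) by auto
  have cR: "card ?R = r" unfolding r_def using raise_inj assms(1) by (intro card_image) auto
  have "card (nopart (Suc n) - ?R) = card {Suc r..r'}"
    using card_Diff_subset[of ?R "nopart (Suc n)"] sub by (simp add: cR r'_def)
  then obtain b where b: "bij_betw b {Suc r..r'} (nopart (Suc n) - ?R)"
    using finite_same_card_bij[of "{Suc r..r'}" "nopart (Suc n) - ?R"] by auto
  \<comment> \<open>Raised partitions keep the index of their origin, so that a lift keeps its place
    among the orders; the remaining partitions are numbered after them.\<close>
  define e' where "e' i = (if i \<le> r then raise (e i) else b i)" for i
  have "bij_betw (raise \<circ> e) {1..r} ?R"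
    using assms(2) raise_inj assms(1) unfolding r_def
    by (intro bij_betw_trans[of e _ "nopart n"]) (auto simp: bij_betw_def)
  then have 1: "bij_betw e' {1..r} ?R"
    by (rule bij_betw_cong[THEN iffD1, rotated]) (simp add: e'_def)
  have 2: "bij_betw e' {Suc r..r'} (nopart (Suc n) - ?R)"
    using b by (rule bij_betw_cong[THEN iffD1, rotated]) (simp add: e'_def)
  have un: "{1..r} \<union> {Suc r..r'} = {1..r'}" "?R \<union> (nopart (Suc n) - ?R) = nopart (Suc n)"
    using rr sub by auto
  have e': "bij_betw e' {1..r'} (nopart (Suc n))"
    using bij_betw_combine[OF 1 2] unfolding un by blast
  have "nopart n \<noteq> {}" using assms(1,3) by (auto simp: nopart_def part_def intro!: exI[of _ "{#n#}"])
  then have r1: "r \<ge> 1" unfolding r_def by (simp add: Suc_le_eq card_gt_0_iff)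
  have mxn: "mx {#n#} = n" by (simp add: mx_def)
  have e'1: "e' 1 = {#Suc n#}" using r1 using assms(3) by (simp add: e'_def raise_def mxn)
  have "\<exists>y. (i = 1 \<longrightarrow> y = hs (Suc n)) \<and> y - hm (e' i) \<in> Top (Suc (mx (e' i))) (Suc n) \<and>
      der y = (if i \<le> r then x i else 0)" if i: "i \<in> {1..r'}" for i
  proof (cases "i = 1")
    case True
    \<comment> \<open>Here the lift is fixed as h_(n+1) with derivative h_n, which keeps the first
      generator equal to the trivial character.\<close>
    then show ?thesis using r1 assms(4) e'1 by (auto simp: D_h h_hm[of "Suc n", symmetric] Top_closed)
  next
    case i1: False
    show ?thesis
    proof (cases "i \<le> r")
      case True
      have ei: "e i \<in> nopart n" using assms(2) True i unfolding r_def by (auto simp: bij_betw_def)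
      define m where "m = mx (e i)"
      have "m \<in># e i" using mx_in nopart_nonempty[OF ei] assms(1) by (auto simp: m_def)
      then obtain \<nu> where \<nu>: "e i = add_mset m \<nu>" "\<nu> \<in> part (n - m)" "0 < m" "m \<le> n"
        using part_remove[of "e i" n m] ei by (auto simp: nopart_def)
      have "x i - hm (e i) \<in> Top (Suc m) n" using x True i unfolding r_def m_def by simp
      then have xi: "x i - hs m * hm \<nu> \<in> Top (Suc m) n" using \<nu>(1,3) by (simp add: hm_add_mset_h)
      have "hs m * hm \<nu> \<in> Lam n" using Lam_h_mult[of "hm \<nu>" "n - m" m] \<nu> by simp
      then have "x i - hs m * hm \<nu> + hs m * hm \<nu> \<in> Lam n" using Top_Lam[OF xi] by blast
      then have "x i \<in> Lam n" by simp
      then obtain y where y: "der y = x i" "y - hs (Suc m) * hm \<nu> \<in> Top (Suc (Suc m)) (Suc n)"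
        using D_lift[of "Suc m" "hm \<nu>" "n - m" n "x i"] xi \<nu> by auto
      have "e' i = add_mset (Suc m) \<nu>" using True unfolding e'_def raise_def m_def[symmetric] by (simp add: \<nu>(1))
      moreover have "mx (e' i) = Suc m" using True by (simp add: e'_def mx_raise m_def)
      ultimately show ?thesis using y True i1 by (auto simp: hm_add_mset_h intro!: exI[of _ y])
    next
      case False
      then have "e' i \<in> nopart (Suc n) - ?R" using bij_betwE[OF 2] i by simp
      then have ei: "e' i \<in> nopart (Suc n)" "e' i \<notin> ?R" by auto
      define m where "m = mx (e' i)"
      obtain \<kappa> where \<kappa>: "e' i = add_mset m (add_mset m \<kappa>)"
        using raise_or_double[OF ei(1) assms(1) ei(2)] unfolding m_def by blast
      have m: "m > 0" "m \<le> Suc n" "add_mset m \<kappa> \<in> part (Suc n - m)"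
        using part_remove[of "e' i" "Suc n" m] ei(1) \<kappa> by (auto simp: nopart_def)
      have \<kappa>p: "\<kappa> \<in> part (Suc n - m - m)" "m \<le> Suc n - m"
        using part_remove[OF m(3), of m] by auto
      have eq: "Suc n - m - m + (m - 1) = n - m" "n - m + m = n" using m(1) \<kappa>p(2) assms(1) by auto
      have "hs (m - 1) * hm \<kappa> \<in> Lam (n - m)"
        using Lam_h_mult[of "hm \<kappa>" "Suc n - m - m" "m - 1"] \<kappa>p(1) unfolding eq by simp
      \<comment> \<open>Because m occurs twice, replacing one m by m - 1 leaves a monomial that
        still has the part m. It counts as an error term, so 0 may be lifted with the prescribed
        leading monomial.\<close>
      then have "hs m * (hs (m - 1) * hm \<kappa>) \<in> Top m n"
        using Top_h_mult[of _ "n - m" m m] m(1) unfolding eq by blast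
      then have "0 - hs (m - 1) * hm (add_mset m \<kappa>) \<in> Top m n"
        using m(1) by (auto simp: hm_add_mset_h mult.left_commute)
      then obtain y where y: "der y = 0" "y - hs m * hm (add_mset m \<kappa>) \<in> Top (Suc m) (Suc n)"
        using D_lift[of m "hm (add_mset m \<kappa>)" "Suc n - m" n 0] m by auto
      have "y - hm (e' i) \<in> Top (Suc (mx (e' i))) (Suc n)"
        using y(2) m(1) unfolding m_def[symmetric] by (simp add: \<kappa> hm_add_mset_h)
      then show ?thesis using False i1 y(1) by (intro exI[of _ y]) simp
    qed
  qed
  then obtain x' where x': "\<And>i. i \<in> {1..r'} \<Longrightarrow> (i = 1 \<longrightarrow> x' i = hs (Suc n)) \<and> x' i - hm (e' i) \<in> Top (Suc (mx (e' i))) (Suc n) \<and>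
      der (x' i) = (if i \<le> r then x i else 0)" by metis
  have "x' 1 = hs (Suc n)" using x'[of 1] r1 rr by simp
  then show ?thesis using e' e'1 x' unfolding r_def r'_def by blast
qed

text \<open>The maximum with 1 covers the step from degree 1, where there is a generator but no
  partition without parts 1.\<close>

lemma presents_lift:
  assumes "n \<ge> 1" "presents n (max 1 (card (nopart n))) x"
    and "bij_betw e' {1..card (nopart (Suc n))} (nopart (Suc n))"
    and x': "\<And>i. i \<in> {1..card (nopart (Suc n))} \<Longrightarrow> x' i - hm (e' i) \<in> Top (Suc (mx (e' i))) (Suc n)"
    and der: "\<And>i. i \<in> {1..card (nopart (Suc n))} \<Longrightarrow>
      der (x' i) = (if i \<le> max 1 (card (nopart n)) then x i else 0)"
    and "nopart (Suc n) \<noteq> {}"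
  shows "presents (Suc n) (card (nopart (Suc n))) x'"
proof (rule presents_Suc[OF assms(2)])
  show "max 1 (card (nopart n)) \<le> card (nopart (Suc n))"
    using assms(1,6) card_nopart_mono[of n] by (simp add: Suc_le_eq card_gt_0_iff)
  show "x' i \<in> Lam (Suc n)" if "i \<in> {1..card (nopart (Suc n))}" for i
    using x_Lam[OF assms(3) x' that] .
  show "qfac (Suc n) i = Suc n * qfac n i" if "i \<in> {2..card (nopart (Suc n))}" for i
    using that by (simp add: qfac_Suc)
  show "qfac n i = 1" if "i \<in> {2..card (nopart (Suc n))}" "max 1 (card (nopart n)) < i" for i
    using qfac_eq_1[of n i] that assms(1) by simp
  show "N dvd c i" if "i \<in> {1..card (nopart (Suc n))}"
    "(\<Sum>i=1..card (nopart (Suc n)). of_int (c i) * x' i) = of_int N * f + hs 1 * g" for N c f g i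
    using lead_indep[OF assms(3) x' that(2,1)] .
qed (use der lead_span[OF assms(3) x'] in auto)

lemma presentation_aux:
  assumes "n \<ge> 2"
  shows "\<exists>e x. bij_betw e {1..card (nopart n)} (nopart n) \<and> e 1 = {#n#} \<and> x 1 = hs n \<and>
    (\<forall>i\<in>{1..card (nopart n)}. x i - hm (e i) \<in> Top (Suc (mx (e i))) n) \<and> presents n (card (nopart n)) x"
  using assms
proof (induction n rule: nat_induct_at_least)
  case base
  have x: "hs 2 - hm {#2#} \<in> Top (Suc (mx {#2#})) 2" "der (hs 2) = hs 1"
    using D_h[of 2] by (simp_all add: h_hm[of 2] Top_closed)
  have "presents (Suc 1) (card (nopart (Suc 1))) (\<lambda>_. hs 2)"
    by (rule presents_lift[of 1 "\<lambda>_. hs 1" "\<lambda>_. {#2#}"])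
      (use presents_1 nopart_2 x in \<open>simp_all add: card_nopart_1 bij_betw_def numeral_2_eq_2\<close>)
  then show ?case using nopart_2 x
    by (intro exI[of _ "\<lambda>_. {#2#}"] exI[of _ "\<lambda>_. hs 2"]) (simp add: bij_betw_def numeral_2_eq_2)
next
  case (Suc n)
  let ?r = "card (nopart n)" and ?r' = "card (nopart (Suc n))"
  obtain e x where ex: "bij_betw e {1..?r} (nopart n)" "e 1 = {#n#}" "x 1 = hs n"
    "\<And>i. i \<in> {1..?r} \<Longrightarrow> x i - hm (e i) \<in> Top (Suc (mx (e i))) n" "presents n ?r x"
    using Suc.IH by blast
  have "{#n#} \<in> nopart n" using Suc.hyps by (auto simp: nopart_def part_def)
  then have r: "max 1 ?r = ?r" by (auto simp: max_def Suc_le_eq card_gt_0_iff)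
  have "{#Suc n#} \<in> nopart (Suc n)" using Suc.hyps by (auto simp: nopart_def part_def)
  then have ne: "nopart (Suc n) \<noteq> {}" by blast
  obtain e' x' where ex': "bij_betw e' {1..?r'} (nopart (Suc n))" "e' 1 = {#Suc n#}" "x' 1 = hs (Suc n)"
    "\<And>i. i \<in> {1..?r'} \<Longrightarrow> x' i - hm (e' i) \<in> Top (Suc (mx (e' i))) (Suc n)"
    "\<And>i. i \<in> {1..?r'} \<Longrightarrow> der (x' i) = (if i \<le> ?r then x i else 0)"
    using step_data[OF Suc.hyps ex(1-4)] by blast
  have "presents (Suc n) ?r' x'"
    by (rule presents_lift[of n x e']) (use Suc.hyps ex(5) ex' r ne in auto)
  then show ?case using ex' by blast
qed

lemma presentation:
  assumes "n \<ge> 2" obtains x where "x 1 = hs n" "presents n (npart n - npart (n - 1)) x"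
proof -
  obtain m where "n = Suc m" using assms by (cases n) auto
  then have "npart n - npart (n - 1) = card (nopart n)" by (simp add: npart_Suc)
  then show ?thesis using presentation_aux[OF assms] that by metis
qed

subsection \<open>Young permutation characters\<close>

text \<open>For a permutation \<open>p\<close> of \<open>A\<close>, a Young permutation character counts the ways to distribute the cycles of \<open>p\<close> over
  blocks of the given sizes; \<open>Hop\<close> splits off one block, and is the action of \<open>h\<^sub>k\<close>. Keeping \<open>p\<close> fixed and varying
  the stable set \<open>A\<close> turns the induction product into composition of such operators.\<close>

definition stab :: "('a \<Rightarrow> 'a) \<Rightarrow> nat \<Rightarrow> 'a set \<Rightarrow> 'a set set" where
  "stab p k A = {B. B \<subseteq> A \<and> p ` B = B \<and> card B = k}"

text \<open>The value 0 on infinite sets makes these operators commute unconditionally, as folding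
  them over a multiset requires.\<close>

definition Hop :: "('a \<Rightarrow> 'a) \<Rightarrow> nat \<Rightarrow> ('a set \<Rightarrow> int) \<Rightarrow> 'a set \<Rightarrow> int" where
  "Hop p k \<phi> A = (if finite A then \<Sum>B\<in>stab p k A. \<phi> (A - B) else 0)"

lemma finite_stab [simp]: "finite A \<Longrightarrow> finite (stab p k A)"
  by (rule finite_subset[of _ "Pow A"]) (auto simp: stab_def)

lemma stab_Diff: "stab p k (A - B) = {C \<in> stab p k A. B \<inter> C = {}}"
  by (auto simp: stab_def)

lemma Hop_0: "finite A \<Longrightarrow> Hop p 0 \<phi> A = \<phi> A"
proof -
  assume A: "finite A"
  have "stab p 0 A = {{}}" using finite_subset[OF _ A] by (auto simp: stab_def)
  then show ?thesis using A by (simp add: Hop_def)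
qed

lemma Hop_Hop:
  assumes "finite A"
  shows "Hop p j (Hop p k \<phi>) A =
    (\<Sum>B\<in>stab p j A. \<Sum>C\<in>stab p k A. if B \<inter> C = {} then \<phi> (A - (B \<union> C)) else 0)"
proof -
  have "Hop p k \<phi> (A - B) = (\<Sum>C\<in>stab p k A. if B \<inter> C = {} then \<phi> (A - (B \<union> C)) else 0)" for B
  proof -
    have "Hop p k \<phi> (A - B) = (\<Sum>C\<in>{C \<in> stab p k A. B \<inter> C = {}}. \<phi> (A - (B \<union> C)))"
    proof -
      have "A - B - C = A - (B \<union> C)" for C by auto
      then show ?thesis using assms by (simp add: Hop_def stab_Diff)
    qed
    also have "\<dots> = (\<Sum>C\<in>stab p k A. if B \<inter> C = {} then \<phi> (A - (B \<union> C)) else 0)"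
      using assms by (simp add: sum.inter_filter)
    finally show ?thesis .
  qed
  then show ?thesis using assms by (simp add: Hop_def[of p j])
qed

lemma Hop_commute: "Hop p j \<circ> Hop p k = Hop p k \<circ> Hop p j"
proof (intro ext)
  fix \<phi> A
  show "(Hop p j \<circ> Hop p k) \<phi> A = (Hop p k \<circ> Hop p j) \<phi> A"
  proof (cases "finite A")
    case True
    have "(\<Sum>B\<in>stab p j A. \<Sum>C\<in>stab p k A. if B \<inter> C = {} then \<phi> (A - (B \<union> C)) else 0)
        = (\<Sum>C\<in>stab p k A. \<Sum>B\<in>stab p j A. if C \<inter> B = {} then \<phi> (A - (C \<union> B)) else 0)"
      by (subst sum.swap) (intro sum.cong refl, simp add: Int_commute Un_commute)
    then show ?thesis using True by (simp add: Hop_Hop)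
  qed (simp add: Hop_def)
qed

text \<open>Counts the ordered decompositions of \<open>A\<close> into \<open>p\<close>-stable
  blocks whose sizes are the parts of \<mu>. Starting from the indicator of the empty set gives 0
  when the sizes do not add up to the size of \<open>A\<close>.\<close>

definition cf :: "('a \<Rightarrow> 'a) \<Rightarrow> nat multiset \<Rightarrow> 'a set \<Rightarrow> int" where
  "cf p \<mu> = fold_mset (Hop p) (\<lambda>A. if A = {} then 1 else 0) \<mu>"

definition ch :: "('a \<Rightarrow> 'a) \<Rightarrow> symf \<Rightarrow> 'a set \<Rightarrow> int" where
  "ch p f A = lin (\<lambda>\<mu>. cf p \<mu> A) f"

lemma ch_linear [simp]:
  "ch p 0 A = 0" "ch p (f + g) A = ch p f A + ch p g A" "ch p (f - g) A = ch p f A - ch p g A"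
  "ch p (- f) A = - ch p f A" "ch p (of_int c * f) A = c * ch p f A"
  "ch p (\<Sum>i\<in>S. F i) A = (\<Sum>i\<in>S. ch p (F i) A)" "ch p (hm \<mu>) A = cf p \<mu> A"
  by (simp_all add: ch_def)

lemma cf_empty: "cf p {#} A = (if A = {} then 1 else 0)"
  by (simp add: cf_def)

lemma cf_add_mset: "cf p (add_mset k \<mu>) A = Hop p k (cf p \<mu>) A"
proof -
  interpret comp_fun_commute "Hop p" by unfold_locales (rule Hop_commute)
  show ?thesis by (simp add: cf_def)
qed

lemma ch_h:
  assumes "finite A" shows "ch p (hs k * f) A = Hop p k (ch p f) A"
proof (cases "k = 0")
  case True
  then show ?thesis using assms by (simp add: hs_def Hop_0)
next
  case False
  have "f \<in> Sp UNIV" by (simp add: Sp_def)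
  then show ?thesis
  proof (induction rule: Sp_induct)
    case (hm \<mu>)
    have "ch p (hm \<mu>) = cf p \<mu>" by (intro ext) simp
    then show ?case using False by (simp add: hm_add_mset_h[symmetric] cf_add_mset)
  qed (use assms in \<open>auto simp: Hop_def distrib_left sum.distrib sum_negf\<close>)
qed

definition nfix :: "('a \<Rightarrow> 'a) \<Rightarrow> 'a set \<Rightarrow> int" where "nfix p A = int (card {x \<in> A. p x = x})"

text \<open>A block with a marked fixed point is the same as a fixed point together with a stable
  set of size k - 1 avoiding it. This is \<partial>h_k = h_(k-1) in terms of characters.\<close>

lemma Hop_nfix:
  assumes "inj p" "finite A" "k > 0"
  shows "(\<Sum>B\<in>stab p k A. nfix p B * \<phi> (A - B)) = Hop p 1 (Hop p (k - 1) \<phi>) A"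
proof -
  have fB: "finite B" if "B \<in> stab p k A" for B k
    using that assms(2) by (auto simp: stab_def intro: finite_subset)
  have s1: "stab p 1 A = (\<lambda>x. {x}) ` {x \<in> A. p x = x}"
    by (auto simp: stab_def card_1_singleton_iff)
  have "(\<Sum>B\<in>stab p k A. nfix p B * \<phi> (A - B)) = (\<Sum>B\<in>stab p k A. \<Sum>x\<in>{x \<in> B. p x = x}. \<phi> (A - B))"
    by (simp add: nfix_def)
  also have "\<dots> = (\<Sum>(B, x)\<in>Sigma (stab p k A) (\<lambda>B. {x \<in> B. p x = x}). \<phi> (A - B))"
    using assms(2) fB by (subst sum.Sigma) auto
  also have "\<dots> = (\<Sum>(x, C)\<in>Sigma {x \<in> A. p x = x} (\<lambda>x. stab p (k - 1) (A - {x})). \<phi> (A - {x} - C))"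
  proof (rule sum.reindex_bij_witness[where i = "\<lambda>(x, C). (insert x C, x)" and j = "\<lambda>(B, x). (x, B - {x})"])
    fix a assume a0: "a \<in> Sigma (stab p k A) (\<lambda>B. {x \<in> B. p x = x})"
    obtain B x where "a = (B, x)" by (cases a)
    then have a: "a = (B, x)" "B \<subseteq> A" "p ` B = B" "card B = k" "x \<in> B" "p x = x" "finite B"
      using a0 fB[of B k] by (simp_all add: stab_def)
    have "p ` (B - {x}) = B - {x}" using image_set_diff[OF assms(1), of B "{x}"] a by simp
    moreover have "card (B - {x}) = k - 1" "B - {x} \<subseteq> A - {x}" "x \<in> A"
      using a(2,4,5,7) by auto
    ultimately show "(case a of (B, x) \<Rightarrow> (x, B - {x})) \<in> Sigma {x \<in> A. p x = x} (\<lambda>x. stab p (k - 1) (A - {x}))"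
      using a(1,6) by (simp add: stab_def)
    show "(case (case a of (B, x) \<Rightarrow> (x, B - {x})) of (x, C) \<Rightarrow> (insert x C, x)) = a"
      using a(1,5) by auto
    have "A - {x} - (B - {x}) = A - B" using a(5) by blast
    then show "(case (case a of (B, x) \<Rightarrow> (x, B - {x})) of (x, C) \<Rightarrow> \<phi> (A - {x} - C)) = (case a of (B, x) \<Rightarrow> \<phi> (A - B))"
      using a(1) by simp
  next
    fix b assume b0: "b \<in> Sigma {x \<in> A. p x = x} (\<lambda>x. stab p (k - 1) (A - {x}))"
    obtain x C where "b = (x, C)" by (cases b)
    then have b: "b = (x, C)" "x \<in> A" "p x = x" "C \<subseteq> A - {x}" "p ` C = C" "card C = k - 1"
      using b0 by (simp_all add: stab_def)
    have "x \<notin> C" using b(4) by blast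
    have "finite C" using b(4) assms(2) by (meson finite_Diff finite_subset)
    have "insert x C \<subseteq> A" using b by blast
    moreover have "p ` insert x C = insert x C" using b(3,5) by (simp only: image_insert)
    moreover have "card (insert x C) = k" using \<open>finite C\<close> \<open>x \<notin> C\<close> b(6) assms(3) by simp
    ultimately
    show "(case b of (x, C) \<Rightarrow> (insert x C, x)) \<in> Sigma (stab p k A) (\<lambda>B. {x \<in> B. p x = x})"
      using b(1,3) by (simp add: stab_def)
    show "(case (case b of (x, C) \<Rightarrow> (insert x C, x)) of (B, x) \<Rightarrow> (x, B - {x})) = b"
      using \<open>x \<notin> C\<close> unfolding b(1) by simp
  qed
  also have "\<dots> = (\<Sum>x\<in>{x \<in> A. p x = x}. Hop p (k - 1) \<phi> (A - {x}))"
    using assms(2) by (subst sum.Sigma[symmetric]) (auto simp: Hop_def)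
  also have "\<dots> = Hop p 1 (Hop p (k - 1) \<phi>) A"
    using assms(2) unfolding Hop_def[of p 1] s1 by (simp add: sum.reindex)
  finally show ?thesis .
qed

lemma nfix_Diff: "finite A \<Longrightarrow> B \<subseteq> A \<Longrightarrow> nfix p A = nfix p B + nfix p (A - B)"
proof -
  assume A: "finite A" "B \<subseteq> A"
  have eq: "{x \<in> A. p x = x} = {x \<in> B. p x = x} \<union> {x \<in> A - B. p x = x}" using A by auto
  have "card {x \<in> A. p x = x} = card {x \<in> B. p x = x} + card {x \<in> A - B. p x = x}"
    unfolding eq by (rule card_Un_disjoint) (use A finite_subset[OF A(2,1)] in auto)
  then show ?thesis by (simp add: nfix_def)
qed

text \<open>The Leibniz rule matches counting: a fixed point of \<open>p\<close> in \<open>A\<close>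
  lies either in the block split off first or in the rest.\<close>

lemma ch_h1_D_hm:
  assumes "inj p" "finite A" "\<forall>x\<in>#\<mu>. x > 0"
  shows "ch p (hs 1 * der (hm \<mu>)) A = nfix p A * cf p \<mu> A"
  using assms(2,3)
proof (induction \<mu> arbitrary: A)
  case empty
  then show ?case by (auto simp: cf_empty nfix_def)
next
  case (add k \<mu>)
  have k: "k > 0" using add.prems by simp
  have eq: "hs 1 * der (hm (add_mset k \<mu>)) = hs 1 * (hs (k - 1) * hm \<mu>) + hs k * (hs 1 * der (hm \<mu>))"
    using k by (simp add: hm_add_mset_h D_h_mult distrib_left mult.left_commute)
  have c: "ch p (hm \<mu>) = cf p \<mu>" by (intro ext) simp
  have "ch p (hs 1 * (hs (k - 1) * hm \<mu>)) A = Hop p 1 (ch p (hs (k - 1) * hm \<mu>)) A"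
    by (rule ch_h[OF add.prems(1)])
  also have "\<dots> = Hop p 1 (Hop p (k - 1) (cf p \<mu>)) A"
    using add.prems(1) by (simp add: Hop_def[of p "1"] ch_h c del: One_nat_def)
  also have "\<dots> = (\<Sum>B\<in>stab p k A. nfix p B * cf p \<mu> (A - B))"
    by (rule Hop_nfix[OF assms(1) add.prems(1) k, symmetric])
  finally have 1: "ch p (hs 1 * (hs (k - 1) * hm \<mu>)) A = (\<Sum>B\<in>stab p k A. nfix p B * cf p \<mu> (A - B))" .
  have "ch p (hs k * (hs 1 * der (hm \<mu>))) A = (\<Sum>B\<in>stab p k A. ch p (hs 1 * der (hm \<mu>)) (A - B))"
    using add.prems(1) by (simp add: ch_h[of A p k] Hop_def del: One_nat_def)
  also have "\<dots> = (\<Sum>B\<in>stab p k A. nfix p (A - B) * cf p \<mu> (A - B))"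
    using add by (intro sum.cong refl add.IH) auto
  finally have "ch p (hs 1 * der (hm (add_mset k \<mu>))) A = (\<Sum>B\<in>stab p k A. (nfix p B + nfix p (A - B)) * cf p \<mu> (A - B))"
    by (simp only: eq ch_linear 1 sum.distrib distrib_right)
  also have "\<dots> = (\<Sum>B\<in>stab p k A. nfix p A * cf p \<mu> (A - B))"
    using nfix_Diff[OF add.prems(1), of _ p] by (intro sum.cong refl) (auto simp: stab_def)
  also have "\<dots> = nfix p A * cf p (add_mset k \<mu>) A"
    using add.prems(1) by (simp add: cf_add_mset Hop_def sum_distrib_left)
  finally show ?case .
qed

lemma ch_h1_D:
  assumes "inj p" "finite A" "f \<in> Lam n"
  shows "ch p (hs 1 * der f) A = nfix p A * ch p f A"
  using assms(3)
proof (induction rule: Sp_induct)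
  case (hm \<mu>)
  then show ?case using ch_h1_D_hm[OF assms(1,2)] by (simp add: part_def)
qed (simp_all add: distrib_left)

subsection \<open>Sign twists\<close>

definition restr :: "('a \<Rightarrow> 'a) \<Rightarrow> 'a set \<Rightarrow> 'a \<Rightarrow> 'a" where
  "restr p A = (\<lambda>x. if x \<in> A then p x else x)"

definition sg :: "('a \<Rightarrow> 'a) \<Rightarrow> 'a set \<Rightarrow> int" where "sg p A = sign (restr p A)"

lemma stable_inj: "finite A \<Longrightarrow> p ` A = A \<Longrightarrow> inj_on p A"
  by (simp add: eq_card_imp_inj_on)

lemma restr_permutes: "finite A \<Longrightarrow> p ` A = A \<Longrightarrow> restr p A permutes A"
proof (rule bij_imp_permutes)
  assume A: "finite A" "p ` A = A"
  have "bij_betw p A A" using stable_inj[OF A] A(2) by (simp add: bij_betw_def)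
  then show "bij_betw (restr p A) A A" by (rule bij_betw_cong[THEN iffD1, rotated]) (simp add: restr_def)
qed (simp add: restr_def)

lemma stable_Diff: "finite A \<Longrightarrow> p ` A = A \<Longrightarrow> B \<subseteq> A \<Longrightarrow> p ` B = B \<Longrightarrow> p ` (A - B) = A - B"
  using inj_on_image_set_diff[OF stable_inj, of A p A B] by auto

lemma sg_Un:
  assumes "finite A" "finite B" "p ` A = A" "p ` B = B" "A \<inter> B = {}"
  shows "sg p (A \<union> B) = sg p A * sg p B"
proof -
  have "restr p (A \<union> B) = restr p A \<circ> restr p B"
  proof
    fix x show "restr p (A \<union> B) x = (restr p A \<circ> restr p B) x"
      using assms(4,5) by (auto simp: restr_def)
  qed
  moreover have "permutation (restr p A)" "permutation (restr p B)"
    using restr_permutes assms by (auto simp: permutation_permutes)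
  ultimately show ?thesis by (simp add: sg_def sign_compose)
qed

lemma sg_Diff:
  assumes "finite A" "p ` A = A" "B \<in> stab p k A"
  shows "sg p A = sg p B * sg p (A - B)"
proof -
  have B: "B \<subseteq> A" "p ` B = B" "B \<union> (A - B) = A" using assms(3) by (auto simp: stab_def)
  have "finite B" "p ` (A - B) = A - B"
    using finite_subset[OF B(1) assms(1)] stable_Diff[OF assms(1,2) B(1,2)] by auto
  then show ?thesis using sg_Un[of B "A - B" p] B assms(1) by auto
qed

lemma sign_cycle_of_list: "cs \<noteq> [] \<Longrightarrow> distinct cs \<Longrightarrow> sign (cycle_of_list cs) = (- 1) ^ (length cs - 1)"
proof (induction cs rule: cycle_of_list.induct)
  case (1 i j cs)
  then have "sign (cycle_of_list (i # j # cs)) = sign (transpose i j) * sign (cycle_of_list (j # cs))"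
    by (simp add: sign_compose permutation_swap_id permutation_of_cycle)
  then show ?case using 1 by (simp add: sign_swap_id del: cycle_of_list.simps)
qed (auto simp: sign_id id_def[symmetric])

text \<open>A minimal nonempty stable set is a single cycle. A cycle of length c has sign
  (-1)^(c-1).\<close>

lemma sg_minimal:
  assumes "finite C" "p ` C = C" "C \<noteq> {}" and min: "\<And>B. B \<subseteq> C \<Longrightarrow> p ` B = B \<Longrightarrow> B \<noteq> {} \<Longrightarrow> B = C"
  shows "(- 1) ^ card C * sg p C = - 1"
proof -
  define q where "q = restr p C"
  have q: "q permutes C" unfolding q_def using assms by (intro restr_permutes)
  then have pq: "permutation q" using assms(1) by (auto simp: permutation_permutes)
  obtain x where x: "x \<in> C" using assms(3) by blast
  define cs where "cs = support q x"
  have set_cs: "set cs = range (\<lambda>i. (q ^^ i) x)" unfolding cs_def by (rule support_set[OF pq])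
  have sub: "set cs \<subseteq> C"
    unfolding set_cs using permutes_funpow[OF q] x by (auto simp: permutes_in_image)
  have "q ` set cs \<subseteq> set cs"
  proof
    fix y assume "y \<in> q ` set cs"
    then obtain i where "y = q ((q ^^ i) x)" unfolding set_cs by auto
    then have "y = (q ^^ Suc i) x" by simp
    then show "y \<in> set cs" unfolding set_cs by blast
  qed
  then have "q ` set cs = set cs"
    by (intro card_subset_eq) (auto simp: card_image inj_on_subset[OF permutes_inj[OF q]])
  moreover have "q ` set cs = p ` set cs" using sub by (intro image_cong) (auto simp: q_def restr_def)
  moreover have "x \<in> set cs" unfolding set_cs by (rule range_eqI[of _ _ 0]) simp
  ultimately have C: "set cs = C" by (intro min[OF sub]) auto
  have "distinct cs" unfolding cs_def by (rule cycle_of_permutation[OF pq])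
  have "q = cycle_of_list cs"
  proof
    fix y show "q y = cycle_of_list cs y"
    proof (cases "y \<in> C")
      case True
      then show ?thesis using cycle_restrict[OF pq, of y x] C unfolding cs_def by simp
    next
      case False
      then show ?thesis using id_outside_supp[of y cs] C q by (simp add: permutes_not_in)
    qed
  qed
  then have "sg p C = (- 1) ^ (length cs - 1)"
    using sign_cycle_of_list[OF _ \<open>distinct cs\<close>] C assms(3) unfolding sg_def q_def[symmetric] by auto
  moreover have "card C = length cs" "length cs > 0"
    using distinct_card[OF \<open>distinct cs\<close>] C assms(3) by auto
  ultimately show ?thesis by (cases "length cs") (auto simp: power_mult_distrib[symmetric])
qed

text \<open>Every stable subset contains or avoids a chosen cycle \<open>C\<close>. Adding or
  removing \<open>C\<close> pairs the subsets so that the terms cancel.\<close>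

lemma sum_signs:
  assumes A: "finite A" "p ` A = A" "A \<noteq> {}"
  shows "(\<Sum>B\<in>{B. B \<subseteq> A \<and> p ` B = B}. (- 1) ^ card B * sg p B) = 0"
proof -
  define S where "S = {B. B \<subseteq> A \<and> p ` B = B}"
  have fS: "finite S" unfolding S_def by (rule finite_subset[of _ "Pow A"]) (use A in auto)
  obtain C where C: "C \<in> S - {{}}" and min: "\<And>B. B \<in> S - {{}} \<Longrightarrow> B \<subseteq> C \<Longrightarrow> B = C"
  proof -
    have "S - {{}} \<noteq> {}" using A by (auto simp: S_def)
    then show ?thesis using finite_has_minimal[of "S - {{}}"] fS that by blast
  qed
  have C': "finite C" "p ` C = C" "C \<noteq> {}" "C \<subseteq> A" using C finite_subset[OF _ A(1)] by (auto simp: S_def)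
  have fin: "finite B" if "B \<in> S" for B using that finite_subset[OF _ A(1)] by (auto simp: S_def)
  have tC: "(- 1) ^ card C * sg p C = - 1"
    using C' min by (intro sg_minimal) (auto simp: S_def)
  have dich: "B \<inter> C = {} \<or> C \<subseteq> B" if "B \<in> S" for B
  proof -
    have "p ` (B \<inter> C) = p ` B \<inter> p ` C"
      using that C' by (intro inj_on_image_Int[OF stable_inj[OF A(1,2)]]) (auto simp: S_def)
    then show ?thesis using min[of "B \<inter> C"] that C' by (auto simp: S_def)
  qed
  define S0 where "S0 = {B \<in> S. B \<inter> C = {}}"
  have S: "S = S0 \<union> (\<lambda>B. B \<union> C) ` S0"
  proof (intro equalityI subsetI)
    fix B assume B: "B \<in> S"
    show "B \<in> S0 \<union> (\<lambda>B. B \<union> C) ` S0"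
    proof (cases "B \<inter> C = {}")
      case False
      then have "C \<subseteq> B" using dich[OF B] by blast
      then have "B = (B - C) \<union> C" "B - C \<in> S0"
        using B stable_Diff[of B p C] fin[OF B] C' by (auto simp: S0_def S_def)
      then show ?thesis by blast
    qed (use B in \<open>simp add: S0_def\<close>)
  next
    fix B assume "B \<in> S0 \<union> (\<lambda>B. B \<union> C) ` S0"
    then show "B \<in> S" using C' by (auto simp: S0_def S_def image_Un)
  qed
  let ?t = "\<lambda>B. (- 1) ^ card B * sg p B"
  have "sum ?t S = sum ?t S0 + sum ?t ((\<lambda>B. B \<union> C) ` S0)"
    unfolding S by (rule sum.union_disjoint) (use fS C' in \<open>auto simp: S0_def\<close>)
  also have "sum ?t ((\<lambda>B. B \<union> C) ` S0) = (\<Sum>B\<in>S0. ?t (B \<union> C))"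
    by (subst sum.reindex) (auto simp: inj_on_def S0_def)
  also have "\<dots> = (\<Sum>B\<in>S0. - ?t B)"
  proof (rule sum.cong[OF refl])
    fix B assume B: "B \<in> S0"
    then have b: "finite B" "p ` B = B" "B \<inter> C = {}" using fin by (auto simp: S0_def S_def)
    have "?t (B \<union> C) = ?t B * ?t C"
      using sg_Un[OF b(1) C'(1) b(2) C'(2) b(3)] card_Un_disjoint[OF b(1) C'(1) b(3)]
      by (simp add: power_add)
    then show "?t (B \<union> C) = - ?t B" unfolding tC by simp
  qed
  finally show ?thesis unfolding S_def[symmetric] by (simp add: sum_negf)
qed

text \<open>The action of e_k: one block is split off and weighted with the sign of \<open>p\<close>
  on it.\<close>

definition Eop :: "('a \<Rightarrow> 'a) \<Rightarrow> nat \<Rightarrow> ('a set \<Rightarrow> int) \<Rightarrow> 'a set \<Rightarrow> int" where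
  "Eop p k \<phi> A = (\<Sum>B\<in>stab p k A. sg p B * \<phi> (A - B))"

text \<open>Collecting the two blocks by their union E leaves, for each E, a signed sum over the
  stable subsets of E. It vanishes because E has \<open>m > 0\<close> elements.\<close>

lemma alternating_Eop_Hop:
  assumes A: "finite A" "p ` A = A" and "m > 0"
  shows "(\<Sum>i\<le>m. (- 1) ^ i * Eop p i (Hop p (m - i) \<phi>) A) = 0"
proof -
  define S where "S X = {B. B \<subseteq> X \<and> p ` B = B}" for X
  have fin: "finite X" if "X \<subseteq> A" for X using finite_subset[OF that A(1)] .
  have "(\<Sum>i\<le>m. (- 1) ^ i * Eop p i (Hop p (m - i) \<phi>) A) =
      (\<Sum>i\<le>m. \<Sum>B\<in>stab p i A. \<Sum>C\<in>stab p (m - i) (A - B). (- 1) ^ card B * sg p B * \<phi> (A - B - C))"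
    using A(1) by (simp add: Eop_def Hop_def sum_distrib_left mult.assoc)
      (intro sum.cong refl, auto simp: stab_def)
  also have "\<dots> = (\<Sum>(i, B, C)\<in>(SIGMA i:{..m}. SIGMA B:stab p i A. stab p (m - i) (A - B)).
      (- 1) ^ card B * sg p B * \<phi> (A - B - C))"
    using A(1) by (simp add: sum.Sigma)
  also have "\<dots> = (\<Sum>(E, B)\<in>(SIGMA E:stab p m A. S E). (- 1) ^ card B * sg p B * \<phi> (A - E))"
  proof (rule sum.reindex_bij_witness[where i = "\<lambda>(E, B). (card B, B, E - B)" and j = "\<lambda>(i, B, C). (B \<union> C, B)"])
    fix a assume "a \<in> (SIGMA i:{..m}. SIGMA B:stab p i A. stab p (m - i) (A - B))"
    then obtain i B C where a: "a = (i, B, C)" "i \<le> m" "B \<subseteq> A" "p ` B = B" "card B = i"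
      "C \<subseteq> A - B" "p ` C = C" "card C = m - i"
      by (auto simp: stab_def)
    have bc: "B \<inter> C = {}" "finite B" "finite C" using a(3,6) fin[of B] fin[of C] by auto
    have "card (B \<union> C) = m" using card_Un_disjoint[OF bc(2,3,1)] a by simp
    then show "(case a of (i, B, C) \<Rightarrow> (B \<union> C, B)) \<in> (SIGMA E:stab p m A. S E)"
      using a by (auto simp: stab_def S_def image_Un)
    show "(case (case a of (i, B, C) \<Rightarrow> (B \<union> C, B)) of (E, B) \<Rightarrow> (card B, B, E - B)) = a"
      using a bc(1) by auto
    have "A - (B \<union> C) = A - B - C" by auto
    then show "(case (case a of (i, B, C) \<Rightarrow> (B \<union> C, B)) of (E, B) \<Rightarrow> (- 1) ^ card B * sg p B * \<phi> (A - E))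
        = (case a of (i, B, C) \<Rightarrow> (- 1) ^ card B * sg p B * \<phi> (A - B - C))"
      using a(1) by simp
  next
    fix b assume "b \<in> (SIGMA E:stab p m A. S E)"
    then obtain E B where b: "b = (E, B)" "E \<subseteq> A" "p ` E = E" "card E = m" "B \<subseteq> E" "p ` B = B"
      by (auto simp: stab_def S_def)
    have "p ` (E - B) = E - B" using stable_Diff[OF fin[OF b(2)] b(3,5,6)] .
    moreover have "card B \<le> m" "card (E - B) = m - card B"
      using card_mono[OF fin[OF b(2)] b(5)] card_Diff_subset[of B E] fin b by auto
    ultimately show "(case b of (E, B) \<Rightarrow> (card B, B, E - B)) \<in> (SIGMA i:{..m}. SIGMA B:stab p i A. stab p (m - i) (A - B))"
      using b by (auto simp: stab_def)
    show "(case (case b of (E, B) \<Rightarrow> (card B, B, E - B)) of (i, B, C) \<Rightarrow> (B \<union> C, B)) = b"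
      using b by auto
  qed
  also have "\<dots> = (\<Sum>E\<in>stab p m A. (\<Sum>B\<in>S E. (- 1) ^ card B * sg p B) * \<phi> (A - E))"
  proof -
    have "finite (S E)" if "E \<in> stab p m A" for E
    proof (rule finite_subset)
      show "S E \<subseteq> Pow E" by (auto simp: S_def)
      show "finite (Pow E)" using that fin[of E] by (simp add: stab_def)
    qed
    then show ?thesis using A(1) by (subst sum.Sigma[symmetric]) (auto simp: sum_distrib_right)
  qed
  also have "\<dots> = 0"
  proof (rule sum.neutral, rule ballI)
    fix E assume "E \<in> stab p m A"
    then have "finite E" "p ` E = E" "E \<noteq> {}" using assms(3) fin by (auto simp: stab_def)
    then show "(\<Sum>B\<in>S E. (- 1) ^ card B * sg p B) * \<phi> (A - E) = 0"
      using sum_signs[of E p] by (simp add: S_def)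
  qed
  finally show ?thesis .
qed

text \<open>The elementary symmetric functions, from \<open>\<Sum>i\<le>m. (- 1) ^ i * e\<^sub>i * h\<^sub>m\<^sub>-\<^sub>i = 0\<close>.\<close>

fun eps :: "nat \<Rightarrow> symf" where
  "eps m = (if m = 0 then 1 else - (\<Sum>i<m. of_int ((- 1) ^ (m + i)) * (hs (m - i) * eps i)))"

declare eps.simps [simp del]

lemma eps_Lam: "eps m \<in> Lam m"
proof (induction m rule: less_induct)
  case (less m)
  have "hs (m - i) * eps i \<in> Lam m" if "i < m" for i
    using Lam_h_mult[OF less[OF that], of "m - i"] that by simp
  moreover have "1 \<in> Lam 0" using Sp_hm[of "{#}" "part 0"] by simp
  ultimately show ?case
    by (subst eps.simps) (auto intro!: Sp_uminus Sp_sum Sp_of_int simp del: Sp_hm part_0 of_int_power of_int_minus)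
qed

text \<open>Both sides satisfy the same recursion, which solves the alternating relation for its
  last term; the sign (-1)^(m+i) comes from dividing by (-1)^m.\<close>

lemma ch_eps:
  assumes "finite A" "p ` A = A"
  shows "ch p (eps m * f) A = Eop p m (ch p f) A"
proof (induction m arbitrary: f rule: less_induct)
  case (less m)
  show ?case
  proof (cases "m = 0")
    case True
    have "stab p 0 A = {{}}" using finite_subset[OF _ assms(1)] by (auto simp: stab_def)
    moreover have "restr p {} = id" by (auto simp: restr_def)
    ultimately show ?thesis using True by (simp add: eps.simps Eop_def sg_def sign_id)
  next
    case False
    have "Eop p i (ch p (hs k * f)) A = Eop p i (Hop p k (ch p f)) A" for i k
      using assms(1) by (simp add: Eop_def ch_h)
    then have "ch p (hs (m - i) * eps i * f) A = Eop p i (Hop p (m - i) (ch p f)) A" if "i < m" for i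
      using less[OF that, of "hs (m - i) * f"] by (simp add: mult.left_commute mult.assoc)
    then have "ch p (eps m * f) A = - (\<Sum>i<m. (- 1) ^ (m + i) * Eop p i (Hop p (m - i) (ch p f)) A)"
      using False by (subst eps.simps) (simp add: sum_distrib_right mult.assoc del: of_int_power of_int_minus)
    also have "\<dots> = - ((- 1) ^ m * (\<Sum>i<m. (- 1) ^ i * Eop p i (Hop p (m - i) (ch p f)) A))"
      by (simp add: sum_distrib_left power_add mult.assoc)
    also have "(\<Sum>i<m. (- 1) ^ i * Eop p i (Hop p (m - i) (ch p f)) A) = - ((- 1) ^ m * Eop p m (Hop p 0 (ch p f)) A)"
      using alternating_Eop_Hop[OF assms, of m "ch p f"] False
      by (simp add: lessThan_Suc_atMost[symmetric] del: lessThan_Suc_atMost)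
    also have "Eop p m (Hop p 0 (ch p f)) A = Eop p m (ch p f) A"
      using assms(1) by (simp add: Eop_def Hop_0)
    finally show ?thesis by (simp add: mult.assoc[symmetric] power_mult_distrib[symmetric])
  qed
qed

lemma Lam_mult: "f \<in> Lam a \<Longrightarrow> g \<in> Lam b \<Longrightarrow> f * g \<in> Lam (a + b)"
proof (induction rule: Sp_induct)
  case (hm \<mu>)
  then have \<mu>: "\<forall>x\<in>#\<mu>. x > 0" "sum_mset \<mu> = a" by (auto simp: part_def)
  have "hm \<mu> * g \<in> Lam (b + sum_mset \<mu>)" using \<mu>(1)
  proof (induction \<mu>)
    case (add k \<mu>)
    then show ?case using Lam_h_mult[of "hm \<mu> * g" "b + sum_mset \<mu>" k]
      by (simp add: hm_add_mset_h mult.assoc ac_simps)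
  qed (use hm in simp)
  then show ?case using \<mu> by (simp add: add.commute)
qed (auto simp: distrib_right)

text \<open>The sign of \<open>p\<close> is the product of its signs on the blocks, so a twist
  replaces each h_k by e_k. One element serves all \<open>p\<close> and \<open>A\<close>
  simultaneously, as the induction on \<mu> requires.\<close>

lemma sg_cf:
  "\<exists>g \<in> Lam (sum_mset \<mu>). \<forall>p. \<forall>A :: 'a set. finite A \<longrightarrow> p ` A = A \<longrightarrow> sg p A * cf p \<mu> A = ch p g A"
proof (induction \<mu>)
  case empty
  have "1 \<in> Lam 0" using Sp_hm[of "{#}" "part 0"] by simp
  moreover have "ch p 1 A = cf p {#} A" for p and A :: "'a set" using ch_linear(7)[of p "{#}" A] by simp
  moreover have "restr p {} = id" for p :: "'a \<Rightarrow> 'a" by (auto simp: restr_def)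
  ultimately show ?case by (intro bexI[of _ 1]) (auto simp: cf_empty sg_def sign_id)
next
  case (add k \<mu>)
  then obtain g where g: "g \<in> Lam (sum_mset \<mu>)"
    "\<And>p. \<And>A :: 'a set. finite A \<Longrightarrow> p ` A = A \<Longrightarrow> sg p A * cf p \<mu> A = ch p g A" by blast
  have "sg p A * cf p (add_mset k \<mu>) A = ch p (eps k * g) A" if A: "finite A" "p ` A = A" for p and A :: "'a set"
  proof -
    have "sg p A * cf p \<mu> (A - B) = sg p B * ch p g (A - B)" if B: "B \<in> stab p k A" for B
    proof -
      have "p ` (A - B) = A - B" using B by (intro stable_Diff A) (auto simp: stab_def)
      then show ?thesis using g(2)[of "A - B" p] A(1) by (simp add: sg_Diff[OF A B] mult.assoc)
    qed
    then show ?thesis using A by (simp add: cf_add_mset Hop_def ch_eps Eop_def sum_distrib_left)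
  qed
  moreover have "eps k * g \<in> Lam (sum_mset (add_mset k \<mu>))" using Lam_mult[OF eps_Lam g(1)] by simp
  ultimately show ?case by blast
qed

subsection \<open>Pairing permutation characters with their sign twists\<close>

text \<open>Ordered set partitions with block sizes \<open>ks\<close>, encoded as maps to block
  numbers. Then a permutation acts by composition, and two set partitions combine into one map to a
  grid.\<close>

definition colorings :: "'a set \<Rightarrow> nat list \<Rightarrow> ('a \<Rightarrow> nat) set" where
  "colorings A ks = {f \<in> A \<rightarrow>\<^sub>E {..<length ks}. \<forall>i<length ks. card {x \<in> A. f x = i} = ks ! i}"

definition fixed_colorings :: "('a \<Rightarrow> 'a) \<Rightarrow> 'a set \<Rightarrow> nat list \<Rightarrow> ('a \<Rightarrow> nat) set" where
  "fixed_colorings p A ks = {f \<in> colorings A ks. \<forall>x\<in>A. f (p x) = f x}"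

lemma finite_colorings [simp]: "finite A \<Longrightarrow> finite (colorings A ks)"
  unfolding colorings_def by (rule finite_subset[OF _ finite_PiE[of A "\<lambda>_. {..<length ks}"]]) auto

lemma finite_fixed_colorings [simp]: "finite A \<Longrightarrow> finite (fixed_colorings p A ks)"
  unfolding fixed_colorings_def by simp

lemma card_eqI_witness:
  assumes "\<And>x. x \<in> L \<Longrightarrow> F x \<in> R \<and> G (F x) = x" "\<And>y. y \<in> R \<Longrightarrow> G y \<in> L \<and> F (G y) = y"
  shows "card L = card R"
  by (rule bij_betw_same_card[of F], rule bij_betw_byWitness[of _ G]) (use assms in auto)

text \<open>The last color class is the block split off. Taking it from the end of the list leaves
  the other colors with their numbers.\<close>

lemma cols_snoc:
  assumes A: "finite A" "p ` A = A"
  shows "card (fixed_colorings p A (ks @ [k])) = (\<Sum>B\<in>stab p k A. card (fixed_colorings p (A - B) ks))"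
proof -
  let ?l = "length ks"
  have fB: "finite (A - B)" for B using A(1) by simp
  let ?F = "\<lambda>f. ({x \<in> A. f x = ?l}, restrict f (A - {x \<in> A. f x = ?l}))"
  let ?G = "\<lambda>(B, g). \<lambda>x\<in>A. if x \<in> B then ?l else g x"
  have "card (fixed_colorings p A (ks @ [k])) = card (SIGMA B:stab p k A. fixed_colorings p (A - B) ks)"
  proof (rule card_eqI_witness[of _ ?F _ ?G])
    fix f assume f: "f \<in> fixed_colorings p A (ks @ [k])"
    have fA: "f x < Suc ?l" if "x \<in> A" for x using f that by (auto simp: fixed_colorings_def colorings_def PiE_def)
    have fp: "f (p x) = f x" if "x \<in> A" for x using f that by (auto simp: fixed_colorings_def)
    have fe: "f x = undefined" if "x \<notin> A" for x using f that by (auto simp: fixed_colorings_def colorings_def PiE_def extensional_def)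
    define B where "B = {x \<in> A. f x = ?l}"
    have GF: "?G (?F f) = f" by (auto simp: fe fun_eq_iff restrict_def)
    have "p ` B = B"
    proof (rule card_subset_eq)
      show "finite B" using A(1) by (simp add: B_def)
      show "p ` B \<subseteq> B" using A(2) fp by (auto simp: B_def)
      show "card (p ` B) = card B"
        by (rule card_image) (auto intro: inj_on_subset[OF stable_inj[OF A]] simp: B_def)
    qed
    moreover have "card B = k" using f by (auto simp: B_def fixed_colorings_def colorings_def nth_append)
    ultimately have B: "B \<in> stab p k A" by (auto simp: stab_def B_def)
    have pd: "p x \<in> A - B" if "x \<in> A - B" for x
      using that A(2) fp by (auto simp: B_def)
    have "card {x \<in> A - B. restrict f (A - B) x = i} = ks ! i" if "i < ?l" for i
    proof -
      have "{x \<in> A - B. restrict f (A - B) x = i} = {x \<in> A. f x = i}" using that by (auto simp: B_def)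
      moreover have "\<forall>i < Suc ?l. card {x \<in> A. f x = i} = (ks @ [k]) ! i"
        using f by (simp add: fixed_colorings_def colorings_def)
      ultimately show ?thesis using that by (simp add: nth_append)
    qed
    moreover have "f x < ?l" if "x \<in> A - B" for x using fA[of x] that by (auto simp: B_def less_Suc_eq)
    ultimately have "restrict f (A - B) \<in> fixed_colorings p (A - B) ks"
      using pd fp by (auto simp: fixed_colorings_def colorings_def)
    then show "?F f \<in> (SIGMA B:stab p k A. fixed_colorings p (A - B) ks) \<and> ?G (?F f) = f"
      using B GF unfolding B_def by blast
  next
    fix y assume y: "y \<in> (SIGMA B:stab p k A. fixed_colorings p (A - B) ks)"
    obtain B g where yB: "y = (B, g)" by (cases y)
    with y have B: "B \<in> stab p k A" and g: "g \<in> fixed_colorings p (A - B) ks" by auto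
    let ?f = "\<lambda>x\<in>A. if x \<in> B then ?l else g x"
    have b: "B \<subseteq> A" "p ` B = B" "card B = k" using B by (auto simp: stab_def)
    have gl: "g x < ?l" if "x \<in> A - B" for x using g that by (auto simp: fixed_colorings_def colorings_def PiE_def)
    have ge: "g x = undefined" if "x \<notin> A - B" for x
      using g that by (auto simp: fixed_colorings_def colorings_def PiE_def extensional_def)
    have eB: "{x \<in> A. ?f x = ?l} = B" 
    proof -
      have "g x \<noteq> ?l" if "x \<in> A" "x \<notin> B" for x using gl[of x] that by auto
      then show ?thesis using b(1) by (auto split: if_splits)
    qed
    have "restrict ?f (A - B) = g" using ge by (auto simp: fun_eq_iff restrict_def)
    then have FG: "?F (?G y) = y" using eB unfolding yB prod.case by simp
    have pd: "p ` (A - B) = A - B" by (rule stable_Diff[OF A b(1,2)])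
    have "?f (p x) = ?f x" if "x \<in> A" for x
    proof (cases "x \<in> B")
      case True
      then have "p x \<in> B" using b(2) by blast
      then show ?thesis using True b(1) by auto
    next
      case False
      then have "p x \<in> A - B" using pd that by blast
      then show ?thesis using False that g by (auto simp: fixed_colorings_def)
    qed
    moreover have "\<forall>i<Suc ?l. card {x \<in> A. ?f x = i} = (ks @ [k]) ! i"
    proof (intro allI impI)
      fix i assume that: "i < Suc ?l"
      show "card {x \<in> A. ?f x = i} = (ks @ [k]) ! i"
      proof (cases "i = ?l")
        case True
        then show ?thesis using eB b(3) by simp
      next
        case False
        then have "{x \<in> A. ?f x = i} = {x \<in> A - B. g x = i}" by auto
        then show ?thesis using g that False by (simp add: fixed_colorings_def colorings_def nth_append)
      qed
    qed
    moreover have "?f \<in> A \<rightarrow>\<^sub>E {..<Suc ?l}" using gl by (auto simp: less_Suc_eq)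
    ultimately have "?f \<in> fixed_colorings p A (ks @ [k])"
      unfolding fixed_colorings_def colorings_def by (simp del: restrict_apply)
    then show "?G y \<in> fixed_colorings p A (ks @ [k]) \<and> ?F (?G y) = y" using FG unfolding yB prod.case by blast
  qed
  also have "\<dots> = (\<Sum>B\<in>stab p k A. card (fixed_colorings p (A - B) ks))"
    using A(1) fB by (intro card_SigmaI) auto
  finally show ?thesis .
qed

lemma cf_cols: "finite A \<Longrightarrow> p ` A = A \<Longrightarrow> cf p (mset ks) A = int (card (fixed_colorings p A ks))"
proof (induction ks arbitrary: A rule: rev_induct)
  case Nil
  have "fixed_colorings p A [] = (if A = {} then {\<lambda>x. undefined} else {})" by (auto simp: fixed_colorings_def colorings_def)
  then show ?case by (simp add: cf_empty)
next
  case (snoc k ks)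
  have "cf p (mset (ks @ [k])) A = (\<Sum>B\<in>stab p k A. cf p (mset ks) (A - B))"
    using snoc.prems(1) by (simp add: cf_add_mset Hop_def)
  also have "\<dots> = (\<Sum>B\<in>stab p k A. int (card (fixed_colorings p (A - B) ks)))"
  proof (rule sum.cong[OF refl])
    fix B assume "B \<in> stab p k A"
    then have "p ` (A - B) = A - B" by (intro stable_Diff[OF snoc.prems]) (auto simp: stab_def)
    then show "cf p (mset ks) (A - B) = int (card (fixed_colorings p (A - B) ks))"
      using snoc.prems(1) by (intro snoc.IH) auto
  qed
  finally show ?case by (simp add: cols_snoc[OF snoc.prems])
qed

text \<open>The 0-1 matrices with row sums \<open>ks\<close> and column sums \<open>js\<close>,
  given by the set of their cells with entry 1.\<close>

definition margins :: "nat list \<Rightarrow> nat list \<Rightarrow> (nat \<times> nat) set set" where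
  "margins ks js = {B. B \<subseteq> {..<length ks} \<times> {..<length js} \<and>
     (\<forall>i<length ks. card {j. (i, j) \<in> B} = ks ! i) \<and> (\<forall>j<length js. card {i. (i, j) \<in> B} = js ! j)}"

lemma finite_margins [simp]: "finite (margins ks js)"
  by (rule finite_subset[of _ "Pow ({..<length ks} \<times> {..<length js})"]) (auto simp: margins_def)

text \<open>If \<open>F x = F y\<close>, then composition with the transposition of \<open>x\<close> and \<open>y\<close> cancels the sum.\<close>

lemma sum_sign_stabilizer:
  fixes F :: "'a \<Rightarrow> 'b"
  assumes "finite A"
  shows "(\<Sum>p\<in>{p. p permutes A \<and> (\<forall>x\<in>A. F (p x) = F x)}. sign p) = (if inj_on F A then 1 else 0)"
proof (cases "inj_on F A")
  case True
  have "p = id" if "p permutes A" "\<forall>x\<in>A. F (p x) = F x" for p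
  proof
    fix x show "p x = id x"
      using that True by (cases "x \<in> A") (auto simp: permutes_not_in permutes_in_image dest: inj_onD)
  qed
  then have "{p. p permutes A \<and> (\<forall>x\<in>A. F (p x) = F x)} = {id}" by (auto simp: permutes_id)
  then show ?thesis using True by (simp add: sign_id)
next
  case False
  then obtain x y where xy: "x \<in> A" "y \<in> A" "x \<noteq> y" "F x = F y" by (auto simp: inj_on_def)
  let ?S = "{p. p permutes A \<and> (\<forall>x\<in>A. F (p x) = F x)}" and ?t = "transpose x y"
  have t: "?t permutes A" using xy by (simp add: permutes_swap_id)
  have Ft: "F (?t z) = F z" for z using xy(4) by (auto simp: transpose_def)
  have S: "p \<circ> ?t \<in> ?S" if "p \<in> ?S" for p
    using that Ft permutes_in_image[OF t] by (auto intro: permutes_compose[OF t])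
  have tt: "(p \<circ> ?t) \<circ> ?t = p" for p :: "'a \<Rightarrow> 'a" by (simp add: comp_assoc)
  have "(\<Sum>p\<in>?S. sign p) = (\<Sum>p\<in>?S. sign (p \<circ> ?t))"
    by (rule sum.reindex_bij_witness[of _ "\<lambda>p. p \<circ> ?t" "\<lambda>p. p \<circ> ?t"]) (use S tt in auto)
  also have "\<dots> = (\<Sum>p\<in>?S. - sign p)"
  proof (rule sum.cong[OF refl])
    fix p assume "p \<in> ?S"
    then have "permutation p" using assms by (auto simp: permutation_permutes)
    then show "sign (p \<circ> ?t) = - sign p"
      using xy(3) by (simp add: sign_compose permutation_swap_id sign_swap_id)
  qed
  finally show ?thesis using False by (simp add: sum_negf)
qed

lemma card_fst_fiber: "B \<subseteq> {..<a} \<times> {..<b} \<Longrightarrow> card {z \<in> B. fst z = i} = card {j. (i, j) \<in> B}"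
  by (rule bij_betw_same_card[of snd]) (auto simp: bij_betw_def inj_on_def image_iff)

lemma card_snd_fiber: "B \<subseteq> {..<a} \<times> {..<b} \<Longrightarrow> card {z \<in> B. snd z = j} = card {i. (i, j) \<in> B}"
  by (rule bij_betw_same_card[of fst]) (auto simp: bij_betw_def inj_on_def image_iff)

lemma card_W_elem: "B \<in> margins ks js \<Longrightarrow> card B = sum_list ks"
proof -
  assume B: "B \<in> margins ks js"
  then have sub: "B \<subseteq> {..<length ks} \<times> {..<length js}" by (simp add: margins_def)
  have "B = (SIGMA i:{..<length ks}. {j. (i, j) \<in> B})" using sub by auto
  moreover have "finite {j. (i, j) \<in> B}" for i
    by (rule finite_subset[of _ "{..<length js}"]) (use sub in auto)
  ultimately have "card B = (\<Sum>i<length ks. card {j. (i, j) \<in> B})"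
    by (metis card_SigmaI finite_lessThan)
  also have "\<dots> = (\<Sum>i<length ks. ks ! i)" using B by (simp add: margins_def)
  finally show ?thesis by (simp add: sum_list_sum_nth atLeast0LessThan)
qed

text \<open>The image of an injective pair of colorings is a 0-1 matrix with the given margins.
  Conversely such a matrix has as many cells as \<open>A\<close> has points, so it arises from (card
  \<open>A\<close>)! bijections.\<close>

lemma card_inj_pairs:
  assumes A: "finite A" "card A = sum_list ks"
  shows "card {(f, g). f \<in> colorings A ks \<and> g \<in> colorings A js \<and> inj_on (\<lambda>x. (f x, g x)) A} = fact (card A) * card (margins ks js)"
proof -
  let ?L = "{(f, g). f \<in> colorings A ks \<and> g \<in> colorings A js \<and> inj_on (\<lambda>x. (f x, g x)) A}"
  let ?R = "SIGMA B:margins ks js. {u \<in> A \<rightarrow>\<^sub>E B. inj_on u A}"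
  let ?F = "\<lambda>(f, g). ((\<lambda>x. (f x, g x)) ` A, \<lambda>x\<in>A. (f x, g x))"
  let ?G = "\<lambda>(B, u). (\<lambda>x\<in>A. fst (u x), \<lambda>x\<in>A. snd (u x))"
  have "card ?L = card ?R"
  proof (rule card_eqI_witness[of _ ?F _ ?G])
    fix z assume z: "z \<in> ?L"
    obtain f g where zf: "z = (f, g)" by (cases z)
    with z have f: "f \<in> colorings A ks" and g: "g \<in> colorings A js" and inj: "inj_on (\<lambda>x. (f x, g x)) A" by auto
    have fe: "f x = undefined" "g x = undefined" if "x \<notin> A" for x
      using f g that by (auto simp: colorings_def PiE_def extensional_def)
    have fA: "f x < length ks" "g x < length js" if "x \<in> A" for x
      using f g that by (auto simp: colorings_def PiE_def)
    let ?B = "(\<lambda>x. (f x, g x)) ` A" and ?u = "\<lambda>x\<in>A. (f x, g x)"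
    have GF: "?G (?F z) = z" using fe by (auto simp: zf fun_eq_iff restrict_def)
    have sub: "?B \<subseteq> {..<length ks} \<times> {..<length js}" using fA by auto
    have "card {j. (i, j) \<in> ?B} = ks ! i" if "i < length ks" for i
    proof -
      have "{z \<in> ?B. fst z = i} = (\<lambda>x. (f x, g x)) ` {x \<in> A. f x = i}" by auto
      then have "card {z \<in> ?B. fst z = i} = card {x \<in> A. f x = i}"
        using inj by (simp add: card_image inj_on_def)
      then show ?thesis using card_fst_fiber[OF sub, of i] f that by (simp add: colorings_def)
    qed
    moreover have "card {i. (i, j) \<in> ?B} = js ! j" if "j < length js" for j
    proof -
      have "{z \<in> ?B. snd z = j} = (\<lambda>x. (f x, g x)) ` {x \<in> A. g x = j}" by auto
      then have "card {z \<in> ?B. snd z = j} = card {x \<in> A. g x = j}"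
        using inj by (simp add: card_image inj_on_def)
      then show ?thesis using card_snd_fiber[OF sub, of j] g that by (simp add: colorings_def)
    qed
    ultimately have "?B \<in> margins ks js" using sub by (simp add: margins_def)
    moreover have "inj_on ?u A" using inj by (simp add: inj_on_def)
    ultimately have "?F z \<in> ?R" by (auto simp: zf)
    then show "?F z \<in> ?R \<and> ?G (?F z) = z" using GF by blast
  next
    fix y assume y: "y \<in> ?R"
    obtain B u where yB: "y = (B, u)" by (cases y)
    with y have B: "B \<in> margins ks js" and u: "u \<in> A \<rightarrow>\<^sub>E B" and inj: "inj_on u A" by auto
    have sub: "B \<subseteq> {..<length ks} \<times> {..<length js}" using B by (simp add: margins_def)
    then have "finite B" by (rule finite_subset) simp
    then have uA: "u ` A = B"
      using u inj card_W_elem[OF B] A by (intro card_subset_eq) (auto simp: card_image)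
    have eq: "(\<lambda>x. ((\<lambda>x\<in>A. fst (u x)) x, (\<lambda>x\<in>A. snd (u x)) x)) ` A = u ` A"
      by (intro image_cong) auto
    have "u x = undefined" if "x \<notin> A" for x using u that by (auto simp: PiE_def extensional_def)
    then have "(\<lambda>x\<in>A. ((\<lambda>x\<in>A. fst (u x)) x, (\<lambda>x\<in>A. snd (u x)) x)) = u"
      by (auto simp: fun_eq_iff restrict_def)
    then have FG: "?F (?G y) = y" using eq uA unfolding yB prod.case by simp
    have uB: "u x \<in> B" if "x \<in> A" for x using u that by auto
    have "card {x \<in> A. fst (u x) = i} = ks ! i" if "i < length ks" for i
    proof -
      have "{z \<in> B. fst z = i} = u ` {x \<in> A. fst (u x) = i}" using uA by auto
      then have "card {z \<in> B. fst z = i} = card {x \<in> A. fst (u x) = i}"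
        using inj by (simp add: card_image inj_on_subset)
      then show ?thesis using card_fst_fiber[OF sub, of i] B that by (simp add: margins_def)
    qed
    moreover have "{x \<in> A. (\<lambda>x\<in>A. fst (u x)) x = i} = {x \<in> A. fst (u x) = i}" for i by auto
    moreover have "fst (u x) < length ks" if "x \<in> A" for x using uB[OF that] sub by (cases "u x") auto
    ultimately have c1: "(\<lambda>x\<in>A. fst (u x)) \<in> colorings A ks" by (auto simp: colorings_def)
    have "card {x \<in> A. snd (u x) = j} = js ! j" if "j < length js" for j
    proof -
      have "{z \<in> B. snd z = j} = u ` {x \<in> A. snd (u x) = j}" using uA by auto
      then have "card {z \<in> B. snd z = j} = card {x \<in> A. snd (u x) = j}"
        using inj by (simp add: card_image inj_on_subset)
      then show ?thesis using card_snd_fiber[OF sub, of j] B that by (simp add: margins_def)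
    qed
    moreover have "{x \<in> A. (\<lambda>x\<in>A. snd (u x)) x = i} = {x \<in> A. snd (u x) = i}" for i by auto
    moreover have "snd (u x) < length js" if "x \<in> A" for x using uB[OF that] sub by (cases "u x") auto
    ultimately have c2: "(\<lambda>x\<in>A. snd (u x)) \<in> colorings A js" by (auto simp: colorings_def)
    have "inj_on (\<lambda>x. ((\<lambda>x\<in>A. fst (u x)) x, (\<lambda>x\<in>A. snd (u x)) x)) A"
      using inj by (auto simp: inj_on_def prod_eq_iff)
    with c1 c2 have "?G y \<in> ?L" by (simp add: yB)
    then show "?G y \<in> ?L \<and> ?F (?G y) = y" using FG by blast
  qed
  also have "\<dots> = (\<Sum>B\<in>margins ks js. card {u \<in> A \<rightarrow>\<^sub>E B. inj_on u A})"
  proof (rule card_SigmaI)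
    show "\<forall>B\<in>margins ks js. finite {u \<in> A \<rightarrow>\<^sub>E B. inj_on u A}"
    proof
      fix B assume "B \<in> margins ks js"
      then have "finite B" by (auto simp: margins_def intro: finite_subset)
      then have "finite (A \<rightarrow>\<^sub>E B)" using A(1) by (intro finite_PiE) auto
      then show "finite {u \<in> A \<rightarrow>\<^sub>E B. inj_on u A}" by simp
    qed
  qed simp
  also have "\<dots> = (\<Sum>B\<in>margins ks js. fact (card A))"
  proof (rule sum.cong[OF refl])
    fix B assume B: "B \<in> margins ks js"
    then have "finite B" by (auto simp: margins_def intro: finite_subset)
    then show "card {u \<in> A \<rightarrow>\<^sub>E B. inj_on u A} = fact (card A)"
      using card_inj_on_subset_funcset[OF A(1), of B A] card_W_elem[OF B] A(2) by (simp add: fact_prod_rev)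
  qed
  finally show ?thesis by simp
qed

text \<open>After the sums are exchanged, each pair of colorings contributes the signed count of its
  stabilizer, which is 1 if the pair separates points and 0 otherwise.\<close>

lemma sign_pairing:
  assumes A: "finite A" "card A = sum_list ks"
  shows "(\<Sum>p | p permutes A. sign p * cf p (mset ks) A * cf p (mset js) A) = fact (card A) * int (card (margins ks js))"
proof -
  let ?P = "{p. p permutes A}"
  have "(\<Sum>p\<in>?P. sign p * cf p (mset ks) A * cf p (mset js) A)
      = (\<Sum>p\<in>?P. \<Sum>(f, g)\<in>colorings A ks \<times> colorings A js. if \<forall>x\<in>A. f (p x) = f x \<and> g (p x) = g x then sign p else 0)"
  proof (rule sum.cong[OF refl])
    fix p assume "p \<in> ?P"
    then have "p ` A = A" by (simp add: permutes_image)
    then have "sign p * cf p (mset ks) A * cf p (mset js) A = (\<Sum>z\<in>fixed_colorings p A ks \<times> fixed_colorings p A js. sign p)"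
      using A(1) by (simp add: cf_cols card_cartesian_product)
    also have "\<dots> = (\<Sum>z\<in>{z \<in> colorings A ks \<times> colorings A js. \<forall>x\<in>A. fst z (p x) = fst z x \<and> snd z (p x) = snd z x}. sign p)"
      by (rule sum.cong) (auto simp: fixed_colorings_def)
    also have "\<dots> = (\<Sum>z\<in>colorings A ks \<times> colorings A js. if \<forall>x\<in>A. fst z (p x) = fst z x \<and> snd z (p x) = snd z x then sign p else 0)"
      by (rule sum.inter_filter) (use A(1) in simp)
    finally show "sign p * cf p (mset ks) A * cf p (mset js) A =
        (\<Sum>(f, g)\<in>colorings A ks \<times> colorings A js. if \<forall>x\<in>A. f (p x) = f x \<and> g (p x) = g x then sign p else 0)"
      by (simp add: case_prod_beta)
  qed
  also have "\<dots> = (\<Sum>(f, g)\<in>colorings A ks \<times> colorings A js. \<Sum>p\<in>?P. if \<forall>x\<in>A. f (p x) = f x \<and> g (p x) = g x then sign p else 0)"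
    by (subst sum.swap) (simp add: case_prod_beta)
  also have "\<dots> = (\<Sum>(f, g)\<in>colorings A ks \<times> colorings A js. if inj_on (\<lambda>x. (f x, g x)) A then 1 else 0)"
  proof (intro sum.cong refl, clarify)
    fix f g
    have "(\<Sum>p\<in>?P. if \<forall>x\<in>A. f (p x) = f x \<and> g (p x) = g x then sign p else 0)
        = (\<Sum>p\<in>{p \<in> ?P. \<forall>x\<in>A. f (p x) = f x \<and> g (p x) = g x}. sign p)"
      using A(1) by (intro sum.inter_filter[symmetric] finite_permutations)
    also have "\<dots> = (if inj_on (\<lambda>x. (f x, g x)) A then 1 else 0)"
      using sum_sign_stabilizer[OF A(1), of "\<lambda>x. (f x, g x)"] by simp
    finally show "(\<Sum>p\<in>?P. if \<forall>x\<in>A. f (p x) = f x \<and> g (p x) = g x then sign p else 0)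
        = (if inj_on (\<lambda>x. (f x, g x)) A then 1 else (0 :: int))" .
  qed
  also have "\<dots> = (\<Sum>z\<in>colorings A ks \<times> colorings A js. if inj_on (\<lambda>x. (fst z x, snd z x)) A then 1 else 0)"
    by (simp add: case_prod_beta)
  also have "\<dots> = (\<Sum>z\<in>{z \<in> colorings A ks \<times> colorings A js. inj_on (\<lambda>x. (fst z x, snd z x)) A}. 1)"
    by (rule sum.inter_filter[symmetric]) (use A(1) in simp)
  also have "{z \<in> colorings A ks \<times> colorings A js. inj_on (\<lambda>x. (fst z x, snd z x)) A}
      = {(f, g). f \<in> colorings A ks \<and> g \<in> colorings A js \<and> inj_on (\<lambda>x. (f x, g x)) A}" by auto
  finally show ?thesis by (simp add: card_inj_pairs[OF A])
qed

section \<open>Conjugate partitions and unitriangularity\<close>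

definition n_above :: "nat list \<Rightarrow> nat \<Rightarrow> nat" where
  "n_above js i = card {j. j < length js \<and> i < js ! j}"

text \<open>The conjugate partition, with entries numbered from 0 and padded by zeros to length
  \<open>n\<close>.\<close>

definition conj_list :: "nat \<Rightarrow> nat list \<Rightarrow> nat list" where "conj_list n js = map (n_above js) [0..<n]"

text \<open>Takes the place of the dominance order as a numeric weight that drops strictly off the
  diagonal.\<close>

definition sqsum :: "nat list \<Rightarrow> nat" where "sqsum js = (\<Sum>j<length js. (js ! j)\<^sup>2)"

definition young :: "nat list \<Rightarrow> (nat \<times> nat) set" where
  "young js = {(i, j). j < length js \<and> i < js ! j}"

lemma sum_bool_card: "finite A \<Longrightarrow> (\<Sum>x\<in>A. if P x then 1 else (0 :: nat)) = card {x \<in> A. P x}"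
  by (simp add: sum.If_cases Int_def)

text \<open>Both sides count triples of a column and two of its cells. Two rows of a 0-1 matrix share at most
  as many columns as the shorter of them has cells, with equality throughout only for nested rows.\<close>

lemma W_conj:
  assumes B: "B \<in> margins (conj_list n js) js'" and n: "\<And>x. x \<in> set js \<Longrightarrow> x \<le> n"
  shows "sqsum js' \<le> sqsum js" and "sqsum js' = sqsum js \<Longrightarrow> B = young js' \<and> (\<forall>i<n. n_above js' i = n_above js i)"
proof -
  define S where "S i = {j. (i, j) \<in> B}" for i
  have sub: "B \<subseteq> {..<n} \<times> {..<length js'}" using B by (simp add: margins_def conj_list_def)
  have finS: "finite (S i)" for i
    by (rule finite_subset[of _ "{..<length js'}"]) (use sub in \<open>auto simp: S_def\<close>)
  have cS: "card (S i) = n_above js i" if "i < n" for i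
    using B that by (simp add: margins_def conj_list_def S_def)
  have cC: "card {i. (i, j) \<in> B} = js' ! j" if "j < length js'" for j
    using B that by (simp add: margins_def)
  have anti: "n_above js i' \<le> n_above js i" if "i \<le> i'" for i i'
    unfolding n_above_def using that by (intro card_mono) auto
  have sq: "(card {i. i < n \<and> P i})\<^sup>2 = (\<Sum>i<n. \<Sum>i'<n. if P i \<and> P i' then 1 else 0)" for P :: "nat \<Rightarrow> bool"
  proof -
    have "(card {i. i < n \<and> P i})\<^sup>2 = (\<Sum>i<n. if P i then 1 else 0) * (\<Sum>i<n. if P i then 1 else 0)"
      by (simp add: sum_bool_card power2_eq_square)
    then show ?thesis unfolding sum_product by (simp add: if_distrib cong: if_cong sum.cong) (intro sum.cong refl, auto)
  qed
  have dbl: "(\<Sum>j<m. (card {i. i < n \<and> P i j})\<^sup>2) = (\<Sum>i<n. \<Sum>i'<n. card {j. j < m \<and> P i j \<and> P i' j})"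
    for m and P :: "nat \<Rightarrow> nat \<Rightarrow> bool"
  proof -
    have "(\<Sum>j<m. (card {i. i < n \<and> P i j})\<^sup>2) = (\<Sum>j<m. \<Sum>i<n. \<Sum>i'<n. if P i j \<and> P i' j then 1 else 0)"
      by (simp add: sq)
    also have "\<dots> = (\<Sum>i<n. \<Sum>i'<n. \<Sum>j<m. if P i j \<and> P i' j then 1 else 0)"
      by (subst sum.swap) (intro sum.cong refl sum.swap)
    finally show ?thesis by (simp add: sum_bool_card)
  qed
  have "sqsum js' = (\<Sum>j<length js'. (card {i. i < n \<and> (i, j) \<in> B})\<^sup>2)"
  proof -
    have "{i. i < n \<and> (i, j) \<in> B} = {i. (i, j) \<in> B}" for j using sub by auto
    then show ?thesis by (simp add: sqsum_def cC)
  qed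
  also have "\<dots> = (\<Sum>i<n. \<Sum>i'<n. card (S i \<inter> S i'))"
  proof -
    have "{j. j < length js' \<and> (i, j) \<in> B \<and> (i', j) \<in> B} = S i \<inter> S i'" for i i' using sub by (auto simp: S_def)
    then show ?thesis by (simp add: dbl)
  qed
  finally have s': "sqsum js' = (\<Sum>i<n. \<Sum>i'<n. card (S i \<inter> S i'))" .
  have "sqsum js = (\<Sum>j<length js. (card {i. i < n \<and> i < js ! j})\<^sup>2)"
  proof -
    have "{i. i < n \<and> i < js ! j} = {..<js ! j}" if "j < length js" for j
      using n[OF nth_mem[OF that]] by auto
    then show ?thesis by (simp add: sqsum_def)
  qed
  also have "\<dots> = (\<Sum>i<n. \<Sum>i'<n. card {j. j < length js \<and> i < js ! j \<and> i' < js ! j})" by (rule dbl)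
  also have "\<dots> = (\<Sum>i<n. \<Sum>i'<n. n_above js (max i i'))"
    by (simp add: n_above_def)
  finally have s: "sqsum js = (\<Sum>i<n. \<Sum>i'<n. n_above js (max i i'))" .
  have le: "card (S i \<inter> S i') \<le> n_above js (max i i')" if "i < n" "i' < n" for i i'
  proof (cases "i \<le> i'")
    case True
    then show ?thesis using card_mono[OF finS[of i'], of "S i \<inter> S i'"] cS[OF that(2)] by (simp add: max_def)
  next
    case False
    then show ?thesis using card_mono[OF finS[of i], of "S i \<inter> S i'"] cS[OF that(1)] by (simp add: max_def)
  qed
  show "sqsum js' \<le> sqsum js" unfolding s s' using le by (intro sum_mono) auto
  assume eq: "sqsum js' = sqsum js"
  have row: "(\<Sum>i'<n. card (S i \<inter> S i')) = (\<Sum>i'<n. n_above js (max i i'))" if "i < n" for i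
  proof (rule antisym)
    show "(\<Sum>i'<n. card (S i \<inter> S i')) \<le> (\<Sum>i'<n. n_above js (max i i'))" using le that by (intro sum_mono) auto
    show "(\<Sum>i'<n. n_above js (max i i')) \<le> (\<Sum>i'<n. card (S i \<inter> S i'))"
    proof (rule ccontr)
      assume lt: "\<not> ?thesis"
      have "(\<Sum>i<n. \<Sum>i'<n. card (S i \<inter> S i')) < (\<Sum>i<n. \<Sum>i'<n. n_above js (max i i'))"
      proof (intro sum_strict_mono_ex1)
        show "\<forall>i\<in>{..<n}. (\<Sum>i'<n. card (S i \<inter> S i')) \<le> (\<Sum>i'<n. n_above js (max i i'))"
          using le by (auto intro!: sum_mono)
        show "\<exists>i\<in>{..<n}. (\<Sum>i'<n. card (S i \<inter> S i')) < (\<Sum>i'<n. n_above js (max i i'))"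
          using \<open>i < n\<close> lt by (intro bexI[of _ i]) auto
      qed simp
      then show False using eq s s' by simp
    qed
  qed
  have entry: "card (S i \<inter> S i') = n_above js (max i i')" if "i < n" "i' < n" for i i'
  proof (rule antisym[OF le[OF that]], rule ccontr)
    assume "\<not> n_above js (max i i') \<le> card (S i \<inter> S i')"
    then have "(\<Sum>i'<n. card (S i \<inter> S i')) < (\<Sum>i'<n. n_above js (max i i'))"
      using that le by (intro sum_strict_mono_ex1) (auto intro!: bexI[of _ i'])
    then show False using row[OF that(1)] by simp
  qed
  have nested: "S i' \<subseteq> S i" if "i \<le> i'" "i' < n" for i i'
  proof -
    have "card (S i \<inter> S i') = card (S i')" using entry[of i i'] cS[of i'] that by (simp add: max_def)
    then have "S i \<inter> S i' = S i'" by (intro card_subset_eq finS) auto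
    then show ?thesis by blast
  qed
  \<comment> \<open>Nested rows make each column an initial segment whose length is its column sum,
    and this determines \<open>B\<close>.\<close>
  have down: "(i, j) \<in> B \<longleftrightarrow> i < js' ! j" if j: "j < length js'" for i j
  proof -
    let ?C = "{i. (i, j) \<in> B}"
    have Cn: "?C \<subseteq> {..<n}" using sub by auto
    have dc: "i \<in> ?C" if "i \<le> i'" "i' \<in> ?C" for i i' using nested[of i i'] that Cn by (auto simp: S_def)
    have fin: "finite ?C" using Cn by (rule finite_subset) simp
    show ?thesis
    proof
      assume "(i, j) \<in> B"
      then have "{..i} \<subseteq> ?C" using dc by auto
      then show "i < js' ! j" using card_mono[OF fin, of "{..i}"] cC[OF j] by simp
    next
      assume i: "i < js' ! j"
      show "(i, j) \<in> B"
      proof (rule ccontr)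
        assume "(i, j) \<notin> B"
        then have "?C \<subseteq> {..<i}" using dc by (force simp: not_less[symmetric])
        then show False using card_mono[of "{..<i}" ?C] cC[OF j] i by simp
      qed
    qed
  qed
  have B': "B = young js'" using down sub by (auto simp: young_def)
  have "n_above js' i = n_above js i" if "i < n" for i
    using cS[OF that] by (simp add: S_def B' young_def n_above_def)
  then show "B = young js' \<and> (\<forall>i<n. n_above js' i = n_above js i)" using B' by blast
qed

lemma young_W:
  assumes "\<And>x. x \<in> set js \<Longrightarrow> x \<le> n"
  shows "young js \<in> margins (conj_list n js) js"
proof -
  have "young js \<subseteq> {..<n} \<times> {..<length js}" using assms nth_mem by (fastforce simp: young_def)
  then show ?thesis by (auto simp: margins_def conj_list_def young_def n_above_def)
qed

lemma mset_eq_above: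
  assumes "\<And>i. n_above js i = n_above js' i" "0 \<notin> set js" "0 \<notin> set js'"
  shows "mset js = mset js'"
proof (rule multiset_eqI)
  fix v
  have *: "count (mset xs) (Suc v) + n_above xs (Suc v) = n_above xs v" for xs v
  proof -
    have "count (mset xs) (Suc v) = card {j. j < length xs \<and> xs ! j = Suc v}"
      unfolding count_mset count_list_eq_length_filter length_filter_conv_card by (simp add: eq_commute)
    moreover have "n_above xs v = card ({j. j < length xs \<and> xs ! j = Suc v} \<union> {j. j < length xs \<and> Suc v < xs ! j})"
      unfolding n_above_def by (rule arg_cong[of _ _ card]) auto
    ultimately show ?thesis by (subst (asm) card_Un_disjoint) (auto simp: n_above_def)
  qed
  show "count (mset js) v = count (mset js') v"
  proof (cases v)
    case 0
    have "count (mset js) 0 = 0" "count (mset js') 0 = 0"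
      by (rule not_in_iff[THEN iffD1]; use assms in simp)+
    then show ?thesis unfolding 0 by (rule trans[OF _ sym])
  next
    case (Suc u)
    then show ?thesis using *[of js u] *[of js' u] assms(1)[of u] assms(1)[of "Suc u"] by simp
  qed
qed

definition pl :: "nat multiset \<Rightarrow> nat list" where "pl \<mu> = sorted_list_of_multiset \<mu>"

lemma mset_pl [simp]: "mset (pl \<mu>) = \<mu>"
  by (simp add: pl_def)

lemma part_le: "\<mu> \<in> part n \<Longrightarrow> x \<in># \<mu> \<Longrightarrow> x \<le> n"
  using part_remove by blast

text \<open>Up to the factor n!, the pairing of the sign-twisted permutation character of the shape
  conjugate to \<mu> with the permutation character of shape \<nu>.\<close>

definition dual_entry :: "nat \<Rightarrow> nat multiset \<Rightarrow> nat multiset \<Rightarrow> int" where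
  "dual_entry n \<mu> \<nu> = int (card (margins (conj_list n (pl \<mu>)) (pl \<nu>)))"

lemma set_pl [simp]: "set (pl \<mu>) = set_mset \<mu>"
  by (metis mset_pl set_mset_mset)

lemma dual_entry_diag: "\<mu> \<in> part n \<Longrightarrow> dual_entry n \<mu> \<mu> = 1"
proof -
  assume \<mu>: "\<mu> \<in> part n"
  have n: "x \<le> n" if "x \<in> set (pl \<mu>)" for x using that part_le[OF \<mu>] by simp
  have "margins (conj_list n (pl \<mu>)) (pl \<mu>) = {young (pl \<mu>)}" using young_W[of "pl \<mu>" n] W_conj(2)[of _ n "pl \<mu>" "pl \<mu>"] n by blast
  then show ?thesis by (simp add: dual_entry_def)
qed

lemma dual_entry_offdiag:
  assumes "\<mu> \<in> part n" "\<nu> \<in> part n" "\<mu> \<noteq> \<nu>" "dual_entry n \<mu> \<nu> \<noteq> 0"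
  shows "int (sqsum (pl \<nu>)) < int (sqsum (pl \<mu>))"
proof (rule ccontr)
  assume *: "\<not> ?thesis"
  obtain B where B: "B \<in> margins (conj_list n (pl \<mu>)) (pl \<nu>)" using assms(4) by (fastforce simp: dual_entry_def)
  have n: "x \<le> n" if "x \<in> set (pl \<mu>)" for x using that part_le[OF assms(1)] by simp
  have n': "x \<le> n" if "x \<in> set (pl \<nu>)" for x using that part_le[OF assms(2)] by simp
  have eq: "\<forall>i<n. n_above (pl \<nu>) i = n_above (pl \<mu>) i" using W_conj[OF B n] * by force
  have "n_above (pl \<nu>) i = n_above (pl \<mu>) i" for i
  proof (cases "i < n")
    case False
    have "n_above (pl \<kappa>) i = 0" if "\<And>x. x \<in> set (pl \<kappa>) \<Longrightarrow> x \<le> n" for \<kappa>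
      using that nth_mem[of _ "pl \<kappa>"] False by (fastforce simp: n_above_def)
    then show ?thesis using n n' by simp
  qed (use eq in simp)
  then have "mset (pl \<nu>) = mset (pl \<mu>)"
    using assms(1,2) by (intro mset_eq_above) (auto simp: part_def)
  then show False using assms(3) by simp
qed

lemma sum_list_conj:
  assumes "\<mu> \<in> part n" shows "sum_list (conj_list n (pl \<mu>)) = n"
proof -
  have n: "x \<le> n" if "x \<in> set (pl \<mu>)" for x using that part_le[OF assms] by simp
  have "(\<lambda>(x, y). (y, x)) ` young (pl \<mu>) = (SIGMA j:{..<length (pl \<mu>)}. {..<pl \<mu> ! j})" by (auto simp: young_def)
  then have "card (young (pl \<mu>)) = card (SIGMA j:{..<length (pl \<mu>)}. {..<pl \<mu> ! j})"
    by (metis (no_types, lifting) card_image inj_onI prod.collapse case_prod_beta prod.inject)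
  also have "\<dots> = sum_list (pl \<mu>)" by (simp add: sum_list_sum_nth atLeast0LessThan)
  also have "\<dots> = n" using assms by (simp add: part_def flip: sum_mset_sum_list)
  finally show ?thesis using card_W_elem[OF young_W, of "pl \<mu>" n] n by simp
qed

subsection \<open>Characters of the symmetric group\<close>

lemma stab_inv: "p permutes A \<Longrightarrow> stab (inv' p) k B = stab p k B"
proof -
  assume p: "p permutes A"
  have "inv' p ` C = C \<longleftrightarrow> p ` C = C" for C
  proof
    assume "inv' p ` C = C"
    then have "p ` C = p ` (inv' p ` C)" by simp
    then show "p ` C = C" using permutes_inverses(1)[OF p] by (simp add: image_image)
  next
    assume "p ` C = C"
    then have "inv' p ` C = inv' p ` (p ` C)" by simp
    then show "inv' p ` C = C" using permutes_inverses(2)[OF p] by (simp add: image_image)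
  qed
  then show ?thesis by (auto simp: stab_def)
qed

text \<open>The orthogonality relations evaluate one factor at the inverse; a permutation and its
  inverse have the same stable sets.\<close>

lemma cf_inv: "p permutes A \<Longrightarrow> cf (inv' p) \<mu> B = cf p \<mu> B"
proof -
  assume "p permutes A"
  then have "Hop (inv' p) = Hop p" by (intro ext) (simp add: Hop_def stab_inv)
  then show ?thesis by (simp add: cf_def)
qed

text \<open>The shape with all parts 1 gives the regular character, which later detects degrees and
  provides the kernel of \<open>lap\<close>.\<close>

lemma cf_ones:
  assumes "finite A"
  shows "cf p (replicate_mset (card A) 1) A = (if \<forall>x\<in>A. p x = x then fact (card A) else 0)"
  using assms
proof (induction "card A" arbitrary: A)
  case 0
  then show ?case by (simp add: cf_empty)
next
  case (Suc k)
  have s1: "stab p 1 A = (\<lambda>x. {x}) ` {x \<in> A. p x = x}"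
    by (auto simp: stab_def card_1_singleton_iff)
  have IH: "cf p (replicate_mset k 1) (A - {x}) = (if \<forall>y\<in>A - {x}. p y = y then fact k else 0)" if "x \<in> A" for x
  proof -
    have "card (A - {x}) = k" using Suc.hyps(2) that by simp
    then show ?thesis using Suc.hyps(1)[of "A - {x}"] Suc.prems by simp
  qed
  have "cf p (replicate_mset (card A) 1) A = Hop p 1 (cf p (replicate_mset k 1)) A"
    unfolding Suc.hyps(2)[symmetric] by (simp add: cf_add_mset)
  also have "\<dots> = (\<Sum>x\<in>{x \<in> A. p x = x}. cf p (replicate_mset k 1) (A - {x}))"
    using Suc.prems unfolding Hop_def s1 by (simp add: sum.reindex)
  also have "\<dots> = (\<Sum>x\<in>{x \<in> A. p x = x}. if \<forall>y\<in>A. p y = y then fact k else 0)"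
    by (intro sum.cong refl) (use IH in auto)
  also have "\<dots> = (if \<forall>x\<in>A. p x = x then fact (card A) else 0)"
  proof (cases "\<forall>x\<in>A. p x = x")
    case True
    then have "{x \<in> A. p x = x} = A" by auto
    then show ?thesis using True by (simp add: Suc.hyps(2)[symmetric])
  qed auto
  finally show ?case .
qed

lemma colorings_permute:
  assumes "p permutes A" "finite A" "f \<in> colorings A ks"
  shows "(\<lambda>x\<in>A. f (inv' p x)) \<in> colorings A ks"
proof -
  have ip: "inv' p x \<in> A" if "x \<in> A" for x using that permutes_in_image[OF permutes_inv[OF assms(1)]] by simp
  have "card {x \<in> A. f (inv' p x) = i} = card {x \<in> A. f x = i}" for i
  proof -
    have "{x \<in> A. f (inv' p x) = i} = p ` {x \<in> A. f x = i}"
    proof (intro equalityI subsetI)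
      fix x assume "x \<in> {x \<in> A. f (inv' p x) = i}"
      then show "x \<in> p ` {x \<in> A. f x = i}"
        using ip permutes_inverses(1)[OF assms(1), of x] by (intro image_eqI[of _ _ "inv' p x"]) auto
    next
      fix x assume "x \<in> p ` {x \<in> A. f x = i}"
      then show "x \<in> {x \<in> A. f (inv' p x) = i}"
        using permutes_inverses(2)[OF assms(1)] permutes_in_image[OF assms(1)] by auto
    qed
    then show ?thesis using permutes_inj_on[OF assms(1)] by (simp add: card_image)
  qed
  moreover have "{x \<in> A. (\<lambda>x\<in>A. f (inv' p x)) x = i} = {x \<in> A. f (inv' p x) = i}" for i by auto
  ultimately show ?thesis using assms(3) ip by (auto simp: colorings_def PiE_iff)
qed

text \<open>Permutations act on colorings by composition with the inverse, and the colorings fixed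
  by \<open>p\<close> are those constant on its cycles.\<close>

lemma cf_rep:
  "\<exists>d \<rho>. is_rep (sym_group n) d \<rho> \<and>
    (\<forall>p\<in>carrier (sym_group n). mat_trace (\<rho> p) = of_int (cf p \<mu> {1..n}))"
proof -
  let ?A = "{1..n}"
  obtain ks where ks: "\<mu> = mset ks" using ex_mset by metis
  let ?a = "\<lambda>p f. \<lambda>x\<in>?A. f (inv' p x)"
  have ip: "inv' p x \<in> ?A" if "p permutes ?A" "x \<in> ?A" for p x
    using that permutes_in_image[OF permutes_inv[OF that(1)]] by simp
  have "\<exists>d \<rho>. is_rep (sym_group n) d \<rho> \<and> (\<forall>p\<in>carrier (sym_group n). mat_trace (\<rho> p)
      = of_nat (card {f \<in> colorings ?A ks. ?a p f = f}))"
  proof (rule permutation_rep[OF sym_group_is_group])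
    show "?a p f \<in> colorings ?A ks" if "p \<in> carrier (sym_group n)" "f \<in> colorings ?A ks" for p f
      using that by (intro colorings_permute) (auto simp: sym_group_carrier)
    show "?a (p \<otimes>\<^bsub>sym_group n\<^esub> q) f = ?a p (?a q f)"
      if "p \<in> carrier (sym_group n)" "q \<in> carrier (sym_group n)" for p q f
    proof -
      have pq: "p permutes ?A" "q permutes ?A" using that by (auto simp: sym_group_carrier)
      have "inv' (p \<circ> q) = inv' q \<circ> inv' p" using pq by (simp add: o_inv_distrib permutes_bij)
      then show ?thesis using ip[OF pq(1)] by (auto simp: sym_group_mult)
    qed
    show "?a \<one>\<^bsub>sym_group n\<^esub> f = f" if "f \<in> colorings ?A ks" for f
      using that by (auto simp: sym_group_one colorings_def PiE_def extensional_def fun_eq_iff)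
  qed simp
  moreover have "of_nat (card {f \<in> colorings ?A ks. ?a p f = f}) = complex_of_int (cf p \<mu> ?A)"
    if "p \<in> carrier (sym_group n)" for p
  proof -
    have p: "p permutes ?A" using that by (simp add: sym_group_carrier)
    have "?a p f = f \<longleftrightarrow> (\<forall>x\<in>?A. f (p x) = f x)" if f: "f \<in> colorings ?A ks" for f
    proof -
      have "?a p f = f \<longleftrightarrow> (\<forall>x\<in>?A. f (inv' p x) = f x)"
        using f by (auto simp: fun_eq_iff colorings_def PiE_def extensional_def restrict_def)
      also have "\<dots> \<longleftrightarrow> (\<forall>x\<in>?A. f (p x) = f x)"
        using ip[OF p] permutes_in_image[OF p] permutes_inverses[OF p] by metis
      finally show ?thesis .
    qed
    then have "{f \<in> colorings ?A ks. ?a p f = f} = fixed_colorings p ?A ks" by (auto simp: fixed_colorings_def)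
    then show ?thesis using cf_cols[of ?A p ks] permutes_image[OF p] by (simp add: ks)
  qed
  ultimately show ?thesis by auto
qed

lemma mat_trace_perm_mat: "mat_trace (perm_mat n p) = of_int (nfix p {1..n})"
proof -
  have "mat_trace (perm_mat n p) = (\<Sum>i<n. if p (i + 1) = i + 1 then 1 else 0)"
    by (simp add: mat_trace_def perm_mat_def)
  also have "\<dots> = (\<Sum>i\<in>{1..n}. if p i = i then 1 else 0)"
    by (rule sum.reindex_bij_witness[of _ "\<lambda>i. i - 1" "\<lambda>i. i + 1"]) auto
  finally show ?thesis by (simp add: nfix_def sum.If_cases Int_def)
qed

lemma ch_T:
  "f \<in> Lam n \<Longrightarrow> p permutes {1..n} \<Longrightarrow> ch p (lap n f) {1..n} = (int n - nfix p {1..n}) * ch p f {1..n}"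
proof -
  assume f: "f \<in> Lam n" and p: "p permutes {1..n}"
  have "ch p (of_int (int n) * f) {1..n} = int n * ch p f {1..n}" by (rule ch_linear(5))
  then show ?thesis using ch_h1_D[OF permutes_inj[OF p] _ f, of "{1..n}"]
    by (simp add: lap_def left_diff_distrib del: One_nat_def)
qed

lemma ch_h_n: "p permutes {1..n} \<Longrightarrow> ch p (hs n) {1..n} = 1"
proof -
  assume p: "p permutes {1..n}"
  have "ch p (hs n * hm {#}) {1..n} = (\<Sum>B\<in>stab p n {1..n}. if {1..n} - B = {} then 1 else 0)"
    unfolding ch_h[OF finite_atLeastAtMost] by (simp add: Hop_def cf_empty del: hm_empty)
  also have "stab p n {1..n} = {{1..n}}"
    using card_subset_eq[of "{1..n}"] permutes_image[OF p] by (auto simp: stab_def)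
  finally show ?thesis by simp
qed

lemma ch_part: "f \<in> Lam n \<Longrightarrow> ch p f A = (\<Sum>\<mu>\<in>part n. mcoeff f \<mu> * cf p \<mu> A)"
  unfolding ch_def by (subst lin_superset[of "part n"]) (auto simp: Sp_def)

lemma sign_dual_pairing:
  "(\<Sum>p | p permutes {1..n}. sign p * cf p (mset (conj_list n (pl \<mu>))) {1..n} * cf p \<nu> {1..n})
    = fact n * dual_entry n \<mu> \<nu>" if "\<mu> \<in> part n"
  using sign_pairing[of "{1..n}" "conj_list n (pl \<mu>)" "pl \<nu>"] sum_list_conj[OF that] by (simp add: dual_entry_def)

text \<open>Pairing with the sign-twisted characters turns vanishing on all permutations into a
  unitriangular system for the coefficients of \<open>f\<close>.\<close>

lemma ch_injective:
  assumes f: "f \<in> Lam n" and 0: "\<And>p. p permutes {1..n} \<Longrightarrow> ch p f {1..n} = 0"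
  shows "f = 0"
proof -
  have "(\<Sum>\<nu>\<in>part n. dual_entry n \<mu> \<nu> * mcoeff f \<nu>) = 0" if \<mu>: "\<mu> \<in> part n" for \<mu>
  proof -
    let ?s = "\<lambda>p. sign p * cf p (mset (conj_list n (pl \<mu>))) {1..n}"
    have "fact n * (\<Sum>\<nu>\<in>part n. dual_entry n \<mu> \<nu> * mcoeff f \<nu>)
        = (\<Sum>\<nu>\<in>part n. (\<Sum>p | p permutes {1..n}. ?s p * cf p \<nu> {1..n}) * mcoeff f \<nu>)"
      unfolding sign_dual_pairing[OF \<mu>] by (simp add: sum_distrib_left mult.assoc)
    also have "\<dots> = (\<Sum>p | p permutes {1..n}. \<Sum>\<nu>\<in>part n. ?s p * cf p \<nu> {1..n} * mcoeff f \<nu>)"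
      unfolding sum_distrib_right by (rule sum.swap)
    also have "\<dots> = (\<Sum>p | p permutes {1..n}. ?s p * ch p f {1..n})"
      unfolding ch_part[OF f] sum_distrib_left by (intro sum.cong refl) (simp add: mult_ac)
    also have "\<dots> = 0" using 0 by simp
    finally show ?thesis by simp
  qed
  then have "mcoeff f \<mu> = 0" if "\<mu> \<in> part n" for \<mu>
    by (intro unitriangular_ker[of "part n" "dual_entry n" "\<lambda>\<mu>. int (sqsum (pl \<mu>))" "mcoeff f"])
      (use that dual_entry_diag dual_entry_offdiag in auto)
  then show ?thesis using f by (intro poly_mapping_eqI) (auto simp: Sp_def in_keys_iff)
qed

section \<open>Integer coordinates with respect to the irreducible characters\<close>

abbreviation chi_comb :: "nat \<Rightarrow> (nat \<Rightarrow> 'a \<Rightarrow> complex) \<Rightarrow> (nat \<Rightarrow> int) \<Rightarrow> 'a \<Rightarrow> complex" where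
  "chi_comb l \<chi> z p \<equiv> \<Sum>i\<le>l. of_int (z i) * \<chi> i p"

context
  fixes n l :: nat and \<chi> :: "nat \<Rightarrow> (nat \<Rightarrow> nat) \<Rightarrow> complex"
  assumes bij: "bij_betw \<chi> {0..l} (irr_chars (sym_group n))"
begin

abbreviation (input) "perms \<equiv> {p. p permutes {1..n}}"

lemma finite_P: "finite perms"
  by (simp add: finite_permutations)

lemma chi_irr: "i \<le> l \<Longrightarrow> \<chi> i \<in> irr_chars (sym_group n)"
  using bij by (auto simp: bij_betw_def)

lemma chi_orthonormal:
  assumes "i \<le> l" "j \<le> l"
  shows "(\<Sum>p\<in>perms. \<chi> i p * \<chi> j (inv' p)) = (if i = j then fact n else 0)"
proof -
  have car: "carrier (sym_group n) = perms" by (auto simp: sym_group_def)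
  have "(\<Sum>p\<in>carrier (sym_group n). \<chi> i p * \<chi> j (inv\<^bsub>sym_group n\<^esub> p)) =
      (if \<chi> i = \<chi> j then of_nat (card (carrier (sym_group n))) else 0)"
    using finite_P by (intro irr_chars_orthonormal[OF sym_group_is_group] chi_irr assms) (simp add: car)
  moreover have "\<chi> i = \<chi> j \<longleftrightarrow> i = j" using bij assms by (auto simp: bij_betw_def dest: inj_onD)
  moreover have "(\<Sum>p\<in>carrier (sym_group n). \<chi> i p * \<chi> j (inv\<^bsub>sym_group n\<^esub> p)) = (\<Sum>p\<in>perms. \<chi> i p * \<chi> j (inv' p))"
    by (rule sum.cong) (simp_all add: car)
  moreover have "card perms = fact n" by (rule card_permutations) auto
  ultimately show ?thesis by (simp add: car)
qed

lemma pairing_coords: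
  fixes a b :: "nat \<Rightarrow> complex"
  shows "(\<Sum>p\<in>perms. (\<Sum>i\<le>l. a i * \<chi> i p) * (\<Sum>j\<le>l. b j * \<chi> j (inv' p))) = fact n * (\<Sum>i\<le>l. a i * b i)"
proof -
  have "(\<Sum>p\<in>perms. (\<Sum>i\<le>l. a i * \<chi> i p) * (\<Sum>j\<le>l. b j * \<chi> j (inv' p)))
      = (\<Sum>p\<in>perms. \<Sum>i\<le>l. \<Sum>j\<le>l. a i * b j * (\<chi> i p * \<chi> j (inv' p)))"
    by (simp add: sum_product mult_ac)
  also have "\<dots> = (\<Sum>i\<le>l. \<Sum>j\<le>l. \<Sum>p\<in>perms. a i * b j * (\<chi> i p * \<chi> j (inv' p)))"
    by (subst sum.swap) (intro sum.cong refl sum.swap)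
  also have "\<dots> = (\<Sum>i\<le>l. \<Sum>j\<le>l. if j = i then a i * b i * fact n else 0)"
    by (intro sum.cong refl) (auto simp: sum_distrib_left[symmetric] chi_orthonormal simp del: One_nat_def)
  also have "\<dots> = fact n * (\<Sum>i\<le>l. a i * b i)"
    by (simp add: sum_distrib_left mult_ac)
  finally show ?thesis .
qed

lemma inv_P: "p \<in> perms \<Longrightarrow> inv' p \<in> perms"
  by (simp add: permutes_inv)

lemma chi_independent:
  fixes a :: "nat \<Rightarrow> complex"
  assumes "\<And>p. p \<in> perms \<Longrightarrow> (\<Sum>i\<le>l. a i * \<chi> i p) = 0" "k \<le> l"
  shows "a k = 0"
proof -
  have "fact n * (\<Sum>i\<le>l. a i * (if i = k then 1 else 0)) = (0 :: complex)"
    unfolding pairing_coords[symmetric] using assms(1) by simp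
  then show ?thesis using assms(2) by (simp add: if_distrib cong: if_cong)
qed

lemma chi_independent_int:
  fixes a b :: "nat \<Rightarrow> int"
  assumes "\<And>p. p \<in> perms \<Longrightarrow> (chi_comb l \<chi> a p) = (chi_comb l \<chi> b p)" "k \<le> l"
  shows "a k = b k"
proof -
  have "complex_of_int (a k - b k) = 0"
    by (rule chi_independent[OF _ assms(2)]) (use assms(1) in \<open>simp add: left_diff_distrib sum_subtractf\<close>)
  then show ?thesis by simp
qed

lemma cf_coords: "\<exists>z :: nat \<Rightarrow> int. \<forall>p\<in>perms. of_int (cf p \<mu> {1..n}) = (chi_comb l \<chi> z p)"
proof -
  have car: "carrier (sym_group n) = perms" by (auto simp: sym_group_def)
  obtain d \<rho> where \<rho>: "is_rep (sym_group n) d \<rho>" "\<And>p. p \<in> perms \<Longrightarrow> mat_trace (\<rho> p) = of_int (cf p \<mu> {1..n})"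
    using cf_rep[of n \<mu>] unfolding car by blast
  obtain cs where cs: "set cs \<subseteq> irr_chars (sym_group n)" "\<And>p. p \<in> perms \<Longrightarrow> mat_trace (\<rho> p) = (\<Sum>\<psi>\<leftarrow>cs. \<psi> p)"
    using rep_decomposition[OF sym_group_is_group \<rho>(1)] unfolding car by blast
  have "\<exists>z :: nat \<Rightarrow> int. \<forall>p. (\<Sum>\<psi>\<leftarrow>cs. \<psi> p) = (chi_comb l \<chi> z p)"
    using cs(1)
  proof (induction cs)
    case Nil
    then show ?case by (intro exI[of _ "\<lambda>_. 0"]) simp
  next
    case (Cons \<psi> cs)
    then obtain z :: "nat \<Rightarrow> int" where z: "\<And>p. (\<Sum>\<psi>\<leftarrow>cs. \<psi> p) = (chi_comb l \<chi> z p)" by auto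
    have "\<psi> \<in> \<chi> ` {0..l}" using Cons.prems bij by (auto simp: bij_betw_def)
    then obtain k where k: "k \<le> l" "\<psi> = \<chi> k" by auto
    have "(\<Sum>i\<le>l. of_int (z i + (if i = k then 1 else 0)) * \<chi> i p) = \<chi> k p + (chi_comb l \<chi> z p)" for p
    proof -
      have "(\<Sum>i\<le>l. of_int (z i + (if i = k then 1 else 0)) * \<chi> i p)
          = (\<Sum>i\<le>l. of_int (z i) * \<chi> i p + (if i = k then \<chi> k p else 0))"
        by (intro sum.cong) (auto simp: distrib_right)
      then show ?thesis using k(1) by (simp add: sum.distrib)
    qed
    then show ?case using z k(2) by (intro exI[of _ "\<lambda>i. z i + (if i = k then 1 else 0)"]) simp
  qed
  then show ?thesis using \<rho>(2) cs(2) by metis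
qed

lemma ch_coords:
  assumes "f \<in> Lam n"
  shows "\<exists>z :: nat \<Rightarrow> int. \<forall>p\<in>perms. of_int (ch p f {1..n}) = (chi_comb l \<chi> z p)"
  using assms
proof (induction rule: Sp_induct)
  case zero
  show ?case by (intro exI[of _ "\<lambda>_. 0"]) simp
next
  case (add f g)
  then obtain z w :: "nat \<Rightarrow> int" where "\<And>p. p \<in> perms \<Longrightarrow> of_int (ch p f {1..n}) = (chi_comb l \<chi> z p)"
    "\<And>p. p \<in> perms \<Longrightarrow> of_int (ch p g {1..n}) = (chi_comb l \<chi> w p)" by blast
  then show ?case by (intro exI[of _ "\<lambda>i. z i + w i"]) (simp add: distrib_right sum.distrib)
next
  case (uminus f)
  then obtain z :: "nat \<Rightarrow> int" where "\<And>p. p \<in> perms \<Longrightarrow> of_int (ch p f {1..n}) = (chi_comb l \<chi> z p)" by blast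
  then show ?case by (intro exI[of _ "\<lambda>i. - z i"]) (simp add: sum_negf)
next
  case (hm \<mu>)
  then show ?case using cf_coords[of \<mu>] by simp
qed

text \<open>The class functions with integral pairings against all permutation characters are the integral combinations
  of their sign twists, by unitriangularity. So an irreducible character splits into orthogonal parts
  in and orthogonal to the lattice of permutation characters; having norm 1 it equals one
  of the two, and it is not orthogonal to the regular character.\<close>

lemma irr_char_in_lattice:
  assumes k: "k \<le> l"
  shows "\<exists>f\<in>Lam n. \<forall>p\<in>perms. \<chi> k p = of_int (ch p f {1..n})"
proof -
  obtain z :: "nat multiset \<Rightarrow> nat \<Rightarrow> int"
    where z: "\<And>\<mu> p. p \<in> perms \<Longrightarrow> of_int (cf p \<mu> {1..n}) = (chi_comb l \<chi> (z \<mu>) p)"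
    using cf_coords by metis
  have zinv: "of_int (cf p \<mu> {1..n}) = (chi_comb l \<chi> (z \<mu>) (inv' p))" if "p \<in> perms" for p \<mu>
    using z[OF inv_P[OF that]] cf_inv[of p "{1..n}"] that by simp
  \<comment> \<open>These coefficients make the combination of sign twists pair with every
    permutation character exactly as \<chi> k does.\<close>
  obtain x where x: "\<And>\<nu>. \<nu> \<in> part n \<Longrightarrow> (\<Sum>\<mu>\<in>part n. x \<mu> * dual_entry n \<mu> \<nu>) = z \<nu> k"
  proof -
    have "\<exists>x. \<forall>\<nu>\<in>part n. (\<Sum>\<mu>\<in>part n. x \<mu> * dual_entry n \<mu> \<nu>) = z \<nu> k"
      by (rule unitriangular_solve[where w = "\<lambda>\<mu>. int (sqsum (pl \<mu>))"])
        (use dual_entry_diag dual_entry_offdiag in auto)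
    then show ?thesis using that by blast
  qed
  let ?c = "\<lambda>\<mu>. mset (conj_list n (pl \<mu>))"
  \<comment> \<open>The twists are again in the lattice of permutation characters, so the
    combination \<open>f\<close> built from them is too.\<close>
  have "\<exists>g\<in>Lam n. \<forall>p\<in>perms. sign p * cf p (?c \<mu>) {1..n} = ch p g {1..n}" if \<mu>: "\<mu> \<in> part n" for \<mu>
  proof -
    obtain g where g1: "g \<in> Lam (sum_mset (?c \<mu>))"
      and all: "\<forall>p. \<forall>A :: nat set. finite A \<longrightarrow> p ` A = A \<longrightarrow> sg p A * cf p (?c \<mu>) A = ch p g A"
      using sg_cf[of "?c \<mu>"] by (rule bexE)
    have g2: "sg p {1..n} * cf p (?c \<mu>) {1..n} = ch p g {1..n}" if "p ` {1..n} = {1..n}" for p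
      using all that by (simp del: One_nat_def)
    note g = g1 g2
    have "sg p {1..n} = sign p" if "p \<in> perms" for p
    proof -
      have "restr p {1..n} = p" using that by (auto simp: restr_def fun_eq_iff permutes_not_in)
      then show ?thesis by (simp add: sg_def)
    qed
    moreover have "sum_mset (?c \<mu>) = n" using sum_list_conj[OF \<mu>] by (simp add: sum_mset_sum_list)
    moreover have "p ` {1..n} = {1..n}" if "p \<in> perms" for p using that by (simp add: permutes_image)
    ultimately show ?thesis using g by (intro bexI[of _ g] ballI) (metis, simp)
  qed
  then obtain g where g: "\<And>\<mu>. \<mu> \<in> part n \<Longrightarrow> g \<mu> \<in> Lam n"
    "\<And>\<mu> p. \<mu> \<in> part n \<Longrightarrow> p \<in> perms \<Longrightarrow> sign p * cf p (?c \<mu>) {1..n} = ch p (g \<mu>) {1..n}"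
    by metis
  define f where "f = (\<Sum>\<mu>\<in>part n. of_int (x \<mu>) * g \<mu>)"
  have fL: "f \<in> Lam n" unfolding f_def using g(1) by (intro Sp_sum Sp_of_int) auto
  have chf: "ch p f {1..n} = (\<Sum>\<mu>\<in>part n. x \<mu> * (sign p * cf p (?c \<mu>) {1..n}))" if "p \<in> perms" for p
    using g(2) that by (simp add: f_def)
  obtain y :: "nat \<Rightarrow> int" where y: "\<And>p. p \<in> perms \<Longrightarrow> of_int (ch p f {1..n}) = (chi_comb l \<chi> y p)"
    using ch_coords[OF fL] by blast
  have yz: "(\<Sum>i\<le>l. y i * z \<nu> i) = z \<nu> k" if \<nu>: "\<nu> \<in> part n" for \<nu>
  proof -
    have "complex_of_int (\<Sum>p\<in>perms. ch p f {1..n} * cf p \<nu> {1..n})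
        = (\<Sum>p\<in>perms. (chi_comb l \<chi> y p) * (chi_comb l \<chi> (z \<nu>) (inv' p)))"
      unfolding of_int_sum of_int_mult using y zinv[of _ \<nu>] by (intro sum.cong refl) simp
    also have "\<dots> = of_int (fact n * (\<Sum>i\<le>l. y i * z \<nu> i))" unfolding pairing_coords by simp
    finally have 1: "(\<Sum>p\<in>perms. ch p f {1..n} * cf p \<nu> {1..n}) = fact n * (\<Sum>i\<le>l. y i * z \<nu> i)"
      by (simp only: of_int_eq_iff)
    have "(\<Sum>p\<in>perms. ch p f {1..n} * cf p \<nu> {1..n})
        = (\<Sum>p\<in>perms. \<Sum>\<mu>\<in>part n. x \<mu> * (sign p * cf p (?c \<mu>) {1..n} * cf p \<nu> {1..n}))"
      by (intro sum.cong refl) (simp add: chf sum_distrib_right mult.assoc del: One_nat_def mem_Collect_eq)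
    also have "\<dots> = (\<Sum>\<mu>\<in>part n. x \<mu> * (\<Sum>p\<in>perms. sign p * cf p (?c \<mu>) {1..n} * cf p \<nu> {1..n}))"
      unfolding sum_distrib_left by (rule sum.swap)
    also have "\<dots> = (\<Sum>\<mu>\<in>part n. x \<mu> * (fact n * dual_entry n \<mu> \<nu>))"
      by (intro sum.cong refl) (simp only: sign_dual_pairing)
    also have "\<dots> = fact n * z \<nu> k" unfolding x[OF \<nu>, symmetric] sum_distrib_left by (simp add: mult_ac)
    finally show ?thesis using 1 by simp
  qed
  have y_lin: "y i = (\<Sum>\<nu>\<in>part n. mcoeff f \<nu> * z \<nu> i)" if "i \<le> l" for i
  proof (rule chi_independent_int[OF _ that])
    fix p assume p: "p \<in> perms"
    have "(\<Sum>i\<le>l. of_int (\<Sum>\<nu>\<in>part n. mcoeff f \<nu> * z \<nu> i) * \<chi> i p)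
        = (\<Sum>\<nu>\<in>part n. of_int (mcoeff f \<nu>) * (chi_comb l \<chi> (z \<nu>) p))"
      unfolding of_int_sum of_int_mult sum_distrib_right sum_distrib_left by (subst sum.swap) (simp add: mult.assoc)
    also have "\<dots> = of_int (ch p f {1..n})" using p by (simp add: z[symmetric] ch_part[OF fL])
    finally show "(chi_comb l \<chi> y p)
        = (\<Sum>i\<le>l. of_int (\<Sum>\<nu>\<in>part n. mcoeff f \<nu> * z \<nu> i) * \<chi> i p)"
      using y[OF p] by simp
  qed
  \<comment> \<open>Since \<open>f\<close> lies in the lattice and pairs with it as \<chi> k does,
    its norm equals its pairing with \<chi> k. An integer vector with this property is 0 or the unit
    vector at \<open>k\<close>.\<close>
  have "(\<Sum>i\<le>l. y i * y i) = (\<Sum>i\<le>l. \<Sum>\<nu>\<in>part n. mcoeff f \<nu> * (y i * z \<nu> i))"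
  proof (rule sum.cong[OF refl])
    fix i assume "i \<in> {..l}"
    then have "y i * y i = y i * (\<Sum>\<nu>\<in>part n. mcoeff f \<nu> * z \<nu> i)" using y_lin[of i] by simp
    then show "y i * y i = (\<Sum>\<nu>\<in>part n. mcoeff f \<nu> * (y i * z \<nu> i))"
      by (simp add: sum_distrib_left mult.left_commute)
  qed
  also have "\<dots> = (\<Sum>\<nu>\<in>part n. mcoeff f \<nu> * (\<Sum>i\<le>l. y i * z \<nu> i))"
    by (subst sum.swap) (simp add: sum_distrib_left)
  also have "\<dots> = y k" using yz y_lin[OF k] by simp
  finally have norm: "(\<Sum>i\<le>l. y i * y i) = y k" .
  have split: "(\<Sum>i\<le>l. y i * y i) = y k * y k + (\<Sum>i\<in>{..l} - {k}. y i * y i)"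
    using k by (subst sum.remove[of _ k]) auto
  have nn: "0 \<le> (\<Sum>i\<in>{..l} - {k}. y i * y i)" by (intro sum_nonneg) simp
  have "y k * y k \<le> y k" using norm split nn by simp
  then have yk: "y k = 0 \<or> y k = 1"
  proof -
    have "0 \<le> y k" using \<open>y k * y k \<le> y k\<close> by (metis order_trans zero_le_square)
    moreover have "\<not> 2 \<le> y k"
    proof
      assume "2 \<le> y k"
      then have "2 * y k \<le> y k * y k" by (intro mult_right_mono) auto
      then show False using \<open>y k * y k \<le> y k\<close> \<open>2 \<le> y k\<close> by linarith
    qed
    ultimately show ?thesis by linarith
  qed
  then have "(\<Sum>i\<in>{..l} - {k}. y i * y i) = 0" using norm split by auto
  then have others: "y i = 0" if "i \<le> l" "i \<noteq> k" for i
    using that sum_nonneg_eq_0_iff[of "{..l} - {k}" "\<lambda>i. y i * y i"] by auto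
  have "y k \<noteq> 0"
  proof
    assume "y k = 0"
    then have y0: "y i = 0" if "i \<le> l" for i using others[OF that] by (cases "i = k") auto
    \<comment> \<open>Pairing \<chi> k with the regular character gives n! times its degree, while
      \<open>y = 0\<close> would make this pairing vanish.\<close>
    let ?\<nu> = "replicate_mset n (1 :: nat)"
    have "?\<nu> \<in> part n" by (simp add: part_def)
    from yz[OF this] have zk: "z ?\<nu> k = 0" using y0 by simp
    have "(\<Sum>p\<in>perms. (\<Sum>i\<le>l. of_int (if i = k then 1 else 0) * \<chi> i p) * (chi_comb l \<chi> (z ?\<nu>) (inv' p)))
        = fact n * (\<Sum>i\<le>l. of_int (if i = k then 1 else 0) * of_int (z ?\<nu> i))"
      by (rule pairing_coords)
    also have "\<dots> = fact n * (\<Sum>i\<le>l. if i = k then of_int (z ?\<nu> k) else 0)"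
      by (intro arg_cong[of _ _ "(*) _"] sum.cong) auto
    also have "\<dots> = 0" using zk by simp
    finally have "(\<Sum>p\<in>perms. (\<Sum>i\<le>l. of_int (if i = k then 1 else 0) * \<chi> i p) * (chi_comb l \<chi> (z ?\<nu>) (inv' p))) = 0" .
    moreover have "(\<Sum>p\<in>perms. (\<Sum>i\<le>l. of_int (if i = k then 1 else 0) * \<chi> i p) * (chi_comb l \<chi> (z ?\<nu>) (inv' p)))
        = (\<Sum>p\<in>perms. if p = id then \<chi> k id * fact n else 0)"
    proof (rule sum.cong[OF refl])
      fix p assume p: "p \<in> perms"
      have a: "(\<Sum>i\<le>l. of_int (if i = k then 1 else 0) * \<chi> i p) = \<chi> k p"
      proof -
        have "(\<Sum>i\<le>l. of_int (if i = k then 1 else 0) * \<chi> i p) = (\<Sum>i\<le>l. if i = k then \<chi> k p else 0)"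
          by (intro sum.cong) auto
        then show ?thesis using k by simp
      qed
      have "(\<forall>x\<in>{1..n}. p x = x) \<longleftrightarrow> p = id"
        using p by (auto simp: fun_eq_iff) (metis permutes_not_in)
      then have "cf p ?\<nu> {1..n} = (if p = id then fact n else 0)" using cf_ones[of "{1..n}" p] by simp
      then have b: "(chi_comb l \<chi> (z ?\<nu>) (inv' p)) = (if p = id then fact n else 0)"
        using zinv[OF p, of ?\<nu>, symmetric] by simp
      show "(\<Sum>i\<le>l. of_int (if i = k then 1 else 0) * \<chi> i p) * (chi_comb l \<chi> (z ?\<nu>) (inv' p))
          = (if p = id then \<chi> k id * fact n else 0)"
        unfolding a b by simp
    qed
    moreover have "id \<in> perms" by (simp add: permutes_id)
    ultimately have "\<chi> k id = 0" using finite_P by simp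
    moreover obtain d where "d > 0" "\<chi> k id = of_nat d"
      using irr_char_one[OF sym_group_is_group chi_irr[OF k]] by (auto simp: sym_group_one)
    ultimately show False by simp
  qed
  then have "y k = 1" using yk by simp
  have "\<chi> k p = of_int (ch p f {1..n})" if "p \<in> perms" for p
  proof -
    have "(chi_comb l \<chi> y p) = (\<Sum>i\<le>l. if i = k then \<chi> k p else 0)"
      using others \<open>y k = 1\<close> by (intro sum.cong) auto
    then show ?thesis using y[OF that] k by simp
  qed
  then show ?thesis using fL by blast
qed

end

subsection \<open>The critical group\<close>

theorem theorem3:
  fixes n l :: nat and \<chi> :: "nat \<Rightarrow> (nat \<Rightarrow> nat) \<Rightarrow> complex" and M :: "nat \<Rightarrow> nat \<Rightarrow> int"
  assumes "n \<ge> 2"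
    and "bij_betw \<chi> {0..l} (irr_chars (sym_group n))"
    and "\<chi> 0 = (\<lambda>g\<in>carrier (sym_group n). 1)"
    and "\<forall>i\<in>{0..l}. \<forall>g\<in>carrier (sym_group n).
           refl_char n g * \<chi> i g = (\<Sum>j=0..l. of_int (M i j) * \<chi> j g)"
  shows "critical_group l (\<lambda>i j. (if i = j then int (n - 1) else 0) - M i j)
           \<cong> product_group {2..npart n - npart (n - 1)} (\<lambda>i. integer_mod_group (qfac n i))"
proof -
  note bij = assms(2)
  define C where "C i j = (if i = j then int (n - 1) else 0) - M i j" for i j
  define r where "r = npart n - npart (n - 1)"
  let ?P = "{p. p permutes {1..n}}"
  have car: "carrier (sym_group n) = ?P" by (auto simp: sym_group_def)
  obtain x where x: "x 1 = hs n" and pres: "presents n r x"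
    using presentation[OF assms(1)] unfolding r_def by blast
  have xL: "\<And>i. i \<in> {1..r} \<Longrightarrow> x i \<in> Lam n"
    and gen: "\<And>f. f \<in> Lam n \<Longrightarrow> \<exists>c. \<exists>g\<in>Lam n. f = (comb r c x) + lap n g"
    and ind: "\<And>c g. g \<in> Lam n \<Longrightarrow> (comb r c x) = lap n g \<Longrightarrow>
       c 1 = 0 \<and> (\<forall>i\<in>{2..r}. int (qfac n i) dvd c i)"
    and ord: "\<And>i. i \<in> {2..r} \<Longrightarrow> \<exists>g\<in>Lam n. lap n g = of_int (int (qfac n i)) * x i"
    using pres unfolding presents_def by blast+
  have hL: "hs n \<in> Lam n" using assms(1) by (simp add: h_hm part_def)
  obtain f where fL: "\<And>k. k \<le> l \<Longrightarrow> f k \<in> Lam n"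
    and f: "\<And>k p. k \<le> l \<Longrightarrow> p \<in> ?P \<Longrightarrow> \<chi> k p = of_int (ch p (f k) {1..n})"
    using irr_char_in_lattice[OF bij] by metis
  \<comment> \<open>Identifies integer coordinates in the irreducible characters with symmetric
    functions of degree \<open>n\<close>; it is shown to be bijective on the indices up to
    \<open>l\<close>.\<close>
  define \<theta> where "\<theta> z = (\<Sum>k\<le>l. of_int (z k) * f k)" for z
  have \<theta>L: "\<theta> z \<in> Lam n" for z unfolding \<theta>_def using fL by (intro Sp_sum Sp_of_int) auto
  have ch\<theta>: "complex_of_int (ch p (\<theta> z) {1..n}) = (chi_comb l \<chi> z p)" if "p \<in> ?P" for p z
    unfolding \<theta>_def ch_linear of_int_sum of_int_mult using f[OF _ that] by (intro sum.cong refl) simp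
  have ch_eqI: "f1 = f2" if "f1 \<in> Lam n" "f2 \<in> Lam n"
    "\<And>p. p \<in> ?P \<Longrightarrow> complex_of_int (ch p f1 {1..n}) = of_int (ch p f2 {1..n})" for f1 f2
  proof -
    have "f1 - f2 = 0" by (rule ch_injective) (use that in \<open>auto simp del: One_nat_def\<close>)
    then show ?thesis by simp
  qed
  have \<theta>_surj: "\<exists>z. g = \<theta> z" if g: "g \<in> Lam n" for g
  proof -
    obtain z :: "nat \<Rightarrow> int" where "\<And>p. p \<in> ?P \<Longrightarrow> of_int (ch p g {1..n}) = (chi_comb l \<chi> z p)"
      using ch_coords[OF bij g] by blast
    then have "g = \<theta> z" by (intro ch_eqI g \<theta>L) (simp only: ch\<theta>)
    then show ?thesis by blast
  qed
  have \<theta>_inj: "z k = w k" if "\<theta> z = \<theta> w" "k \<le> l" for z w k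
    by (rule chi_independent_int[OF bij _ that(2)]) (simp only: ch\<theta>[symmetric] that(1))
  have \<theta>_add: "\<theta> (\<lambda>k. z k + w k) = \<theta> z + \<theta> w" for z w
    by (simp add: \<theta>_def distrib_right sum.distrib)
  have \<theta>_scale: "\<theta> (\<lambda>k. c * z k) = of_int c * \<theta> z" for c z
    by (simp add: \<theta>_def sum_distrib_left mult.assoc)
  have \<theta>_cong: "\<theta> z = \<theta> w" if "\<And>k. k \<le> l \<Longrightarrow> z k = w k" for z w
    unfolding \<theta>_def using that by (intro sum.cong) auto
  define \<delta> :: "nat \<Rightarrow> int" where "\<delta> k = (if k = 0 then 1 else 0)" for k
  have \<theta>\<delta>: "\<theta> \<delta> = hs n"
  proof (rule ch_eqI[OF \<theta>L hL])
    fix p assume p: "p \<in> ?P"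
    have "(chi_comb l \<chi> \<delta> p) = (\<Sum>k\<le>l. if k = 0 then \<chi> 0 p else 0)"
      by (intro sum.cong) (auto simp: \<delta>_def)
    then show "complex_of_int (ch p (\<theta> \<delta>) {1..n}) = of_int (ch p (hs n) {1..n})"
      using p ch_h_n[of p n] by (simp add: ch\<theta>[OF p] assms(3) car del: One_nat_def)
  qed
  \<comment> \<open>Under this identification the transposed extended McKay-Cartan matrix becomes
    \<open>lap n\<close>; \<open>C\<close> is used here with index 0 included.\<close>
  have lap\<theta>: "lap n (\<theta> y) = \<theta> (\<lambda>i. \<Sum>j\<le>l. C j i * y j)" for y
  proof (rule ch_eqI[OF T_Lam[OF \<theta>L] \<theta>L])
    fix p assume p: "p \<in> ?P"
    have rc: "refl_char n p = of_int (nfix p {1..n}) - 1"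
      using p by (simp add: refl_char_def mat_trace_perm_mat car del: One_nat_def)
    have mult: "of_int (int n - nfix p {1..n}) * \<chi> j p = (\<Sum>i\<le>l. of_int (C j i) * \<chi> i p)" if j: "j \<le> l" for j
    proof -
      have "of_int (int n - nfix p {1..n}) * \<chi> j p = of_int (int (n - 1)) * \<chi> j p - refl_char n p * \<chi> j p"
        using assms(1) by (simp add: rc of_nat_diff algebra_simps)
      also have "refl_char n p * \<chi> j p = (\<Sum>i\<le>l. of_int (M j i) * \<chi> i p)"
        using assms(4) j p by (simp add: car atLeast0AtMost)
      also have "of_int (int (n - 1)) * \<chi> j p = (\<Sum>i\<le>l. if i = j then of_int (int (n - 1)) * \<chi> j p else 0)"
        using j by simp
      also have "\<dots> - (\<Sum>i\<le>l. of_int (M j i) * \<chi> i p) = (\<Sum>i\<le>l. of_int (C j i) * \<chi> i p)"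
        unfolding sum_subtractf[symmetric] by (intro sum.cong) (auto simp: C_def left_diff_distrib)
      finally show ?thesis .
    qed
    have "complex_of_int (ch p (lap n (\<theta> y)) {1..n}) = of_int (int n - nfix p {1..n}) * (chi_comb l \<chi> y p)"
    proof -
      have "p permutes {1..n}" using p by simp
      from ch_T[OF \<theta>L this] show ?thesis by (simp only: of_int_mult ch\<theta>[OF p])
    qed
    also have "\<dots> = (\<Sum>j\<le>l. of_int (y j) * (of_int (int n - nfix p {1..n}) * \<chi> j p))"
      unfolding sum_distrib_left by (intro sum.cong refl) (rule mult.left_commute)
    also have "\<dots> = (\<Sum>j\<le>l. of_int (y j) * (\<Sum>i\<le>l. of_int (C j i) * \<chi> i p))"
      by (intro sum.cong refl) (simp only: mult atMost_iff)
    also have "\<dots> = (\<Sum>i\<le>l. of_int (\<Sum>j\<le>l. C j i * y j) * \<chi> i p)"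
      unfolding of_int_sum of_int_mult sum_distrib_left sum_distrib_right by (subst sum.swap) (simp add: mult_ac)
    finally show "complex_of_int (ch p (lap n (\<theta> y)) {1..n}) = of_int (ch p (\<theta> (\<lambda>i. \<Sum>j\<le>l. C j i * y j)) {1..n})"
      by (simp only: ch\<theta>[OF p])
  qed
  \<comment> \<open>The coordinates of the regular character. It vanishes away from the identity,
    and \<open>n\<close> minus the number of fixed points vanishes at the identity.\<close>
  obtain d where d: "lap n (\<theta> d) = 0" "d 0 = 1"
  proof -
    let ?\<nu> = "replicate_mset n (1 :: nat)"
    have \<nu>: "hm ?\<nu> \<in> Lam n" by (simp add: part_def)
    then obtain d where d: "hm ?\<nu> = \<theta> d" using \<theta>_surj by blast
    have cf: "cf p ?\<nu> {1..n} = (if p = id then fact n else 0)" if p: "p \<in> ?P" for p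
    proof -
      have "(\<forall>x\<in>{1..n}. p x = x) \<longleftrightarrow> p = id" using p by (auto simp: fun_eq_iff) (metis permutes_not_in)
      then show ?thesis using cf_ones[of "{1..n}" p] by simp
    qed
    have "lap n (hm ?\<nu>) = 0"
    proof (rule ch_injective[OF T_Lam[OF \<nu>]])
      fix p assume p: "p permutes {1..n}"
      show "ch p (lap n (hm ?\<nu>)) {1..n} = 0"
      proof (cases "p = id")
        case True
        then have "{x \<in> {1..n}. p x = x} = {1..n}" by auto
        then have "nfix p {1..n} = int n" by (simp add: nfix_def)
        then show ?thesis unfolding ch_T[OF \<nu> p] by simp
      next
        case False
        then have "ch p (hm ?\<nu>) {1..n} = 0" using cf[of p] p by (simp only: ch_linear mem_Collect_eq if_False)
        then show ?thesis unfolding ch_T[OF \<nu> p] by simp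
      qed
    qed
    moreover have "d 0 = 1"
    proof -
      have "(\<Sum>p\<in>?P. (chi_comb l \<chi> d p) * (chi_comb l \<chi> \<delta> (inv' p)))
          = fact n * (\<Sum>i\<le>l. of_int (d i) * of_int (\<delta> i))"
        by (rule pairing_coords[OF bij])
      also have "(\<Sum>i\<le>l. of_int (d i) * of_int (\<delta> i)) = (\<Sum>i\<le>l. if i = 0 then complex_of_int (d 0) else 0)"
        by (intro sum.cong) (auto simp: \<delta>_def)
      finally have "(\<Sum>p\<in>?P. (chi_comb l \<chi> d p) * (chi_comb l \<chi> \<delta> (inv' p))) = fact n * complex_of_int (d 0)"
        by simp
      moreover have "(\<Sum>p\<in>?P. (chi_comb l \<chi> d p) * (chi_comb l \<chi> \<delta> (inv' p)))
          = (\<Sum>p\<in>?P. if p = id then fact n else 0)"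
      proof (rule sum.cong[OF refl])
        fix p assume p: "p \<in> ?P"
        have ip: "inv' p \<in> ?P" using p by (simp add: permutes_inv)
        have "(chi_comb l \<chi> \<delta> (inv' p)) = 1"
          using ch\<theta>[OF ip, of \<delta>] ch_h_n[of "inv' p" n] ip unfolding \<theta>\<delta> by simp
        moreover have "(chi_comb l \<chi> d p) = of_int (cf p ?\<nu> {1..n})"
          using ch\<theta>[OF p, of d] unfolding d[symmetric] ch_linear by (rule sym)
        then have "(chi_comb l \<chi> d p) = (if p = id then fact n else 0)"
          unfolding cf[OF p] by simp
        ultimately show "(chi_comb l \<chi> d p) * (chi_comb l \<chi> \<delta> (inv' p)) = (if p = id then fact n else 0)"
          by simp
      qed
      moreover have "id \<in> ?P" "finite ?P" by (simp_all add: permutes_id finite_permutations)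
      ultimately have "fact n * complex_of_int (d 0) = fact n" by simp
      then show ?thesis by simp
    qed
    ultimately show ?thesis using that[of d] d by simp
  qed
  \<comment> \<open>Coordinates in the generators are chosen arbitrarily; those with index at least
    2 are unique modulo their orders by \<open>ind\<close>.\<close>
  define coef where "coef g = (SOME c. \<exists>g'\<in>Lam n. g = (comb r c x) + lap n g')" for g
  have coef: "\<exists>g'\<in>Lam n. g = (\<Sum>i=1..r. of_int (coef g i) * x i) + lap n g'" if "g \<in> Lam n" for g
    unfolding coef_def using gen[OF that] by (rule someI_ex)
  have coef_cong: "int (qfac n i) dvd coef g i - c i"
    if g: "g = (comb r c x) + lap n g'" "g' \<in> Lam n" and i: "i \<in> {2..r}" for g c g' i
  proof -
    have "(comb r c x) \<in> Lam n" using xL by (intro Sp_sum Sp_of_int) auto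
    then have "g \<in> Lam n" using g T_Lam[of g' n] by auto
    then obtain g'' where g'': "g'' \<in> Lam n" "g = (\<Sum>i=1..r. of_int (coef g i) * x i) + lap n g''"
      using coef by blast
    have "(\<Sum>i=1..r. of_int (coef g i - c i) * x i) = (\<Sum>i=1..r. of_int (coef g i) * x i) - (comb r c x)"
      by (simp add: left_diff_distrib sum_subtractf)
    also have "(\<Sum>i=1..r. of_int (coef g i) * x i) = g - lap n g''"
      unfolding eq_diff_eq by (rule g''(2)[symmetric])
    also have "(comb r c x) = g - lap n g'"
      unfolding eq_diff_eq by (rule g(1)[symmetric])
    also have "g - lap n g'' - (g - lap n g') = lap n (g' - g'')" by simp
    finally show ?thesis using ind[of "g' - g''" "\<lambda>i. coef g i - c i"] g(2) g''(1) i by blast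
  qed
  have r1: "1 \<in> {1..r}"
  proof -
    have "\<exists>m. n = Suc m" using assms(1) by (cases n) auto
    then have "r = card (nopart n)" unfolding r_def by (auto simp: npart_Suc)
    moreover have "{#n#} \<in> nopart n" using assms(1) by (auto simp: nopart_def part_def)
    then have "card (nopart n) > 0" by (auto simp: card_gt_0_iff)
    ultimately show ?thesis by simp
  qed
  let ?H = "product_group {1..l} (\<lambda>_. integer_group)"
  let ?Q = "product_group {2..r} (\<lambda>i. integer_mod_group (qfac n i))"
  have qpos: "qfac n i > 0" for i unfolding qfac_def by (rule prod_pos) auto
  \<comment> \<open>A vector indexed from 1 is completed by 0 at the trivial character. The map
    \<Phi> then reads off the coordinates from 2 on, which discards multiples of h_n.\<close>
  define ext where "ext w = (\<lambda>k::nat. if k = 0 then 0 else w k :: int)" for w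
  define \<Phi> where "\<Phi> w = (\<lambda>i\<in>{2..r}. coef (\<theta> (ext w)) i mod int (qfac n i))" for w
  have \<Phi>_carrier: "\<Phi> w \<in> carrier ?Q" for w
    using qpos by (auto simp: \<Phi>_def carrier_integer_mod_group)
  have hom: "\<Phi> \<in> hom ?H ?Q"
  proof (rule homI)
    fix v w assume vw: "v \<in> carrier ?H" "w \<in> carrier ?H"
    show "\<Phi> v \<in> carrier ?Q" by (rule \<Phi>_carrier)
    let ?u = "v \<otimes>\<^bsub>?H\<^esub> w"
    have "\<theta> (ext ?u) = \<theta> (\<lambda>k. ext v k + ext w k)" by (rule \<theta>_cong) (auto simp: ext_def)
    then have u: "\<theta> (ext ?u) = \<theta> (ext v) + \<theta> (ext w)" by (simp only: \<theta>_add)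
    obtain g1 where g1: "g1 \<in> Lam n" "\<theta> (ext v) = (\<Sum>i=1..r. of_int (coef (\<theta> (ext v)) i) * x i) + lap n g1"
      using coef[OF \<theta>L] by blast
    obtain g2 where g2: "g2 \<in> Lam n" "\<theta> (ext w) = (\<Sum>i=1..r. of_int (coef (\<theta> (ext w)) i) * x i) + lap n g2"
      using coef[OF \<theta>L] by blast
    have "\<theta> (ext ?u) = (\<Sum>i=1..r. of_int (coef (\<theta> (ext v)) i) * x i) + lap n g1 + ((\<Sum>i=1..r. of_int (coef (\<theta> (ext w)) i) * x i) + lap n g2)"
      unfolding u g1(2)[symmetric] g2(2)[symmetric] ..
    then have eq: "\<theta> (ext ?u) = (\<Sum>i=1..r. of_int (coef (\<theta> (ext v)) i + coef (\<theta> (ext w)) i) * x i) + lap n (g1 + g2)"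
      by (simp add: distrib_right sum.distrib add_ac)
    have "coef (\<theta> (ext ?u)) i mod int (qfac n i) = (coef (\<theta> (ext v)) i + coef (\<theta> (ext w)) i) mod int (qfac n i)"
      if "i \<in> {2..r}" for i
      using coef_cong[OF eq _ that] g1 g2 by (auto simp: mod_eq_dvd_iff)
    then show "\<Phi> ?u = \<Phi> v \<otimes>\<^bsub>?Q\<^esub> \<Phi> w"
      unfolding \<Phi>_def by (auto simp: fun_eq_iff restrict_def mod_simps)
  qed
  have surj: "\<Phi> ` carrier ?H = carrier ?Q"
  proof (intro equalityI subsetI)
    fix t assume t: "t \<in> carrier ?Q"
    define c where "c i = (if i = 1 then 0 else t i)" for i :: nat
    have "(comb r c x) \<in> Lam n" using xL by (intro Sp_sum Sp_of_int) auto
    then obtain z where z: "(comb r c x) = \<theta> z" using \<theta>_surj by blast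
    \<comment> \<open>Dropping the coordinate at the trivial character subtracts a multiple of
      \<open>x 1\<close>, so the residues from index 2 on remain those of \<open>t\<close>.\<close>
    define w where "w = restrict z {1..l}"
    have "\<theta> (\<lambda>k. ext w k + z 0 * \<delta> k) = \<theta> z" by (rule \<theta>_cong) (auto simp: ext_def w_def \<delta>_def)
    then have "\<theta> (ext w) = \<theta> z - of_int (z 0) * x 1" unfolding \<theta>_add \<theta>_scale \<theta>\<delta> x by (simp add: eq_diff_eq)
    moreover have "(\<Sum>i=1..r. of_int (if i = 1 then z 0 else 0) * x i) = of_int (z 0) * x 1"
    proof -
      have "(\<Sum>i=1..r. of_int (if i = 1 then z 0 else 0) * x i) = (\<Sum>i=1..r. if i = 1 then of_int (z 0) * x 1 else 0)"
        by (intro sum.cong) auto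
      then show ?thesis using r1 by simp
    qed
    ultimately have "\<theta> (ext w) = (comb r c x) - (\<Sum>i=1..r. of_int (if i = 1 then z 0 else 0) * x i)"
      using z by simp
    then have eq: "\<theta> (ext w) = (\<Sum>i=1..r. of_int (c i - (if i = 1 then z 0 else 0)) * x i) + lap n 0"
      unfolding sum_subtractf[symmetric] left_diff_distrib[symmetric] of_int_diff[symmetric] by simp
    have "coef (\<theta> (ext w)) i mod int (qfac n i) = t i" if i: "i \<in> {2..r}" for i
    proof -
      have "int (qfac n i) dvd coef (\<theta> (ext w)) i - t i" using coef_cong[OF eq _ i] i by (simp add: c_def)
      then have "coef (\<theta> (ext w)) i mod int (qfac n i) = t i mod int (qfac n i)" by (simp add: mod_eq_dvd_iff)
      moreover have "t i \<in> carrier (integer_mod_group (qfac n i))" using t i by auto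
      ultimately show ?thesis using qpos[of i] by (simp add: carrier_integer_mod_group)
    qed
    then have "\<Phi> w = t" using t by (auto simp: \<Phi>_def fun_eq_iff PiE_def extensional_def)
    moreover have "w \<in> carrier ?H" by (simp add: w_def)
    ultimately show "t \<in> \<Phi> ` carrier ?H" by blast
  qed (use \<Phi>_carrier in auto)
  have kernel: "kernel ?H ?Q \<Phi> = {(\<lambda>i\<in>{1..l}. \<Sum>j=1..l. C j i * y j) | y. y \<in> carrier ?H}"
  proof (intro equalityI subsetI)
    fix w assume "w \<in> {(\<lambda>i\<in>{1..l}. \<Sum>j=1..l. C j i * y j) | y. y \<in> carrier ?H}"
    then obtain y where y: "w = (\<lambda>i\<in>{1..l}. \<Sum>j=1..l. C j i * y j)" by blast
    \<comment> \<open>The full image under the extended matrix. Its entry at index 0 is missing from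
      \<open>w\<close>, which again costs only a multiple of \<open>x 1\<close>.\<close>
    define v where "v i = (\<Sum>j\<le>l. C j i * ext y j)" for i
    have sum0: "(\<Sum>j\<le>l. C j i * ext y j) = (\<Sum>j=1..l. C j i * y j)" for i
      by (rule sum.mono_neutral_cong_right) (auto simp: ext_def)
    have vs: "v i = (\<Sum>j=1..l. C j i * y j)" for i unfolding v_def by (rule sum0)
    have "\<theta> (\<lambda>k. ext w k + v 0 * \<delta> k) = \<theta> v"
    proof (rule \<theta>_cong)
      fix k assume "k \<le> l"
      then show "ext w k + v 0 * \<delta> k = v k"
        by (cases "k = 0") (simp_all add: ext_def \<delta>_def y vs)
    qed
    moreover have "\<theta> v = lap n (\<theta> (ext y))" unfolding lap\<theta> v_def ..
    ultimately have "\<theta> (ext w) = lap n (\<theta> (ext y)) - of_int (v 0) * x 1" unfolding \<theta>_add \<theta>_scale \<theta>\<delta> x by (simp add: eq_diff_eq)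
    moreover have "(\<Sum>i=1..r. of_int (if i = 1 then - v 0 else 0) * x i) = - (of_int (v 0) * x 1)"
    proof -
      have "(\<Sum>i=1..r. of_int (if i = 1 then - v 0 else 0) * x i) = (\<Sum>i=1..r. if i = 1 then - (of_int (v 0) * x 1) else 0)"
        by (intro sum.cong) auto
      then show ?thesis using r1 by simp
    qed
    ultimately have eq: "\<theta> (ext w) = (\<Sum>i=1..r. of_int (if i = 1 then - v 0 else 0) * x i) + lap n (\<theta> (ext y))" by simp
    have "coef (\<theta> (ext w)) i mod int (qfac n i) = 0" if "i \<in> {2..r}" for i
      using coef_cong[OF eq \<theta>L that] that by (simp add: dvd_eq_mod_eq_0)
    then have "\<Phi> w = \<one>\<^bsub>?Q\<^esub>" by (auto simp: \<Phi>_def)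
    moreover have "w \<in> carrier ?H" by (simp add: y)
    ultimately show "w \<in> kernel ?H ?Q \<Phi>" by (simp add: kernel_def)
  next
    fix w assume "w \<in> kernel ?H ?Q \<Phi>"
    then have w: "w \<in> carrier ?H" "\<Phi> w = \<one>\<^bsub>?Q\<^esub>" by (auto simp: kernel_def)
    obtain g where g: "g \<in> Lam n" "\<theta> (ext w) = (\<Sum>i=1..r. of_int (coef (\<theta> (ext w)) i) * x i) + lap n g"
      using coef[OF \<theta>L] by blast
    define c where "c = coef (\<theta> (ext w))"
    \<comment> \<open>In the kernel each coordinate is a multiple of the order of its generator, so
      that summand lies in the image of \<open>lap n\<close>.\<close>
    have "\<exists>g\<in>Lam n. lap n g = of_int (c i) * x i" if i: "i \<in> {2..r}" for i
    proof -
      have "c i mod int (qfac n i) = 0" using fun_cong[OF w(2), of i] i by (simp add: \<Phi>_def c_def)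
      then obtain e where e: "c i = int (qfac n i) * e" by (auto simp: mod_eq_0_iff_dvd dvd_def)
      obtain g where g: "g \<in> Lam n" "lap n g = of_int (int (qfac n i)) * x i" using ord[OF i] by blast
      have "lap n (of_int e * g) = of_int (c i) * x i" unfolding T_linear g(2) e by (simp add: mult_ac)
      then show ?thesis using Sp_of_int[OF g(1), of e] by blast
    qed
    then obtain G where G: "\<And>i. i \<in> {2..r} \<Longrightarrow> G i \<in> Lam n \<and> lap n (G i) = of_int (c i) * x i" by metis
    have "(comb r c x) = of_int (c 1) * x 1 + (\<Sum>i=2..r. of_int (c i) * x i)"
      using r1 by (subst sum.atLeast_Suc_atMost) (auto simp: numeral_2_eq_2)
    also have "(\<Sum>i=2..r. of_int (c i) * x i) = lap n (\<Sum>i=2..r. G i)"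
      using G by simp
    finally have "\<theta> (ext w) = of_int (c 1) * hs n + lap n ((\<Sum>i=2..r. G i) + g)"
      using g(2) unfolding c_def[symmetric] x[symmetric] T_linear(2) by (simp only: add.assoc)
    moreover have "(\<Sum>i=2..r. G i) + g \<in> Lam n" using G g(1) by (intro Sp_add Sp_sum) auto
    then obtain y where y: "(\<Sum>i=2..r. G i) + g = \<theta> y" using \<theta>_surj by blast
    ultimately have "\<theta> (ext w) = of_int (c 1) * hs n + lap n (\<theta> y)" by simp
    \<comment> \<open>Because the regular character is in the kernel and has coordinate 1 at index
      0, subtracting \<open>y 0\<close> copies of it makes that coordinate vanish. This justifies
      deleting the row of \<open>C\<close> at index 0, which is a column of the transposed
      matrix.\<close>
    also have "lap n (\<theta> y) = lap n (\<theta> (\<lambda>k. y k + (- y 0) * d k))" unfolding \<theta>_add \<theta>_scale T_linear d(1) by simp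
    also have "lap n (\<theta> (\<lambda>k. y k + (- y 0) * d k)) = \<theta> (\<lambda>i. \<Sum>j\<le>l. C j i * (y j + (- y 0) * d j))"
      by (rule lap\<theta>)
    finally have "\<theta> (ext w) = \<theta> (\<lambda>i. c 1 * \<delta> i + (\<Sum>j\<le>l. C j i * (y j + (- y 0) * d j)))"
      by (simp only: \<theta>_add \<theta>_scale \<theta>\<delta>)
    then have comp: "ext w i = c 1 * \<delta> i + (\<Sum>j\<le>l. C j i * (y j + (- y 0) * d j))" if "i \<le> l" for i
      using that by (rule \<theta>_inj)
    define y' where "y' = (\<lambda>j\<in>{1..l}. y j + (- y 0) * d j)"
    have "w = (\<lambda>i\<in>{1..l}. \<Sum>j=1..l. C j i * y' j)"
    proof
      fix i show "w i = (\<lambda>i\<in>{1..l}. \<Sum>j=1..l. C j i * y' j) i"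
      proof (cases "i \<in> {1..l}")
        case True
        have "(\<Sum>j\<le>l. C j i * (y j + (- y 0) * d j)) = (\<Sum>j=1..l. C j i * y' j)"
          by (rule sum.mono_neutral_cong_right) (auto simp: y'_def d(2) not_le)
        then show ?thesis using comp[of i] True by (simp add: ext_def \<delta>_def)
      next
        case False
        then show ?thesis using w(1) by (auto simp: PiE_def extensional_def)
      qed
    qed
    moreover have "y' \<in> carrier ?H" by (simp add: y'_def)
    ultimately show "w \<in> {(\<lambda>i\<in>{1..l}. \<Sum>j=1..l. C j i * y j) | y. y \<in> carrier ?H}" by blast
  qed
  have "group_hom ?H ?Q \<Phi>"
    using hom by (intro group_hom.intro group_hom_axioms.intro) auto
  then have "?H Mod kernel ?H ?Q \<Phi> \<cong> ?Q" using surj by (rule group_hom.FactGroup_iso)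
  then show ?thesis unfolding kernel unfolding critical_group_def C_def r_def .
qed

end
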